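(* There exist an equilateral triangle $\Delta\subset\mathbb{R}^2$ and a $1$-parameter deformation $\{P_q\}_{q\in[-1/\sqrt2,\,1/\sqrt2]}$ of $\Delta=P_{-1/\sqrt2}$ by axially symmetric pentagons (that is, a family of convex bodies in $\mathbb{R}^2$ containing the origin in their interior, depending continuously on $q$ in the Hausdorff topology, each symmetric with respect to a line, with $P_{-1/\sqrt2}=\Delta$, and such that $P_q$ is a pentagon for $-1/\sqrt2<q<1/\sqrt2$, possibly degenerating to a polygon with fewer vertices at the endpoints) satisfying the following properties. (i) For every $q\in[-1/\sqrt2,1/\sqrt2]$, the function $\mathcal{F}_{P_q}$ has a critical point at the origin $(0,0)\in\mathbb{R}^2\times\mathbb{R}^2$. (ii) The Hessian matrix $\operatorname{Hess}_{(0,0)}\mathcal{F}_{P_0}$ is non-degenerate and non-definite (it is neither positive nor negative definite), so that $P_0$ is a saddle point. (iii) For all $q>-1/\sqrt2$ close enough to $-1/\sqrt2$ we have $$\operatorname{tr}[\operatorname{cov}(P_q)\operatorname{cov}(P_q^\circ)]>\operatorname{tr}[\operatorname{cov}(\Delta)\operatorname{cov}(\Delta^\circ)]=\frac18 .$$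
   Context: For a convex body $K\subset\mathbb{R}^n$ containing the origin in its interior, $K^\circ=\{y\in\mathbb{R}^n\mid \langle x,y\rangle\le 1\ \forall x\in K\}$ is its polar body, $|\cdot|$ is Lebesgue measure, and $\operatorname{vp}(K)=|K|\cdot|K^\circ|$ is the volume product. Define $\mathcal{F}_K(x,\xi)=\operatorname{vp}\big((K^\circ+\xi)^\circ+x\big)$, which is well defined for $(x,\xi)$ in an open neighbourhood of $(0,0)\in\mathbb{R}^n\times\mathbb{R}^n$ (where $0\in\operatorname{int}(K^\circ+\xi)$ and $0\in\operatorname{int}((K^\circ+\xi)^\circ+x)$). For a convex body $K$ with barycenter at the origin, $\operatorname{cov}(K)$ is the symmetric $n\times n$ matrix with entries $\operatorname{cov}(K)_{ij}=\frac1{|K|}\int_K x_ix_j\,dx$. (Here $n=2$. When $\mathcal F_K$ has a critical point at the origin, $K$ and $K^\circ$ have barycenter at the origin, so both covariance matrices are defined.) *)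

theory Defs
  imports "HOL-Analysis.Analysis"
begin

definition convex_body :: "'a::euclidean_space set \<Rightarrow> bool" where
  "convex_body K \<longleftrightarrow> convex K \<and> compact K \<and> interior K \<noteq> {}"

definition polar :: "'a::real_inner set \<Rightarrow> 'a set" where
  "polar K = {y. \<forall>x\<in>K. x \<bullet> y \<le> 1}"

definition vp :: "'a::euclidean_space set \<Rightarrow> real" where
  "vp K = measure lebesgue K * measure lebesgue (polar K)"

text \<open>A total function; only its values near the origin are meaningful. Outside the
  neighbourhood of the origin where the bodies involved contain 0 in their interior,
  a polar may be unbounded and the value is then arbitrary.\<close>
definition FK :: "'a::euclidean_space set \<Rightarrow> 'a \<times> 'a \<Rightarrow> real" where
  "FK K = (\<lambda>(x, \<xi>). vp ((\<lambda>y. y + x) ` polar ((\<lambda>y. y + \<xi>) ` polar K)))"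

text \<open>The matrix of second moments about the origin, normalised by volume. It is the
  covariance matrix when the barycenter of \<open>K\<close> is the origin.\<close>
definition cov :: "(real ^ 'n::finite) set \<Rightarrow> real ^ 'n ^ 'n" where
  "cov K = (\<chi> i j. (LINT x:K|lebesgue. x $ i * x $ j) / measure lebesgue K)"

definition critical_point :: "('a::real_normed_vector \<Rightarrow> real) \<Rightarrow> 'a \<Rightarrow> bool" where
  "critical_point f p \<longleftrightarrow> (f has_derivative (\<lambda>_. 0)) (at p)"

definition saddle_point :: "('a::real_normed_vector \<Rightarrow> real) \<Rightarrow> 'a \<Rightarrow> bool" where
  "saddle_point f p \<longleftrightarrow> critical_point f p \<and>
     (\<forall>e>0. (\<exists>y\<in>ball p e. f y < f p) \<and> (\<exists>z\<in>ball p e. f z > f p))"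

definition twice_differentiable_at :: "('a::real_normed_vector \<Rightarrow> real) \<Rightarrow> 'a \<Rightarrow> bool" where
  "twice_differentiable_at f p \<longleftrightarrow>
     (\<exists>D :: 'a \<Rightarrow> 'a \<Rightarrow>\<^sub>L real.
        (\<forall>\<^sub>F x in nhds p. (f has_derivative blinfun_apply (D x)) (at x)) \<and> D differentiable (at p))"

text \<open>The standard basis of \<open>real ^ 'm \<times> real ^ 'n\<close>, indexed by the sum of the index types.\<close>
definition pair_axis :: "'m::finite + 'n::finite \<Rightarrow> (real ^ 'm) \<times> (real ^ 'n)" where
  "pair_axis k = (case k of Inl i \<Rightarrow> (axis i 1, 0) | Inr j \<Rightarrow> (0, axis j 1))"

text \<open>The matrix of second partial derivatives. Since \<open>frechet_derivative\<close> is unspecified at points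
  of non-differentiability, this is meaningful only under \<open>twice_differentiable_at f p\<close>.\<close>
definition hessian ::
  "((real ^ 'm::finite) \<times> (real ^ 'n::finite) \<Rightarrow> real) \<Rightarrow> (real ^ 'm) \<times> (real ^ 'n)
     \<Rightarrow> real ^ ('m + 'n) ^ ('m + 'n)" where
  "hessian f p = (\<chi> i j.
     frechet_derivative (\<lambda>x. frechet_derivative f (at x) (pair_axis j)) (at p) (pair_axis i))"

definition positive_definite :: "real ^ 'n::finite ^ 'n \<Rightarrow> bool" where
  "positive_definite A \<longleftrightarrow> (\<forall>v. v \<noteq> 0 \<longrightarrow> v \<bullet> (A *v v) > 0)"

definition negative_definite :: "real ^ 'n::finite ^ 'n \<Rightarrow> bool" where
  "negative_definite A \<longleftrightarrow> (\<forall>v. v \<noteq> 0 \<longrightarrow> v \<bullet> (A *v v) < 0)"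

definition equilateral_triangle :: "(real ^ 2) set \<Rightarrow> bool" where
  "equilateral_triangle T \<longleftrightarrow>
     (\<exists>a b c. a \<noteq> b \<and> dist a b = dist b c \<and> dist b c = dist c a \<and> T = convex hull {a, b, c})"

definition convex_ngon :: "nat \<Rightarrow> (real ^ 2) set \<Rightarrow> bool" where
  "convex_ngon k K \<longleftrightarrow>
     polytope K \<and> interior K \<noteq> {} \<and> card {v. v extreme_point_of K} = k"

text \<open>Orthogonal reflection in the line through \<open>p\<close> with unit direction vector \<open>u\<close>.\<close>
definition line_reflection :: "real ^ 2 \<Rightarrow> real ^ 2 \<Rightarrow> real ^ 2 \<Rightarrow> real ^ 2" where
  "line_reflection p u x = 2 *\<^sub>R (p + ((x - p) \<bullet> u) *\<^sub>R u) - x"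

definition axially_symmetric :: "(real ^ 2) set \<Rightarrow> bool" where
  "axially_symmetric K \<longleftrightarrow> (\<exists>p u. norm u = 1 \<and> line_reflection p u ` K = K)"

text \<open>For nonempty bounded sets, where both suprema are over nonempty bounded sets of reals.\<close>
definition hausdorff_dist :: "'a::metric_space set \<Rightarrow> 'a set \<Rightarrow> real" where
  "hausdorff_dist A B = max (SUP a\<in>A. infdist a B) (SUP b\<in>B. infdist b A)"

definition hausdorff_continuous_on ::
  "'t::topological_space set \<Rightarrow> ('t \<Rightarrow> 'a::metric_space set) \<Rightarrow> bool" where
  "hausdorff_continuous_on I P \<longleftrightarrow>
     (\<forall>q\<in>I. ((\<lambda>r. hausdorff_dist (P r) (P q)) \<longlongrightarrow> 0) (at q within I))"

end

theory Submission
  imports Defs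
begin

text \<open>
  For a planar body \<open>M\<close> put \<open>G\<^sub>M(y) = \<integral>\<^sub>M (1 + y \<bullet> z)\<^sup>-\<^sup>3 dz\<close>. The polar of a translate \<open>L + x\<close> is the
  image of the polar of \<open>L\<close> under the projective map \<open>z \<mapsto> z / (1 + x \<bullet> z)\<close>, whose Jacobian is
  \<open>(1 + x \<bullet> z)\<^sup>-\<^sup>3\<close>; so its area is \<open>G\<close> of the polar of \<open>L\<close>, evaluated at \<open>x\<close>
  (\<open>measure_polar_translate\<close>). Using this twice turns the volume product near the origin into
  \<open>G\<^sub>K(\<xi>) u\<^sup>-\<^sup>3 G\<^sub>K\<^sub>\<circ>(x / u)\<close> with \<open>u = 1 + x \<bullet> \<xi>\<close> (\<open>FK_near_origin\<close>), where the index \<open>K\<circ>\<close> stands for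
  the polar body. The functions \<open>G\<close> may be differentiated under the integral sign. Hence the origin
  is critical as soon as both barycenters vanish, and then the Hessian there is
  \<open>3 |K| |K\<circ>|\<close> times the block matrix with rows \<open>(4 cov K\<circ>, -1)\<close> and \<open>(-1, 4 cov K)\<close>
  (\<open>FK_gradient\<close>).

  It is then enough to find a good family of pentagons, and the family below consists of bodies with
  \<open>K\<circ> = -K\<close>. The pentagon with vertices \<open>(0, t)\<close>, \<open>(\<plusminus>a, b)\<close>, \<open>(\<plusminus>c, -1/t)\<close> has this property
  when \<open>a\<^sup>2 = 1 + b\<^sup>2\<close> and \<open>a c = 1 - b/t\<close>: each vertex, reflected in the origin, is then dual to an
  edge (\<open>polar_pentagon\<close>). The two barycenter conditions coincide for such a body, and by symmetry
  only the vertical coordinate matters, so one equation is left. It is the cubic equation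
  \<open>balance t b = 0\<close>. For \<open>1/2 \<le> t\<^sup>2 \<le> 2\<close> it has a unique root, which lies in \<open>[-1/t, t]\<close> and depends
  continuously on \<open>t\<close>. At \<open>t\<^sup>2 = 2\<close> the root is \<open>-1/t\<close>: the vertices of the two lower pairs coincide
  and the body is an equilateral triangle. At \<open>t\<^sup>2 = 1/2\<close> the root is \<open>t\<close> and the triangle reflected
  in the origin appears. The parameter of the family is \<open>q = 1/t - t\<close>.

  Here both covariance matrices are the same diagonal matrix, with entries \<open>\<sigma>\<^sub>x\<close>, \<open>\<sigma>\<^sub>y\<close>. The Hessian
  therefore splits into the two blocks with rows \<open>(4\<sigma>, -1)\<close>, \<open>(-1, 4\<sigma>)\<close>, and it is nondegenerate
  and indefinite if \<open>0 < 4\<sigma> < 1\<close> for both entries. At \<open>t = 1\<close> this follows from the cubic equation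
  together with \<open>b > 47/100\<close> (\<open>moment_deficits_at_center\<close>). The trace in question is
  \<open>\<sigma>\<^sub>x\<^sup>2 + \<sigma>\<^sub>y\<^sup>2\<close>, which exceeds \<open>1/8\<close> if \<open>\<sigma>\<^sub>x + \<sigma>\<^sub>y > 1/2\<close>. In the coordinates \<open>d = 2 - t\<^sup>2\<close> and
  \<open>w = 1 + b t\<close>, which both tend to \<open>0\<close> at the triangle, \<open>\<sigma>\<^sub>x + \<sigma>\<^sub>y - 1/2\<close> is a positive factor times
  \<open>w\<^sup>2 (18 + \<dots>) + d\<^sup>2 (27 + \<dots>)\<close> (\<open>moment_excess\<close>), and this is positive close to the triangle.
\<close>

section \<open>Polar bodies and projective maps\<close>

lemma closed_polar: "closed (polar K)"
proof -
  have "polar K = (\<Inter>x\<in>K. {y. x \<bullet> y \<le> 1})" by (auto simp: polar_def)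
  then show ?thesis by (auto intro: closed_halfspace_le)
qed

lemma convex_polar: "convex (polar K)"
proof -
  have "polar K = (\<Inter>x\<in>K. {y. x \<bullet> y \<le> 1})" by (auto simp: polar_def)
  then show ?thesis by (auto intro: convex_INT convex_halfspace_le)
qed

text \<open>Test the polar inequality on points of the ball in the direction of \<open>y\<close>; the ball is open, so the
  bound is obtained with a factor \<open>u < 1\<close> first.\<close>

lemma norm_le_polar:
  fixes K :: "'a::real_inner set"
  assumes "ball 0 r \<subseteq> K" "r > 0" "y \<in> polar K"
  shows "r * norm y \<le> 1"
proof (rule field_le_mult_one_interval)
  fix u :: real assume u: "0 < u" "u < 1"
  show "u * (r * norm y) \<le> 1"
  proof (cases "y = 0")
    case False
    let ?x = "(u * r / norm y) *\<^sub>R y"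
    have "norm ?x < r" using u assms(2) False by simp
    then have "?x \<in> K" using assms(1) by auto
    then have "?x \<bullet> y \<le> 1" using assms(3) unfolding polar_def by blast
    moreover have "?x \<bullet> y = u * (r * norm y)"
      using False by (simp add: dot_square_norm power2_eq_square)
    ultimately show ?thesis by simp
  qed simp
qed

lemma compact_polar:
  fixes K :: "'a::euclidean_space set"
  assumes "ball 0 r \<subseteq> K" "r > 0"
  shows "compact (polar K)"
proof -
  have "norm y \<le> 1 / r" if "y \<in> polar K" for y
    using norm_le_polar[OF assms that] assms(2) by (simp add: field_simps)
  then have "bounded (polar K)" by (auto simp: bounded_iff)
  then show ?thesis by (simp add: compact_eq_bounded_closed closed_polar)
qed

lemma ball_subset_polar:
  fixes K :: "'a::real_inner set"
  assumes "\<And>x. x \<in> K \<Longrightarrow> norm x \<le> B" "B > 0"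
  shows "ball 0 (1 / B) \<subseteq> polar K"
proof
  fix y :: 'a assume "y \<in> ball 0 (1 / B)"
  then have y: "norm y \<le> 1 / B" by simp
  show "y \<in> polar K" unfolding polar_def
  proof (clarsimp)
    fix x assume "x \<in> K"
    have "x \<bullet> y \<le> norm x * norm y" by (rule norm_cauchy_schwarz)
    also have "\<dots> \<le> B * (1 / B)"
      using assms(1)[OF \<open>x \<in> K\<close>] y assms(2) by (intro mult_mono) auto
    finally show "x \<bullet> y \<le> 1" using assms(2) by simp
  qed
qed

text \<open>A point outside \<open>K\<close> is separated from \<open>K\<close> by a hyperplane. As \<open>0 \<in> K\<close>, that hyperplane misses the
  origin, and its normal vector, suitably scaled, lies in the polar body and excludes the point from
  the bipolar.\<close>

lemma bipolar:
  fixes K :: "'a::euclidean_space set"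
  assumes "convex K" "closed K" "0 \<in> K"
  shows "polar (polar K) = K"
proof
  show "K \<subseteq> polar (polar K)" by (auto simp: polar_def inner_commute)
  show "polar (polar K) \<subseteq> K"
  proof (rule ccontr)
    assume "\<not> polar (polar K) \<subseteq> K"
    then obtain z where z: "z \<in> polar (polar K)" "z \<notin> K" by auto
    obtain a b where ab: "a \<bullet> z < b" "\<And>x. x \<in> K \<Longrightarrow> a \<bullet> x > b"
      using separating_hyperplane_closed_point[OF assms(1,2) z(2)] by auto
    have b: "b < 0" using ab(2)[OF assms(3)] by simp
    have "(1 / b) *\<^sub>R a \<in> polar K"
      unfolding polar_def using ab(2) b
      by (auto simp: inner_commute divide_simps less_imp_le)
    then have "((1 / b) *\<^sub>R a) \<bullet> z \<le> 1" using z(1) unfolding polar_def by blast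
    then have "(a \<bullet> z) / b \<le> 1" by simp
    then show False using ab(1) b by (simp add: divide_simps)
  qed
qed

text \<open>The inequality \<open>(k + x) \<bullet> y \<le> 1\<close> says \<open>k \<bullet> y \<le> 1 - x \<bullet> y\<close>, that is, \<open>y / (1 - x \<bullet> y)\<close> lies in the
  polar of \<open>L\<close>; and \<open>y \<mapsto> y / (1 - x \<bullet> y)\<close> is inverse to \<open>z \<mapsto> z / (1 + x \<bullet> z)\<close>. The ball around the origin
  keeps both denominators positive.\<close>

lemma polar_translate:
  fixes L :: "'a::real_inner set"
  assumes "ball 0 r \<subseteq> L" "norm x < r"
  shows "polar ((\<lambda>y. y + x) ` L) = (\<lambda>z. z /\<^sub>R (1 + x \<bullet> z)) ` polar L"
    and "\<And>z. z \<in> polar L \<Longrightarrow> 1 + x \<bullet> z > 0"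
proof -
  have r: "r > 0" using assms(2) norm_ge_zero[of x] by linarith
  show pos: "1 + x \<bullet> z > 0" if "z \<in> polar L" for z
  proof -
    have rz: "r * norm z \<le> 1" using norm_le_polar[OF assms(1) r that] .
    have "\<bar>x \<bullet> z\<bar> \<le> norm x * norm z" by (rule Cauchy_Schwarz_ineq2)
    moreover have "norm x * norm z < 1"
    proof (cases "z = 0")
      case False
      then have "norm x * norm z < r * norm z" using assms(2) by simp
      then show ?thesis using rz by simp
    qed simp
    ultimately show ?thesis by linarith
  qed
  show "polar ((\<lambda>y. y + x) ` L) = (\<lambda>z. z /\<^sub>R (1 + x \<bullet> z)) ` polar L"
  proof (intro set_eqI iffI)
    fix y assume y: "y \<in> polar ((\<lambda>y. y + x) ` L)"
    then have le: "k \<bullet> y \<le> 1 - x \<bullet> y" if "k \<in> L" for k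
      using that by (auto simp: polar_def inner_add_left)
    have "0 \<in> L" using assms(1) r by auto
    from le[OF this] have "x \<bullet> y \<le> 1" by simp
    moreover have "x \<bullet> y \<noteq> 1"
    proof
      assume 1: "x \<bullet> y = 1"
      have "x \<in> L" using assms by auto
      from le[OF this] 1 show False by simp
    qed
    ultimately have u: "1 - x \<bullet> y > 0" by simp
    let ?z = "y /\<^sub>R (1 - x \<bullet> y)"
    have "k \<bullet> ?z \<le> 1" if "k \<in> L" for k
      using le[OF that] u by (simp add: field_simps)
    then have "?z \<in> polar L" unfolding polar_def by blast
    moreover have "1 + x \<bullet> ?z = 1 / (1 - x \<bullet> y)" using u by (simp add: field_simps)
    then have "y = ?z /\<^sub>R (1 + x \<bullet> ?z)" using u by simp
    ultimately show "y \<in> (\<lambda>z. z /\<^sub>R (1 + x \<bullet> z)) ` polar L" by (intro image_eqI)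
  next
    fix y assume "y \<in> (\<lambda>z. z /\<^sub>R (1 + x \<bullet> z)) ` polar L"
    then obtain z where z: "z \<in> polar L" "y = z /\<^sub>R (1 + x \<bullet> z)" by auto
    note u = pos[OF z(1)]
    have "(k + x) \<bullet> y \<le> 1" if "k \<in> L" for k
    proof -
      have "k \<bullet> z \<le> 1" using z(1) that unfolding polar_def by blast
      then have "(k + x) \<bullet> z \<le> 1 + x \<bullet> z" by (simp add: inner_add_left)
      then show ?thesis using u by (simp add: z(2) field_simps)
    qed
    then show "y \<in> polar ((\<lambda>y. y + x) ` L)" unfolding polar_def by blast
  qed
qed

lemma projective_map_has_derivative:
  fixes x z :: "'a::real_inner"
  assumes "1 + x \<bullet> z \<noteq> 0"
  shows "((\<lambda>z. z /\<^sub>R (1 + x \<bullet> z)) has_derivative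
    (\<lambda>h. h /\<^sub>R (1 + x \<bullet> z) - ((x \<bullet> h) / (1 + x \<bullet> z)\<^sup>2) *\<^sub>R z)) (at z within S)"
proof -
  have "((\<lambda>z. inverse (1 + x \<bullet> z)) has_derivative
      (\<lambda>h. - (inverse (1 + x \<bullet> z) * (x \<bullet> h) * inverse (1 + x \<bullet> z)))) (at z within S)"
    by (rule Deriv.has_derivative_inverse[where f="\<lambda>z. 1 + x \<bullet> z", OF assms])
       (rule has_derivative_eq_rhs, (rule derivative_intros)+, simp)
  from has_derivative_scaleR[OF this has_derivative_ident] show ?thesis
    by (rule has_derivative_eq_rhs) (simp add: fun_eq_iff power2_eq_square divide_inverse mult_ac)
qed

text \<open>The derivative is a rank one perturbation of the homothety by \<open>1 / (1 + x \<bullet> z)\<close>.\<close>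

lemma det_projective_map:
  fixes x z :: "real^2"
  assumes "1 + x \<bullet> z \<noteq> 0"
  shows "det (matrix (\<lambda>h. h /\<^sub>R (1 + x \<bullet> z) - ((x \<bullet> h) / (1 + x \<bullet> z)\<^sup>2) *\<^sub>R z))
           = 1 / (1 + x \<bullet> z) ^ 3"
proof -
  define u where "u = 1 + x \<bullet> z"
  have u: "u \<noteq> 0" "u = 1 + x$1 * z$1 + x$2 * z$2"
    using assms by (auto simp: u_def inner_vec_def sum_2)
  have "det (matrix (\<lambda>h. h /\<^sub>R u - ((x \<bullet> h) / u\<^sup>2) *\<^sub>R z))
     = (1 / u - x$1 / u\<^sup>2 * z$1) * (1 / u - x$2 / u\<^sup>2 * z$2) - (x$2 / u\<^sup>2 * z$1) * (x$1 / u\<^sup>2 * z$2)"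
    by (simp add: det_2 matrix_def inner_axis divide_inverse) (simp add: axis_def)
  also have "\<dots> = (u - (x$1 * z$1 + x$2 * z$2)) / u ^ 3"
    using u(1) by (simp add: field_simps power2_eq_square power3_eq_cube)
  also have "\<dots> = 1 / u ^ 3" using u(2) by simp
  finally show ?thesis by (simp add: u_def)
qed

lemma set_integrable_compact:
  fixes f :: "'a::euclidean_space \<Rightarrow> 'b::{banach,second_countable_topology}"
  assumes "compact M" "continuous_on M f"
  shows "set_integrable lebesgue M f"
proof -
  have "integrable lborel (\<lambda>x. indicator M x *\<^sub>R f x)"
    by (rule borel_integrable_compact[OF assms])
  then show ?thesis
    unfolding set_integrable_def using integrable_completion[of "\<lambda>x. indicator M x *\<^sub>R f x" lborel]
    by (auto dest: borel_measurable_integrable)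
qed

lemma measure_polar_translate:
  fixes L :: "(real^2) set"
  assumes "ball 0 r \<subseteq> L" "norm x < r"
  shows "measure lebesgue (polar ((\<lambda>y. y + x) ` L)) = (LINT z:polar L|lebesgue. 1 / (1 + x \<bullet> z) ^ 3)"
proof -
  note pos = polar_translate(2)[OF assms]
  have r: "r > 0" using assms(2) norm_ge_zero[of x] by linarith
  have comp: "compact (polar L)" by (rule compact_polar[OF assms(1) r])
  let ?g = "\<lambda>z. z /\<^sub>R (1 + x \<bullet> z)"
  let ?g' = "\<lambda>z h. h /\<^sub>R (1 + x \<bullet> z) - ((x \<bullet> h) / (1 + x \<bullet> z)\<^sup>2) *\<^sub>R z"
  have int: "set_integrable lebesgue (polar L) (\<lambda>z. 1 / (1 + x \<bullet> z) ^ 3)"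
    by (intro set_integrable_compact comp continuous_intros) (use pos in force)
  have det: "\<bar>det (matrix (?g' z))\<bar> = 1 / (1 + x \<bullet> z) ^ 3" if "z \<in> polar L" for z
    using pos[OF that] by (subst det_projective_map) auto
  have inj: "inj_on ?g (polar L)"
  proof (rule inj_onI)
    fix z w assume z: "z \<in> polar L" and w: "w \<in> polar L" and eq: "?g z = ?g w"
    have "1 - x \<bullet> ?g z = 1 / (1 + x \<bullet> z)" "1 - x \<bullet> ?g w = 1 / (1 + x \<bullet> w)"
      using pos[OF z] pos[OF w] by (auto simp: field_simps)
    then have "1 + x \<bullet> z = 1 + x \<bullet> w" using eq pos[OF z] pos[OF w] by simp
    then show "z = w" using eq pos[OF z] by simp
  qed
  have "measure lebesgue (?g ` polar L) = integral (polar L) (\<lambda>z. \<bar>det (matrix (?g' z))\<bar>)"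
  proof (rule measure_differentiable_image_eq)
    show "polar L \<in> sets lebesgue" using comp by (simp add: lmeasurable_compact fmeasurableD)
    show "(?g has_derivative ?g' z) (at z within polar L)" if "z \<in> polar L" for z
      using pos[OF that] by (intro projective_map_has_derivative) auto
    show "(\<lambda>z. \<bar>det (matrix (?g' z))\<bar>) integrable_on polar L"
      using set_lebesgue_integral_eq_integral(1)[OF int] det integrable_cong by (metis (mono_tags, lifting))
  qed (rule inj)
  also have "\<dots> = integral (polar L) (\<lambda>z. 1 / (1 + x \<bullet> z) ^ 3)"
    by (rule Henstock_Kurzweil_Integration.integral_cong) (rule det)
  finally show ?thesis
    using set_lebesgue_integral_eq_integral(2)[OF int] polar_translate(1)[OF assms] by simp
qed

section \<open>Derivatives of integrals of ridge functions\<close>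

lemma second_order_remainder:
  fixes \<phi> :: "real \<Rightarrow> real"
  assumes "\<And>s. \<bar>s\<bar> \<le> \<rho> \<Longrightarrow> (\<phi> has_real_derivative \<phi>' s) (at s)"
    and "\<And>s. \<bar>s\<bar> \<le> \<rho> \<Longrightarrow> (\<phi>' has_real_derivative \<phi>'' s) (at s)"
    and "\<And>s. \<bar>s\<bar> \<le> \<rho> \<Longrightarrow> \<bar>\<phi>'' s\<bar> \<le> C"
    and s: "\<bar>s\<bar> \<le> \<rho>" "\<bar>s'\<bar> \<le> \<rho>"
  shows "\<bar>\<phi> s' - \<phi> s - \<phi>' s * (s' - s)\<bar> \<le> C * (s' - s)\<^sup>2"
proof -
  let ?S = "closed_segment s s'"
  have S: "\<bar>u\<bar> \<le> \<rho>" if "u \<in> ?S" for u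
    using that s by (auto simp: closed_segment_eq_real_ivl split: if_splits)
  have C: "C \<ge> 0" using assms(3)[OF s(1)] by linarith
  have d1: "\<bar>\<phi>' u - \<phi>' s\<bar> \<le> C * \<bar>s' - s\<bar>" if u: "u \<in> ?S" for u
  proof -
    have "norm (\<phi>' u - \<phi>' s) \<le> C * norm (u - s)"
      by (rule field_differentiable_bound[where S = ?S and f' = \<phi>''])
         (use u S assms(2,3) in \<open>auto intro: has_field_derivative_at_within\<close>)
    also have "\<dots> \<le> C * \<bar>s' - s\<bar>"
      using u C by (intro mult_left_mono) (auto simp: closed_segment_eq_real_ivl split: if_splits)
    finally show ?thesis by simp
  qed
  have "norm ((\<phi> s' - \<phi>' s * s') - (\<phi> s - \<phi>' s * s)) \<le> (C * \<bar>s' - s\<bar>) * norm (s' - s)"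
  proof (rule field_differentiable_bound[where S = ?S and f' = "\<lambda>u. \<phi>' u - \<phi>' s"
      and f = "\<lambda>u. \<phi> u - \<phi>' s * u"])
    fix u assume "u \<in> ?S"
    have "((\<lambda>u. \<phi> u - \<phi>' s * u) has_field_derivative \<phi>' u - \<phi>' s * 1) (at u within ?S)"
      by (intro DERIV_diff DERIV_cmult DERIV_ident has_field_derivative_at_within[OF assms(1)[OF S[OF \<open>u \<in> ?S\<close>]]])
    then show "((\<lambda>u. \<phi> u - \<phi>' s * u) has_field_derivative \<phi>' u - \<phi>' s) (at u within ?S)" by simp
  qed (use d1 in auto)
  then show ?thesis by (simp add: algebra_simps power2_eq_square abs_mult_self_eq)
qed

text \<open>The integrand is a function of \<open>y \<bullet> z\<close>, up to a weight. Its second order Taylor remainder is bounded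
  by a multiple of \<open>|y' - y|\<^sup>2\<close> uniformly on the bounded set \<open>M\<close>, and this bound survives integration.
  The restriction on \<open>y\<close> keeps \<open>y \<bullet> z\<close> in \<open>[-1/2, 1/2]\<close>, away from the pole of \<open>(1 + s)\<^sup>-\<^sup>k\<close>.\<close>

lemma has_derivative_ridge_integral:
  fixes f :: "'a::euclidean_space \<Rightarrow> 'b::euclidean_space" and \<phi> :: "real \<Rightarrow> real"
  assumes M: "compact M" "\<And>z. z \<in> M \<Longrightarrow> norm z \<le> B" "B > 0"
    and f: "continuous_on M f"
    and \<phi>: "\<And>s. \<bar>s\<bar> \<le> 1 / 2 \<Longrightarrow> (\<phi> has_real_derivative \<phi>' s) (at s)"
    and \<phi>': "\<And>s. \<bar>s\<bar> \<le> 1 / 2 \<Longrightarrow> (\<phi>' has_real_derivative \<phi>'' s) (at s)"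
    and C: "\<And>s. \<bar>s\<bar> \<le> 1 / 2 \<Longrightarrow> \<bar>\<phi>'' s\<bar> \<le> C"
    and y: "norm y < 1 / (2 * B)"
  shows "((\<lambda>y. LINT z:M|lebesgue. \<phi> (y \<bullet> z) *\<^sub>R f z) has_derivative
    (\<lambda>h. LINT z:M|lebesgue. (\<phi>' (y \<bullet> z) * (h \<bullet> z)) *\<^sub>R f z)) (at y)"
proof -
  have range: "\<bar>y' \<bullet> z\<bar> \<le> 1 / 2" if "norm y' < 1 / (2 * B)" "z \<in> M" for y' z
  proof -
    have "\<bar>y' \<bullet> z\<bar> \<le> norm y' * norm z" by (rule Cauchy_Schwarz_ineq2)
    also have "\<dots> \<le> (1 / (2 * B)) * B" using that M by (intro mult_mono) auto
    finally show ?thesis using M(3) by simp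
  qed
  have cont_comp: "continuous_on M (\<lambda>z. \<psi> (y' \<bullet> z))"
    if "norm y' < 1 / (2 * B)" "\<And>s. \<bar>s\<bar> \<le> 1 / 2 \<Longrightarrow> (\<psi> has_real_derivative \<psi>' s) (at s)" for y' \<psi> \<psi>'
  proof (rule continuous_on_compose2[where t = "{s. \<bar>s\<bar> \<le> 1 / 2}" and g = \<psi> and f = "\<lambda>z. y' \<bullet> z"])
    show "continuous_on {s. \<bar>s\<bar> \<le> 1 / 2} \<psi>"
    proof (intro continuous_at_imp_continuous_on ballI)
      fix s :: real assume "s \<in> {s. \<bar>s\<bar> \<le> 1 / 2}"
      then have "(\<psi> has_real_derivative \<psi>' s) (at s)" using that(2) by simp
      then show "isCont \<psi> s" by (rule DERIV_isCont)
    qed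
    show "continuous_on M (\<lambda>z. y' \<bullet> z)"
      by (intro continuous_on_inner continuous_on_const continuous_on_id)
    show "(\<lambda>z. y' \<bullet> z) ` M \<subseteq> {s. \<bar>s\<bar> \<le> 1 / 2}"
    proof
      fix u assume "u \<in> (\<lambda>z. y' \<bullet> z) ` M"
      then obtain z where z: "z \<in> M" and u: "u = y' \<bullet> z" by (rule imageE)
      show "u \<in> {s. \<bar>s\<bar> \<le> 1 / 2}" unfolding u mem_Collect_eq by (rule range[OF that(1) z])
    qed
  qed
  have int0: "set_integrable lebesgue M (\<lambda>z. \<phi> (y' \<bullet> z) *\<^sub>R f z)" if "norm y' < 1 / (2 * B)" for y'
    by (intro set_integrable_compact M continuous_intros cont_comp[OF that \<phi>] f)
  have int1: "set_integrable lebesgue M (\<lambda>z. (\<phi>' (y \<bullet> z) * (h \<bullet> z)) *\<^sub>R f z)" for h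
    by (intro set_integrable_compact M continuous_intros cont_comp[OF y \<phi>'] f)
  let ?G = "\<lambda>y. LINT z:M|lebesgue. \<phi> (y \<bullet> z) *\<^sub>R f z"
  let ?D = "\<lambda>h. LINT z:M|lebesgue. (\<phi>' (y \<bullet> z) * (h \<bullet> z)) *\<^sub>R f z"
  have C0: "C \<ge> 0" using C[of 0] by simp
  let ?K = "C * B\<^sup>2 * (LINT z:M|lebesgue. norm (f z))"
  have lin: "linear ?D"
  proof (rule linearI)
    fix h h' show "?D (h + h') = ?D h + ?D h'"
      by (subst set_integral_add(2)[OF int1 int1, symmetric])
         (simp add: inner_add_left algebra_simps)
  next
    fix r h show "?D (r *\<^sub>R h) = r *\<^sub>R ?D h"
      by (subst set_integral_scaleR_right[symmetric]) (simp add: mult.left_commute mult.assoc)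
  qed
  show ?thesis
  proof (rule has_derivativeI_sandwich[where e = "1 / (2 * B) - norm y" and H = "\<lambda>y'. ?K * norm (y' - y)"])
    show "0 < 1 / (2 * B) - norm y" using y by simp
    show "bounded_linear ?D" using lin by (simp add: linear_conv_bounded_linear)
    show "((\<lambda>y'. ?K * norm (y' - y)) \<longlongrightarrow> 0) (at y)"
      by (rule tendsto_eq_intros refl)+ simp
    fix y' assume "y' \<noteq> y" "dist y' y < 1 / (2 * B) - norm y"
    then have y': "norm y' < 1 / (2 * B)"
      using norm_triangle_ineq[of y "y' - y"] by (simp add: dist_norm)
    have "?G y' - ?G y - ?D (y' - y) = (LINT z:M|lebesgue.
        \<phi> (y' \<bullet> z) *\<^sub>R f z - \<phi> (y \<bullet> z) *\<^sub>R f z - (\<phi>' (y \<bullet> z) * ((y' - y) \<bullet> z)) *\<^sub>R f z)"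
      by (subst set_integral_diff(2)[OF set_integral_diff(1)[OF int0[OF y'] int0[OF y]] int1],
          subst set_integral_diff(2)[OF int0[OF y'] int0[OF y]], rule refl)
    also have "\<dots> = (LINT z:M|lebesgue. (\<phi> (y' \<bullet> z) - \<phi> (y \<bullet> z) - \<phi>' (y \<bullet> z) * (y' \<bullet> z - y \<bullet> z)) *\<^sub>R f z)"
      by (simp only: scaleR_diff_left inner_diff_left)
    also have "norm \<dots> \<le> (LINT z:M|lebesgue. norm ((\<phi> (y' \<bullet> z) - \<phi> (y \<bullet> z) - \<phi>' (y \<bullet> z) * (y' \<bullet> z - y \<bullet> z)) *\<^sub>R f z))"
      unfolding set_lebesgue_integral_def
      by (rule order_trans[OF integral_norm_bound]) (simp add: abs_mult mult.assoc)
    also have "\<dots> \<le> (LINT z:M|lebesgue. (C * B\<^sup>2 * (norm (y' - y))\<^sup>2) * norm (f z))"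
    proof (rule set_integral_mono)
      show "set_integrable lebesgue M (\<lambda>z. norm ((\<phi> (y' \<bullet> z) - \<phi> (y \<bullet> z) - \<phi>' (y \<bullet> z) * (y' \<bullet> z - y \<bullet> z)) *\<^sub>R f z))"
        by (intro set_integrable_compact M continuous_intros cont_comp[OF y \<phi>] cont_comp[OF y' \<phi>]
            cont_comp[OF y \<phi>'] f)
      show "set_integrable lebesgue M (\<lambda>z. C * B\<^sup>2 * (norm (y' - y))\<^sup>2 * norm (f z))"
        by (intro set_integrable_compact M continuous_intros f)
      fix z assume z: "z \<in> M"
      have "\<bar>(y' - y) \<bullet> z\<bar> \<le> norm (y' - y) * B"
        using Cauchy_Schwarz_ineq2[of "y' - y" z] mult_left_mono[OF M(2)[OF z], of "norm (y' - y)"] by simp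
      then have sq: "(y' \<bullet> z - y \<bullet> z)\<^sup>2 \<le> (norm (y' - y) * B)\<^sup>2"
        by (subst abs_le_square_iff[symmetric]) (use M(3) in \<open>simp add: inner_diff_left abs_mult\<close>)
      have "\<bar>\<phi> (y' \<bullet> z) - \<phi> (y \<bullet> z) - \<phi>' (y \<bullet> z) * (y' \<bullet> z - y \<bullet> z)\<bar> \<le> C * (y' \<bullet> z - y \<bullet> z)\<^sup>2"
        by (rule second_order_remainder[OF \<phi> \<phi>' C range[OF y z] range[OF y' z]])
      also have "\<dots> \<le> C * (norm (y' - y) * B)\<^sup>2" by (rule mult_left_mono[OF sq C0])
      also have "\<dots> = C * B\<^sup>2 * (norm (y' - y))\<^sup>2" by (simp add: power_mult_distrib)
      finally show "norm ((\<phi> (y' \<bullet> z) - \<phi> (y \<bullet> z) - \<phi>' (y \<bullet> z) * (y' \<bullet> z - y \<bullet> z)) *\<^sub>R f z)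
          \<le> C * B\<^sup>2 * (norm (y' - y))\<^sup>2 * norm (f z)"
        unfolding norm_scaleR by (rule mult_right_mono) simp
    qed
    also have "\<dots> = ?K * norm (y' - y) * norm (y' - y)"
      by (simp add: power2_eq_square mult_ac)
    finally show "norm (?G y' - ?G y - ?D (y' - y)) / norm (y' - y) \<le> ?K * norm (y' - y)"
      using \<open>y' \<noteq> y\<close> by (simp add: divide_simps)
  qed
qed

lemma inverse_power_has_derivative:
  assumes "\<bar>s\<bar> \<le> 1 / (2::real)"
  shows "((\<lambda>s. c / (1 + s) ^ k) has_real_derivative (- real k * c / (1 + s) ^ Suc k)) (at s)"
proof -
  have s: "1 + s > 0" using assms by linarith
  have "((\<lambda>s. (1 + s) ^ k) has_real_derivative real k * (1 + s) ^ (k - 1) * 1) (at s)"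
    by (rule derivative_eq_intros refl)+ simp
  then have "((\<lambda>s. c / (1 + s) ^ k) has_real_derivative
      (0 * (1 + s) ^ k - c * (real k * (1 + s) ^ (k - 1) * 1)) / ((1 + s) ^ k * (1 + s) ^ k)) (at s)"
    using s by (intro DERIV_divide DERIV_const) auto
  moreover have "(0 * w ^ k - c * (real k * w ^ (k - 1) * 1)) / (w ^ k * w ^ k)
      = - real k * c / w ^ Suc k" if "w > 0" for w :: real
    using that
    by (cases k, simp, simp add: divide_simps, simp add: ring_distribs mult.commute)
  ultimately show ?thesis using s by simp
qed

lemma inverse_power_bound:
  assumes "\<bar>s\<bar> \<le> 1 / (2::real)"
  shows "\<bar>c / (1 + s) ^ k\<bar> \<le> \<bar>c\<bar> * 2 ^ k"
proof -
  have s: "1 + s \<ge> 1 / 2" using assms by linarith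
  then have "(1 / 2) ^ k \<le> (1 + s) ^ k" by (intro power_mono) auto
  then have "1 / (1 + s) ^ k \<le> 2 ^ k" using s by (simp add: field_simps power_one_over)
  then have "\<bar>c\<bar> * (1 / (1 + s) ^ k) \<le> \<bar>c\<bar> * 2 ^ k" by (rule mult_left_mono) simp
  then show ?thesis using s by (simp add: abs_mult)
qed

text \<open>By \<open>measure_polar_translate\<close>, this is the area of the polar of \<open>L + y\<close> if \<open>M\<close> is the polar of \<open>L\<close>.\<close>

definition polar_volume :: "(real^2) set \<Rightarrow> real^2 \<Rightarrow> real" where
  "polar_volume M y = (LINT z:M|lebesgue. 1 / (1 + y \<bullet> z) ^ 3)"

definition polar_volume_grad :: "(real^2) set \<Rightarrow> real^2 \<Rightarrow> real^2" where
  "polar_volume_grad M y = (LINT z:M|lebesgue. (- 3 / (1 + y \<bullet> z) ^ 4) *\<^sub>R z)"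

lemma polar_volume_has_derivative:
  assumes M: "compact M" "\<And>z. z \<in> M \<Longrightarrow> norm z \<le> B" "B > 0" and y: "norm y < 1 / (2 * B)"
  shows "(polar_volume M has_derivative (\<lambda>h. polar_volume_grad M y \<bullet> h)) (at y)"
proof -
  have d: "((\<lambda>y. LINT z:M|lebesgue. (1 / (1 + y \<bullet> z) ^ 3) *\<^sub>R (1::real)) has_derivative
    (\<lambda>h. LINT z:M|lebesgue. ((- 3 / (1 + y \<bullet> z) ^ 4) * (h \<bullet> z)) *\<^sub>R (1::real))) (at y)"
  proof (rule has_derivative_ridge_integral[OF M _ _ _ _ y,
        where \<phi> = "\<lambda>s. 1 / (1 + s) ^ 3" and \<phi>' = "\<lambda>s. - 3 / (1 + s) ^ 4"
          and \<phi>'' = "\<lambda>s. 12 / (1 + s) ^ 5" and C = "12 * 2 ^ 5" and f = "\<lambda>z. 1"])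
    fix s :: real assume s: "\<bar>s\<bar> \<le> 1 / 2"
    show "((\<lambda>s. 1 / (1 + s) ^ 3) has_real_derivative - 3 / (1 + s) ^ 4) (at s)"
      using inverse_power_has_derivative[OF s, of 1 3] by simp
    show "((\<lambda>s. - 3 / (1 + s) ^ 4) has_real_derivative 12 / (1 + s) ^ 5) (at s)"
      using inverse_power_has_derivative[OF s, of "-3" 4] by simp
    show "\<bar>12 / (1 + s) ^ 5\<bar> \<le> 12 * 2 ^ 5"
      using inverse_power_bound[OF s, of 12 5] by simp
  qed (assumption | rule continuous_on_const)+
  have pos: "1 + y \<bullet> z \<noteq> 0" if "z \<in> M" for z
  proof -
    have "\<bar>y \<bullet> z\<bar> \<le> norm y * norm z" by (rule Cauchy_Schwarz_ineq2)
    also have "\<dots> \<le> (1 / (2 * B)) * B" using that y M by (intro mult_mono) auto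
    finally have "\<bar>y \<bullet> z\<bar> \<le> 1 / 2" using M(3) by simp
    then show ?thesis by linarith
  qed
  have int: "set_integrable lebesgue M (\<lambda>z. (- 3 / (1 + y \<bullet> z) ^ 4) *\<^sub>R z)"
    by (intro set_integrable_compact M continuous_intros) (use pos in auto)
  have eq: "(LINT z:M|lebesgue. ((- 3 / (1 + y \<bullet> z) ^ 4) * (h \<bullet> z)) *\<^sub>R (1::real)) = polar_volume_grad M y \<bullet> h" for h
  proof -
    have "polar_volume_grad M y \<bullet> h
        = (\<integral>z. (indicator M z *\<^sub>R ((- 3 / (1 + y \<bullet> z) ^ 4) *\<^sub>R z)) \<bullet> h \<partial>lebesgue)"
      unfolding polar_volume_grad_def set_lebesgue_integral_def
      by (rule integral_inner_left[symmetric]) (rule int[unfolded set_integrable_def])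
    also have "\<dots> = (LINT z:M|lebesgue. ((- 3 / (1 + y \<bullet> z) ^ 4) * (h \<bullet> z)) *\<^sub>R (1::real))"
      unfolding set_lebesgue_integral_def
      by (rule Bochner_Integration.integral_cong[OF refl])
         (simp only: inner_scaleR_left real_scaleR_def mult_1_right inner_commute[of h])
    finally show ?thesis ..
  qed
  have "(\<lambda>y. LINT z:M|lebesgue. (1 / (1 + y \<bullet> z) ^ 3) *\<^sub>R (1::real)) = polar_volume M"
    by (rule ext) (simp add: polar_volume_def)
  then show ?thesis using d unfolding eq by metis
qed

lemma polar_volume_grad_has_derivative:
  assumes M: "compact M" "\<And>z. z \<in> M \<Longrightarrow> norm z \<le> B" "B > 0" and y: "norm y < 1 / (2 * B)"
  shows "(polar_volume_grad M has_derivative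
     (\<lambda>h. LINT z:M|lebesgue. (12 / (1 + y \<bullet> z) ^ 5 * (h \<bullet> z)) *\<^sub>R z)) (at y)"
  unfolding polar_volume_grad_def[abs_def]
proof (rule has_derivative_ridge_integral[OF M _ _ _ _ y,
      where \<phi> = "\<lambda>s. - 3 / (1 + s) ^ 4" and \<phi>' = "\<lambda>s. 12 / (1 + s) ^ 5"
        and \<phi>'' = "\<lambda>s. - 60 / (1 + s) ^ 6" and C = "60 * 2 ^ 6" and f = "\<lambda>z. z"])
  fix s :: real assume s: "\<bar>s\<bar> \<le> 1 / 2"
  show "((\<lambda>s. - 3 / (1 + s) ^ 4) has_real_derivative 12 / (1 + s) ^ 5) (at s)"
    using inverse_power_has_derivative[OF s, of "-3" 4] by simp
  show "((\<lambda>s. 12 / (1 + s) ^ 5) has_real_derivative - 60 / (1 + s) ^ 6) (at s)"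
    using inverse_power_has_derivative[OF s, of 12 5] by simp
  show "\<bar>- 60 / (1 + s) ^ 6\<bar> \<le> 60 * 2 ^ 6"
    using inverse_power_bound[OF s, of 60 6] by simp
qed (assumption | rule continuous_on_id)+

section \<open>The volume product near the origin\<close>

lemma set_integral_translate:
  fixes f :: "'a::euclidean_space \<Rightarrow> real"
  assumes "compact S" "continuous_on ((\<lambda>z. z + \<xi>) ` S) f"
  shows "(LINT z:(\<lambda>z. z + \<xi>) ` S|lebesgue. f z) = (LINT z:S|lebesgue. f (z + \<xi>))"
proof -
  let ?T = "(\<lambda>z. z + \<xi>) ` S"
  have T: "compact ?T" using assms(1) by (intro compact_continuous_image continuous_intros)
  have fm: "(\<lambda>z. indicator ?T z *\<^sub>R f z) \<in> borel_measurable borel"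
    using borel_measurable_integrable[OF borel_integrable_compact[OF T assms(2)]]
    unfolding measurable_lborel2 .
  have gm: "(\<lambda>z. indicator S z *\<^sub>R f (z + \<xi>)) \<in> borel_measurable borel"
    using borel_measurable_integrable[OF borel_integrable_compact[OF assms(1), of "\<lambda>z. f (z + \<xi>)"]]
      continuous_on_compose2[OF assms(2), of S "\<lambda>z. z + \<xi>"] by (simp add: continuous_intros)
  have "(LINT z:?T|lebesgue. f z) = (\<integral>z. indicator ?T z *\<^sub>R f z \<partial>lborel)"
    unfolding set_lebesgue_integral_def by (rule integral_completion) (use fm in simp)
  also have "\<dots> = (\<integral>z. indicator ?T z *\<^sub>R f z \<partial>(distr lborel borel ((+) \<xi>)))"
    by (simp add: lborel_distr_plus)
  also have "\<dots> = (\<integral>z. indicator ?T (\<xi> + z) *\<^sub>R f (\<xi> + z) \<partial>lborel)"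
    by (rule integral_distr) (use fm in auto)
  also have "\<dots> = (\<integral>z. indicator S z *\<^sub>R f (z + \<xi>) \<partial>lborel)"
    by (rule Bochner_Integration.integral_cong) (auto simp: indicator_def add.commute)
  also have "\<dots> = (LINT z:S|lebesgue. f (z + \<xi>))"
    unfolding set_lebesgue_integral_def by (rule integral_completion[symmetric]) (use gm in simp)
  finally show ?thesis .
qed

text \<open>With \<open>L = (K\<circ> + \<xi>)\<circ>\<close>, both factors of the volume product of \<open>L + x\<close> are areas of polars of translates:
  \<open>L\<close> itself is the polar of a translate of \<open>K\<circ>\<close>, and the polar of \<open>L + x\<close> gives an integral over
  \<open>L\<circ> = K\<circ> + \<xi>\<close>. After moving that integral back to \<open>K\<circ>\<close>, its integrand is
  \<open>(1 + x \<bullet> \<xi> + x \<bullet> z)\<^sup>-\<^sup>3\<close>, and \<open>1 + x \<bullet> \<xi>\<close> can be factored out.\<close>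

lemma FK_near_origin:
  fixes K :: "(real^2) set"
  assumes K: "compact K" "convex K" "ball 0 r \<subseteq> K" "r > 0"
  shows "\<forall>\<^sub>F p in nhds 0. FK K p = polar_volume K (snd p) *
    (inverse (1 + fst p \<bullet> snd p) ^ 3 * polar_volume (polar K) (inverse (1 + fst p \<bullet> snd p) *\<^sub>R fst p))"
proof -
  obtain B where B: "B > 0" "\<And>z. z \<in> K \<Longrightarrow> norm z \<le> B"
    using compact_imp_bounded[OF K(1)] bounded_pos by blast
  have K0: "0 \<in> K" using K by auto
  have Kc: "closed K" using K(1) by (rule compact_imp_closed)
  note bip = bipolar[OF K(2) Kc K0]
  have cp: "compact (polar K)" by (rule compact_polar[OF K(3,4)])
  have np: "norm z \<le> 1 / r" if "z \<in> polar K" for z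
    using norm_le_polar[OF K(3,4) that] K(4) by (simp add: field_simps)
  have bp: "ball 0 (1 / B) \<subseteq> polar K" by (rule ball_subset_polar[OF B(2) B(1)])
  let ?e = "min (min (1 / B) (1 / 2)) (1 / (1 / r + 1))"
  have e: "?e > 0" using B(1) K(4) by (simp add: add_pos_pos)
  have "FK K (x, \<xi>) = polar_volume K \<xi> *
     (inverse (1 + x \<bullet> \<xi>) ^ 3 * polar_volume (polar K) (inverse (1 + x \<bullet> \<xi>) *\<^sub>R x))"
    if x: "norm x < ?e" and xi: "norm \<xi> < ?e" for x \<xi> :: "real^2"
  proof -
    let ?L = "polar ((\<lambda>y. y + \<xi>) ` polar K)"
    have "measure lebesgue ((\<lambda>y. y + x) ` ?L) = measure lebesgue ?L"
      using measure_translation[of x ?L] by (simp add: add.commute)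
    also have "\<dots> = polar_volume K \<xi>"
      using measure_polar_translate[OF bp, of \<xi>] xi by (simp add: bip polar_volume_def)
    finally have 1: "measure lebesgue ((\<lambda>y. y + x) ` ?L) = polar_volume K \<xi>" .
    have "ball 0 (1 / (1 / r + 1)) \<subseteq> ?L"
    proof (rule ball_subset_polar)
      show "norm z \<le> 1 / r + 1" if z: "z \<in> (\<lambda>y. y + \<xi>) ` polar K" for z
      proof -
        obtain y where y: "y \<in> polar K" "z = y + \<xi>" using z by auto
        show ?thesis unfolding y(2) using np[OF y(1)] xi norm_triangle_ineq[of y \<xi>] by linarith
      qed
    qed (use K(4) in \<open>simp add: add_pos_pos\<close>)
    then have 2: "measure lebesgue (polar ((\<lambda>y. y + x) ` ?L)) = (LINT z:polar ?L|lebesgue. 1 / (1 + x \<bullet> z) ^ 3)"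
      and pos: "\<And>z. z \<in> polar ?L \<Longrightarrow> 1 + x \<bullet> z > 0"
      using measure_polar_translate[of _ ?L x] polar_translate(2)[of _ ?L x] x by auto
    have "- \<xi> \<in> polar K" using bp xi by auto
    then have "0 \<in> (\<lambda>y. y + \<xi>) ` polar K" by (auto intro!: image_eqI[of _ _ "- \<xi>"])
    moreover have "convex ((\<lambda>y. y + \<xi>) ` polar K)"
      using convex_translation[OF convex_polar[of K], of \<xi>] by (simp add: add.commute)
    moreover have "compact ((\<lambda>y. y + \<xi>) ` polar K)"
      using cp by (intro compact_continuous_image continuous_intros)
    ultimately have 3: "polar ?L = (\<lambda>y. y + \<xi>) ` polar K"
      by (intro bipolar compact_imp_closed)
    let ?u = "1 + x \<bullet> \<xi>"
    have "\<bar>x \<bullet> \<xi>\<bar> \<le> norm x * norm \<xi>" by (rule Cauchy_Schwarz_ineq2)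
    also have "\<dots> \<le> (1 / 2) * (1 / 2)" using x xi by (intro mult_mono) auto
    finally have u: "?u > 0" by linarith
    have "(LINT z:polar ?L|lebesgue. 1 / (1 + x \<bullet> z) ^ 3) = (LINT z:polar K|lebesgue. 1 / (1 + x \<bullet> (z + \<xi>)) ^ 3)"
      unfolding 3 by (rule set_integral_translate[OF cp]) (use pos 3 in \<open>force intro!: continuous_intros\<close>)
    also have "\<dots> = (LINT z:polar K|lebesgue. inverse ?u ^ 3 * (1 / (1 + (inverse ?u *\<^sub>R x) \<bullet> z) ^ 3))"
    proof -
      have eq: "1 + x \<bullet> (z + \<xi>) = ?u * (1 + (inverse ?u *\<^sub>R x) \<bullet> z)" for z
        using u by (simp add: inner_add_right field_simps)
      show ?thesis unfolding eq by (simp add: power_mult_distrib divide_inverse power_inverse)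
    qed
    also have "\<dots> = inverse ?u ^ 3 * polar_volume (polar K) (inverse ?u *\<^sub>R x)"
      unfolding polar_volume_def by (rule set_integral_mult_right)
    finally show ?thesis using 1 2 by (simp add: FK_def vp_def)
  qed
  note * = this
  have **: "FK K p = polar_volume K (snd p) *
    (inverse (1 + fst p \<bullet> snd p) ^ 3 * polar_volume (polar K) (inverse (1 + fst p \<bullet> snd p) *\<^sub>R fst p))"
    if "norm p < ?e" for p
  proof -
    have "norm (fst p) < ?e" "norm (snd p) < ?e"
      using that norm_fst_le[of "fst p" "snd p"] norm_snd_le[of "snd p" "fst p"] by auto
    then show ?thesis using *[of "fst p" "snd p"] by simp
  qed
  show ?thesis
    unfolding eventually_nhds_metric using e ** by (auto simp: dist_norm intro!: exI[of _ ?e])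
qed

section \<open>Gradient and Hessian of the volume product\<close>

text \<open>The gradient of \<open>g(\<xi>) u\<^sup>-\<^sup>3 k(x / u)\<close> with \<open>u = 1 + x \<bullet> \<xi>\<close>, where \<open>gg\<close> and \<open>gk\<close> are the gradients
  of \<open>g\<close> and \<open>k\<close>. Here \<open>v = 1 / u\<close>, and \<open>\<tau>\<close> is minus the derivative of \<open>u\<^sup>-\<^sup>3 k(x / u)\<close> with respect to
  \<open>u\<close>.\<close>

definition product_gradient ::
  "('a::real_inner \<Rightarrow> real) \<Rightarrow> ('a \<Rightarrow> 'a) \<Rightarrow> ('a \<Rightarrow> real) \<Rightarrow> ('a \<Rightarrow> 'a) \<Rightarrow> 'a \<times> 'a \<Rightarrow> 'a \<times> 'a" where
  "product_gradient g gg k gk p =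
    (let x = fst p; \<xi> = snd p; v = inverse (1 + x \<bullet> \<xi>); y = v *\<^sub>R x;
         \<tau> = 3 * v ^ 4 * k y + v ^ 5 * (gk y \<bullet> x)
     in (g \<xi> *\<^sub>R (v ^ 4 *\<^sub>R gk y - \<tau> *\<^sub>R \<xi>), (v ^ 3 * k y) *\<^sub>R gg \<xi> - (g \<xi> * \<tau>) *\<^sub>R x))"

lemma inverse_inner_has_derivative:
  fixes p :: "'a::real_inner \<times> 'a"
  assumes "1 + fst p \<bullet> snd p \<noteq> 0"
  shows "((\<lambda>p. inverse (1 + fst p \<bullet> snd p)) has_derivative
    (\<lambda>h. - (inverse (1 + fst p \<bullet> snd p) * (fst p \<bullet> snd h + fst h \<bullet> snd p) * inverse (1 + fst p \<bullet> snd p)))) (at p)"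
proof (rule Deriv.has_derivative_inverse[where f = "\<lambda>p. 1 + fst p \<bullet> snd p", OF assms])
  have "((\<lambda>p. 1 + fst p \<bullet> snd p) has_derivative (\<lambda>h. 0 + (fst p \<bullet> snd h + fst h \<bullet> snd p))) (at p)"
    by (intro has_derivative_add has_derivative_const has_derivative_inner has_derivative_fst
        has_derivative_snd has_derivative_ident)
  then show "((\<lambda>p. 1 + fst p \<bullet> snd p) has_derivative (\<lambda>h. fst p \<bullet> snd h + fst h \<bullet> snd p)) (at p)"
    by simp
qed

lemma product_has_gradient:
  fixes g k :: "'a::real_inner \<Rightarrow> real"
  assumes u: "1 + fst p \<bullet> snd p \<noteq> 0"
    and g: "(g has_derivative (\<lambda>h. gg (snd p) \<bullet> h)) (at (snd p))"
    and k: "(k has_derivative (\<lambda>h. gk (inverse (1 + fst p \<bullet> snd p) *\<^sub>R fst p) \<bullet> h))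
              (at (inverse (1 + fst p \<bullet> snd p) *\<^sub>R fst p))"
  shows "((\<lambda>p. g (snd p) * (inverse (1 + fst p \<bullet> snd p) ^ 3 * k (inverse (1 + fst p \<bullet> snd p) *\<^sub>R fst p)))
     has_derivative (\<lambda>h. product_gradient g gg k gk p \<bullet> h)) (at p)"
proof -
  obtain x \<xi> where p: "p = (x, \<xi>)" by (cases p)
  define v where "v = inverse (1 + x \<bullet> \<xi>)"
  define y where "y = v *\<^sub>R x"
  note vd = inverse_inner_has_derivative[OF u]
  note yd = has_derivative_scaleR[OF vd has_derivative_fst[OF has_derivative_ident]]
  note kd = has_derivative_compose[OF yd k]
  note v3 = has_derivative_power[OF vd, of 3]
  note gd = has_derivative_compose[OF has_derivative_snd[OF has_derivative_ident] g]
  note d = has_derivative_mult[OF gd has_derivative_mult[OF v3 kd]]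
  show ?thesis
  proof (rule has_derivative_eq_rhs[OF d], rule ext)
    fix h :: "'a \<times> 'a"
    obtain a b where h: "h = (a, b)" by (cases h)
    have "product_gradient g gg k gk p \<bullet> h =
       g \<xi> * (v ^ 4 * (gk y \<bullet> a) - (3 * v ^ 4 * k y + v ^ 5 * (gk y \<bullet> x)) * (\<xi> \<bullet> a))
       + (v ^ 3 * k y * (gg \<xi> \<bullet> b) - g \<xi> * (3 * v ^ 4 * k y + v ^ 5 * (gk y \<bullet> x)) * (x \<bullet> b))"
      by (simp add: product_gradient_def p h Let_def v_def[symmetric] y_def[symmetric]
          inner_diff_left)
    also have "\<dots> = g \<xi> * (v ^ 3 * (gk y \<bullet> (v *\<^sub>R a + (- (v * (x \<bullet> b + a \<bullet> \<xi>) * v)) *\<^sub>R x))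
        + (3 * - (v * (x \<bullet> b + a \<bullet> \<xi>) * v) * v ^ 2) * k y) + (gg \<xi> \<bullet> b) * (v ^ 3 * k y)"
      by (simp add: inner_add_right inner_commute[of \<xi> a] algebra_simps eval_nat_numeral)
    finally show "g (snd p) * (inverse (1 + fst p \<bullet> snd p) ^ 3 *
           (gk (inverse (1 + fst p \<bullet> snd p) *\<^sub>R fst p) \<bullet>
            (inverse (1 + fst p \<bullet> snd p) *\<^sub>R fst h +
             (- (inverse (1 + fst p \<bullet> snd p) * (fst p \<bullet> snd h + fst h \<bullet> snd p) * inverse (1 + fst p \<bullet> snd p))) *\<^sub>R fst p)) +
           (of_nat 3 * - (inverse (1 + fst p \<bullet> snd p) * (fst p \<bullet> snd h + fst h \<bullet> snd p) * inverse (1 + fst p \<bullet> snd p)) *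
            inverse (1 + fst p \<bullet> snd p) ^ (3 - 1)) * k (inverse (1 + fst p \<bullet> snd p) *\<^sub>R fst p)) +
        (gg (snd p) \<bullet> snd h) * (inverse (1 + fst p \<bullet> snd p) ^ 3 * k (inverse (1 + fst p \<bullet> snd p) *\<^sub>R fst p)) =
        product_gradient g gg k gk p \<bullet> h"
      by (simp add: p h v_def y_def)
  qed
qed

text \<open>At the origin \<open>v\<close>, \<open>k(x / u)\<close>, \<open>g(\<xi>)\<close> and \<open>\<tau>\<close> are all stationary, so only the derivatives of the
  two gradients and the terms \<open>\<tau> \<xi>\<close> and \<open>g(\<xi>) \<tau> x\<close> contribute.\<close>

lemma product_gradient_has_derivative_origin:
  fixes g k :: "'a::real_inner \<Rightarrow> real"
  assumes g: "(g has_derivative (\<lambda>h. gg 0 \<bullet> h)) (at 0)" and k: "(k has_derivative (\<lambda>h. gk 0 \<bullet> h)) (at 0)"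
    and gg: "(gg has_derivative Hg) (at 0)" and gk: "(gk has_derivative Hk) (at 0)"
    and z: "gg 0 = 0" "gk 0 = 0"
  shows "(product_gradient g gg k gk has_derivative
    (\<lambda>h. (g 0 *\<^sub>R (Hk (fst h) - (3 * k 0) *\<^sub>R snd h), k 0 *\<^sub>R Hg (snd h) - (3 * g 0 * k 0) *\<^sub>R fst h))) (at 0)"
proof -
  let ?v = "\<lambda>p::'a \<times> 'a. inverse (1 + fst p \<bullet> snd p)"
  let ?y = "\<lambda>p::'a \<times> 'a. ?v p *\<^sub>R fst p"
  have fstd: "(fst has_derivative fst) (at (0::'a \<times> 'a))" and sndd: "(snd has_derivative snd) (at (0::'a \<times> 'a))"
    by (rule has_derivative_fst[OF has_derivative_ident], rule has_derivative_snd[OF has_derivative_ident])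
  have vd: "(?v has_derivative (\<lambda>h. 0)) (at 0)"
    by (rule has_derivative_eq_rhs[OF inverse_inner_has_derivative]) auto
  have vn: "((\<lambda>p. ?v p ^ n) has_derivative (\<lambda>h. 0)) (at 0)" for n
    by (rule has_derivative_eq_rhs[OF has_derivative_power[OF vd]]) auto
  have yd: "(?y has_derivative fst) (at 0)"
    by (rule has_derivative_eq_rhs[OF has_derivative_scaleR[OF vd fstd]]) auto
  have kd: "((\<lambda>p. k (?y p)) has_derivative (\<lambda>h. 0)) (at 0)"
    using has_derivative_compose[OF yd, of k "\<lambda>h. gk 0 \<bullet> h"] k z by simp
  have gkd: "((\<lambda>p. gk (?y p)) has_derivative (\<lambda>h. Hk (fst h))) (at 0)"
    using has_derivative_compose[OF yd, of gk Hk] gk by simp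
  have gd: "((\<lambda>p. g (snd p)) has_derivative (\<lambda>h. 0)) (at (0::'a \<times> 'a))"
    using has_derivative_compose[OF sndd, of g "\<lambda>h. gg 0 \<bullet> h"] g z by simp
  have ggd: "((\<lambda>p. gg (snd p)) has_derivative (\<lambda>h. Hg (snd h))) (at (0::'a \<times> 'a))"
    using has_derivative_compose[OF sndd, of gg Hg] gg by simp
  let ?\<tau> = "\<lambda>p. 3 * ?v p ^ 4 * k (?y p) + ?v p ^ 5 * (gk (?y p) \<bullet> fst p)"
  have \<tau>d: "(?\<tau> has_derivative (\<lambda>h. 0)) (at 0)"
    by (rule has_derivative_eq_rhs[OF has_derivative_add[OF
          has_derivative_mult[OF has_derivative_mult[OF has_derivative_const vn] kd]
          has_derivative_mult[OF vn has_derivative_inner[OF gkd fstd]]]]) (auto simp: z)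
  have A: "((\<lambda>p. g (snd p) *\<^sub>R (?v p ^ 4 *\<^sub>R gk (?y p) - ?\<tau> p *\<^sub>R snd p)) has_derivative
      (\<lambda>h. g 0 *\<^sub>R (Hk (fst h) - (3 * k 0) *\<^sub>R snd h))) (at 0)"
    by (rule has_derivative_eq_rhs[OF has_derivative_scaleR[OF gd has_derivative_diff[OF
          has_derivative_scaleR[OF vn gkd] has_derivative_scaleR[OF \<tau>d sndd]]]]) (auto simp: z)
  have B: "((\<lambda>p. (?v p ^ 3 * k (?y p)) *\<^sub>R gg (snd p) - (g (snd p) * ?\<tau> p) *\<^sub>R fst p) has_derivative
      (\<lambda>h. k 0 *\<^sub>R Hg (snd h) - (3 * g 0 * k 0) *\<^sub>R fst h)) (at 0)"
    by (rule has_derivative_eq_rhs[OF has_derivative_diff[OF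
          has_derivative_scaleR[OF has_derivative_mult[OF vn kd] ggd]
          has_derivative_scaleR[OF has_derivative_mult[OF gd \<tau>d] fstd]]]) (auto simp: z mult_ac)
  show ?thesis
    using has_derivative_Pair[OF A B] by (simp add: product_gradient_def[abs_def] Let_def)
qed

text \<open>Near \<open>p\<close> the partial derivatives of \<open>f\<close> are the components of \<open>G\<close>, so the derivative of \<open>G\<close>
  determines the matrix of second partial derivatives.\<close>

lemma hessian_from_gradient:
  fixes f :: "(real ^ 'm::finite) \<times> (real ^ 'n::finite) \<Rightarrow> real"
  assumes G: "\<forall>\<^sub>F x in nhds p. (f has_derivative (\<lambda>h. G x \<bullet> h)) (at x)"
    and H: "(G has_derivative H) (at p)"
  shows "twice_differentiable_at f p"
    and "hessian f p $ i $ j = H (pair_axis i) \<bullet> pair_axis j"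
proof -
  have "\<forall>\<^sub>F x in nhds p. (f has_derivative blinfun_apply (blinfun_inner_left (G x))) (at x)"
    using G by (rule eventually_mono) (simp add: inner_commute)
  moreover have "(\<lambda>x. blinfun_inner_left (G x)) differentiable (at p)"
    using bounded_linear.has_derivative[OF bounded_linear_blinfun_inner_left H] by (rule differentiableI)
  ultimately show "twice_differentiable_at f p"
    unfolding twice_differentiable_at_def by (intro exI[of _ "\<lambda>x. blinfun_inner_left (G x)"] conjI)
  have ev: "\<forall>\<^sub>F x in nhds p. G x \<bullet> pair_axis j = frechet_derivative f (at x) (pair_axis j)"
    using G by (rule eventually_mono) (metis frechet_derivative_at)
  have "((\<lambda>x. G x \<bullet> pair_axis j) has_derivative (\<lambda>h. H h \<bullet> pair_axis j)) (at p)"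
    by (rule has_derivative_inner_left[OF H])
  then have "((\<lambda>x. frechet_derivative f (at x) (pair_axis j)) has_derivative (\<lambda>h. H h \<bullet> pair_axis j)) (at p)"
    by (rule has_derivative_transform_eventually)
       (use ev eventually_nhds_x_imp_x[OF ev] in \<open>auto simp: eventually_at_filter elim: eventually_mono\<close>)
  from frechet_derivative_at[OF this] show "hessian f p $ i $ j = H (pair_axis i) \<bullet> pair_axis j"
    by (simp add: hessian_def) metis
qed

text \<open>On the line through \<open>p\<close> in direction \<open>v\<close>, the derivative of \<open>f\<close> vanishes at \<open>p\<close> and has positive
  slope there; hence it is positive just after \<open>p\<close>, and \<open>f\<close> increases.\<close>

lemma increase_along_line:
  fixes f :: "'a::real_inner \<Rightarrow> real"
  assumes G: "\<forall>\<^sub>F x in nhds p. (f has_derivative (\<lambda>h. G x \<bullet> h)) (at x)"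
    and H: "(G has_derivative H) (at p)" and G0: "G p = 0" and v: "H v \<bullet> v > 0" and e: "e > 0"
  shows "\<exists>z\<in>ball p e. f z > f p"
proof -
  have v0: "v \<noteq> 0" using v by auto
  obtain d where d: "d > 0" "\<And>x. dist x p < d \<Longrightarrow> (f has_derivative (\<lambda>h. G x \<bullet> h)) (at x)"
    using G unfolding eventually_nhds_metric by blast
  have line: "((\<lambda>r. p + r *\<^sub>R v) has_derivative (\<lambda>r. r *\<^sub>R v)) (at r)" for r :: real
    by (rule has_derivative_eq_rhs[OF has_derivative_add[OF has_derivative_const
          has_derivative_scaleR_left[OF has_derivative_ident]]]) simp
  let ?\<phi>' = "\<lambda>r. G (p + r *\<^sub>R v) \<bullet> v"
  have "((\<lambda>r. G (p + r *\<^sub>R v)) has_derivative (\<lambda>r. H (r *\<^sub>R v))) (at 0)"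
    using has_derivative_compose[OF line[of 0], of G H] H by simp
  from has_derivative_inner_left[OF this, of v]
  have "(?\<phi>' has_derivative (\<lambda>r. H (r *\<^sub>R v) \<bullet> v)) (at 0)" .
  moreover have "H (r *\<^sub>R v) \<bullet> v = (H v \<bullet> v) * r" for r
    using linear_scale[OF has_derivative_linear[OF H]] by simp
  ultimately have "DERIV ?\<phi>' 0 :> H v \<bullet> v" by (simp add: has_field_derivative_def)
  from DERIV_pos_inc_right[OF this v] obtain d' where d': "d' > 0" "\<And>r. 0 < r \<Longrightarrow> r < d' \<Longrightarrow> ?\<phi>' r > 0"
    using G0 by auto
  define m where "m = min d' (min (d / norm v) (e / norm v))"
  \<comment> \<open>halving keeps \<open>p + s v\<close> strictly inside all three neighbourhoods\<close>
  define s where "s = m / 2"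
  have m: "m > 0" "m \<le> d'" "m \<le> d / norm v" "m \<le> e / norm v" using d d' e v0 by (auto simp: m_def)
  then have sm: "0 < s" "s < m" by (auto simp: s_def)
  then have "s < d'" "s < d / norm v" "s < e / norm v" using m by linarith+
  then have s: "0 < s" "s < d'" "s * norm v < d" "s * norm v < e"
    using sm v0 by (auto simp: pos_less_divide_eq)
  have fd: "DERIV (\<lambda>r. f (p + r *\<^sub>R v)) r :> ?\<phi>' r" if r: "0 \<le> r" "r \<le> s" for r
  proof -
    have "r * norm v \<le> s * norm v" using r by (intro mult_right_mono) auto
    then have "dist (p + r *\<^sub>R v) p < d" using s r by (simp add: dist_norm)
    from has_derivative_compose[OF line d(2)[OF this]]
    show ?thesis by (simp add: has_field_derivative_def mult_commute_abs)
  qed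
  have "f (p + 0 *\<^sub>R v) < f (p + s *\<^sub>R v)"
  proof (rule DERIV_pos_imp_increasing_open[OF s(1)])
    show "\<exists>l. DERIV (\<lambda>r. f (p + r *\<^sub>R v)) r :> l \<and> 0 < l" if "0 < r" "r < s" for r
      using fd[of r] d'(2)[of r] that s by auto
    show "continuous_on {0..s} (\<lambda>r. f (p + r *\<^sub>R v))"
      by (intro continuous_at_imp_continuous_on ballI) (use fd DERIV_isCont in auto)
  qed
  then show ?thesis using s by (intro bexI[of _ "p + s *\<^sub>R v"]) (auto simp: dist_norm)
qed

lemma saddle_point_from_gradient:
  fixes f :: "'a::real_inner \<Rightarrow> real"
  assumes G: "\<forall>\<^sub>F x in nhds p. (f has_derivative (\<lambda>h. G x \<bullet> h)) (at x)"
    and H: "(G has_derivative H) (at p)" and G0: "G p = 0"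
    and v: "H v \<bullet> v > 0" and w: "H w \<bullet> w < 0"
  shows "saddle_point f p"
  unfolding saddle_point_def critical_point_def
proof (intro conjI allI impI)
  show "(f has_derivative (\<lambda>_. 0)) (at p)" using eventually_nhds_x_imp_x[OF G] G0 by simp
  fix e :: real assume e: "e > 0"
  show "\<exists>z\<in>ball p e. f z > f p" by (rule increase_along_line[OF G H G0 v e])
  have "\<forall>\<^sub>F x in nhds p. ((\<lambda>x. - f x) has_derivative (\<lambda>h. (- G x) \<bullet> h)) (at x)"
    using G by (rule eventually_mono) (auto dest: has_derivative_minus)
  from increase_along_line[OF this has_derivative_minus[OF H] _ _ e, of w] G0 w
  show "\<exists>y\<in>ball p e. f y < f p" by auto
qed

lemma polar_volume_0: "compact M \<Longrightarrow> polar_volume M 0 = measure lebesgue M"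
  unfolding polar_volume_def set_lebesgue_integral_def by simp

lemma polar_volume_grad_0: "polar_volume_grad M 0 = (- 3) *\<^sub>R (LINT z:M|lebesgue. z)"
  unfolding polar_volume_grad_def set_lebesgue_integral_def
  by (subst integral_scaleR_right[symmetric]) (simp add: mult.commute)

text \<open>If both barycenters are at the origin, the second derivative of \<open>F\<^sub>K\<close> at the origin consists of the
  second moments of the two bodies, from the functions \<open>G\<close>, and of multiples of the identity that
  couple \<open>x\<close> and \<open>\<xi>\<close>, from \<open>u = 1 + x \<bullet> \<xi>\<close>. The factor \<open>12\<close> is the second derivative of \<open>(1 + s)\<^sup>-\<^sup>3\<close> at
  \<open>0\<close>.\<close>

theorem FK_gradient:
  fixes K :: "(real^2) set"
  assumes K: "compact K" "convex K" "ball 0 r \<subseteq> K" "r > 0"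
    and bary: "(LINT z:K|lebesgue. z) = 0" "(LINT z:polar K|lebesgue. z) = 0"
  obtains G where "\<forall>\<^sub>F p in nhds 0. (FK K has_derivative (\<lambda>h. G p \<bullet> h)) (at p)"
    "G 0 = 0"
    "(G has_derivative (\<lambda>h.
       (measure lebesgue K *\<^sub>R ((LINT z:polar K|lebesgue. (12 * (fst h \<bullet> z)) *\<^sub>R z)
           - (3 * measure lebesgue (polar K)) *\<^sub>R snd h),
        measure lebesgue (polar K) *\<^sub>R (LINT z:K|lebesgue. (12 * (snd h \<bullet> z)) *\<^sub>R z)
           - (3 * measure lebesgue K * measure lebesgue (polar K)) *\<^sub>R fst h))) (at 0)"
proof -
  have cp: "compact (polar K)" by (rule compact_polar[OF K(3,4)])
  obtain B where B: "B > 0" "\<And>z. z \<in> K \<Longrightarrow> norm z \<le> B"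
    using compact_imp_bounded[OF K(1)] bounded_pos by blast
  obtain C where C: "C > 0" "\<And>z. z \<in> polar K \<Longrightarrow> norm z \<le> C"
    using compact_imp_bounded[OF cp] bounded_pos by blast
  let ?g = "polar_volume K" and ?gg = "polar_volume_grad K"
  let ?k = "polar_volume (polar K)" and ?gk = "polar_volume_grad (polar K)"
  let ?u = "\<lambda>p::(real^2) \<times> (real^2). 1 + fst p \<bullet> snd p"
  let ?F = "\<lambda>p. ?g (snd p) * (inverse (?u p) ^ 3 * ?k (inverse (?u p) *\<^sub>R fst p))"
  let ?G = "product_gradient ?g ?gg ?k ?gk"
  note dg = polar_volume_has_derivative[OF K(1) B(2,1)]
  note dk = polar_volume_has_derivative[OF cp C(2,1)]
  note dgg = polar_volume_grad_has_derivative[OF K(1) B(2,1), of 0]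
  note dgk = polar_volume_grad_has_derivative[OF cp C(2,1), of 0]
  have z: "?gg 0 = 0" "?gk 0 = 0" by (simp_all add: polar_volume_grad_0 bary)
  have near: "\<forall>\<^sub>F p in nhds 0. f p < e" if "isCont f 0" "f 0 < e"
    for f :: "(real^2) \<times> (real^2) \<Rightarrow> real" and e
    unfolding eventually_nhds_conv_at using that(2) order_tendstoD(2)[OF that(1)[unfolded isCont_def]] by auto
  have ev1: "\<forall>\<^sub>F p in nhds 0. - ?u p < 0"
    by (rule near) (auto intro!: continuous_intros)
  have ev2: "\<forall>\<^sub>F p::(real^2) \<times> (real^2) in nhds 0. norm (snd p) < 1 / (2 * B)"
    by (rule near) (use B in \<open>auto intro!: continuous_intros\<close>)
  have ev3: "\<forall>\<^sub>F p in nhds 0. norm (inverse (?u p) *\<^sub>R fst p) < 1 / (2 * C)"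
    by (rule near) (use C in \<open>auto intro!: continuous_intros\<close>)
  have ev4: "\<forall>\<^sub>F p in nhds 0. \<forall>\<^sub>F x in nhds p. FK K x = ?F x"
    using FK_near_origin[OF K] by (simp add: eventually_eventually)
  have "\<forall>\<^sub>F p in nhds 0. (FK K has_derivative (\<lambda>h. ?G p \<bullet> h)) (at p)"
    using ev1 ev2 ev3 ev4
  proof eventually_elim
    case (elim p)
    have d: "(?F has_derivative (\<lambda>h. ?G p \<bullet> h)) (at p)"
      by (rule product_has_gradient) (use elim dg dk in auto)
    show ?case
    proof (rule has_derivative_transform_eventually[OF d])
      show "\<forall>\<^sub>F x in at p. ?F x = FK K x"
        using elim(4) unfolding eventually_nhds_conv_at by (auto elim: eventually_mono)
      show "?F p = FK K p" using eventually_nhds_x_imp_x[OF elim(4)] by simp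
    qed simp
  qed
  moreover have "?G 0 = 0" by (simp add: product_gradient_def z Let_def zero_prod_def)
  moreover have "(?G has_derivative (\<lambda>h.
       (measure lebesgue K *\<^sub>R ((LINT z:polar K|lebesgue. (12 * (fst h \<bullet> z)) *\<^sub>R z)
           - (3 * measure lebesgue (polar K)) *\<^sub>R snd h),
        measure lebesgue (polar K) *\<^sub>R (LINT z:K|lebesgue. (12 * (snd h \<bullet> z)) *\<^sub>R z)
           - (3 * measure lebesgue K * measure lebesgue (polar K)) *\<^sub>R fst h))) (at 0)"
    using product_gradient_has_derivative_origin[OF dg dk dgg dgk z] B(1) C(1)
    by (simp add: polar_volume_0[OF K(1)] polar_volume_0[OF cp])
  ultimately show ?thesis by (rule that)
qed

section \<open>Moments of trapezoids\<close>

lemma set_integral_reflect: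
  fixes f :: "'a::euclidean_space \<Rightarrow> real"
  assumes "compact S" "continuous_on UNIV f"
  shows "(LINT z:uminus ` S|lebesgue. f z) = (LINT z:S|lebesgue. f (- z))"
proof -
  let ?T = "uminus ` S"
  have cf: "continuous_on A f" for A by (rule continuous_on_subset[OF assms(2)]) auto
  have cg: "continuous_on A (\<lambda>z. f (- z))" for A
    by (rule continuous_on_compose2[OF assms(2)]) (auto intro: continuous_intros)
  have T: "compact ?T" using assms(1) by (rule compact_negations)
  have fm: "(\<lambda>z. indicator ?T z *\<^sub>R f z) \<in> borel_measurable borel"
    using borel_measurable_integrable[OF borel_integrable_compact[OF T cf]]
    unfolding measurable_lborel2 .
  have gm: "(\<lambda>z. indicator S z *\<^sub>R f (- z)) \<in> borel_measurable borel"
    using borel_measurable_integrable[OF borel_integrable_compact[OF assms(1) cg]]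
    unfolding measurable_lborel2 .
  have refl: "distr lborel borel uminus = (lborel :: 'a measure)"
    using lborel_affine[of "-1" "0::'a"] by (simp add: density_1)
  have "(LINT z:?T|lebesgue. f z) = (\<integral>z. indicator ?T z *\<^sub>R f z \<partial>lborel)"
    unfolding set_lebesgue_integral_def by (rule integral_completion) (use fm in simp)
  also have "\<dots> = (\<integral>z. indicator ?T z *\<^sub>R f z \<partial>(distr lborel borel uminus))"
    by (simp add: refl)
  also have "\<dots> = (\<integral>z. indicator ?T (- z) *\<^sub>R f (- z) \<partial>lborel)"
    by (rule integral_distr) (use fm in auto)
  also have "\<dots> = (\<integral>z. indicator S z *\<^sub>R f (- z) \<partial>lborel)"
    by (rule Bochner_Integration.integral_cong) (auto simp: indicator_def)
  also have "\<dots> = (LINT z:S|lebesgue. f (- z))"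
    unfolding set_lebesgue_integral_def by (rule integral_completion[symmetric]) (use gm in simp)
  finally show ?thesis .
qed

lemma vector_integral_component:
  fixes f :: "real^2 \<Rightarrow> real^2"
  assumes "compact S" "continuous_on UNIV f"
  shows "(LINT z:S|lebesgue. f z) $ i = (LINT z:S|lebesgue. f z $ i)"
proof -
  have "set_integrable lebesgue S f"
    by (rule set_integrable_compact[OF assms(1) continuous_on_subset[OF assms(2)]]) simp
  from integral_bounded_linear[OF bounded_linear_vec_nth this[unfolded set_integrable_def]]
  show ?thesis by (simp add: set_lebesgue_integral_def)
qed

lemma Basis_real2: "(Basis :: (real^2) set) = {axis 1 1, axis 2 1}"
  unfolding Basis_vec_def by (auto simp: UNIV_2)

lemma vector_measurable: "(\<lambda>(x, y). vector [x, y] :: real^2) \<in> borel_measurable (lborel \<Otimes>\<^sub>M lborel)"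
proof -
  have "continuous_on UNIV (\<lambda>p::real \<times> real. (\<chi> i. if i = 1 then fst p else snd p) :: real^2)"
  proof (rule continuous_on_vec_lambda)
    fix i :: 2
    show "continuous_on UNIV (\<lambda>p::real \<times> real. if i = 1 then fst p else snd p)"
      by (cases "i = 1") (auto intro: continuous_intros)
  qed
  moreover have "(\<lambda>p. (\<chi> i. if i = 1 then fst p else snd p) :: real^2) = (\<lambda>(x, y). vector [x, y] :: real^2)"
    by (auto simp: fun_eq_iff vec_eq_iff forall_2)
  ultimately have "continuous_on UNIV (\<lambda>(x::real, y). vector [x, y] :: real^2)" by metis
  then have "(\<lambda>(x, y). vector [x, y] :: real^2) \<in> borel_measurable borel"
    by (rule borel_measurable_continuous_onI)
  then show ?thesis by (simp add: lborel_prod)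
qed

lemma lborel_real2: "distr (lborel \<Otimes>\<^sub>M lborel) borel (\<lambda>(x, y). vector [x, y] :: real^2) = lborel"
proof (rule lborel_eqI[symmetric])
  fix l u :: "real^2" assume lu: "\<And>b. b \<in> Basis \<Longrightarrow> l \<bullet> b \<le> u \<bullet> b"
  have le: "l$1 \<le> u$1" "l$2 \<le> u$2" using lu[of "axis 1 1"] lu[of "axis 2 1"] by (auto simp: inner_axis Basis_real2)
  have "(\<lambda>(x, y). vector [x, y] :: real^2) -` box l u \<inter> space (lborel \<Otimes>\<^sub>M lborel) = {l$1<..<u$1} \<times> {l$2<..<u$2}"
    by (auto simp: mem_box_cart forall_2 space_pair_measure)
  then have "emeasure (distr (lborel \<Otimes>\<^sub>M lborel) borel (\<lambda>(x, y). vector [x, y] :: real^2)) (box l u)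
      = emeasure (lborel \<Otimes>\<^sub>M lborel) ({l$1<..<u$1} \<times> {l$2<..<u$2})"
    by (simp add: emeasure_distr vector_measurable)
  also have "\<dots> = ennreal (u$1 - l$1) * ennreal (u$2 - l$2)"
    using le by (subst lborel.emeasure_pair_measure_Times) auto
  also have "\<dots> = ennreal (\<Prod>b\<in>Basis. (u - l) \<bullet> b)"
    using le by (simp add: Basis_real2 axis_eq_axis inner_axis ennreal_mult[symmetric])
  finally show "emeasure (distr (lborel \<Otimes>\<^sub>M lborel) borel (\<lambda>(x, y). vector [x, y] :: real^2)) (box l u)
      = (\<Prod>b\<in>Basis. (u - l) \<bullet> b)" .
qed simp

text \<open>Fubini's theorem, with the horizontal coordinate integrated first. It is transported along the
  measure isomorphism between \<open>\<real> \<times> \<real>\<close> and the vectors of length two.\<close>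

lemma set_integral_iterated:
  fixes f :: "real^2 \<Rightarrow> real"
  assumes "compact S" "continuous_on UNIV f"
  shows "(LINT z:S|lebesgue. f z)
    = (\<integral>y. (\<integral>x. indicator S (vector [x, y]) * f (vector [x, y]) \<partial>lborel) \<partial>lborel)"
proof -
  let ?v = "\<lambda>(x, y). vector [x, y] :: real^2"
  have int: "integrable lborel (\<lambda>z. indicator S z *\<^sub>R f z)"
    by (rule borel_integrable_compact[OF assms(1) continuous_on_subset[OF assms(2)]]) auto
  then have fm: "(\<lambda>z. indicator S z *\<^sub>R f z) \<in> borel_measurable borel"
    using borel_measurable_integrable measurable_lborel2 by blast
  have "(LINT z:S|lebesgue. f z) = (\<integral>z. indicator S z *\<^sub>R f z \<partial>lborel)"
    unfolding set_lebesgue_integral_def by (rule integral_completion) (use fm in simp)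
  also have "\<dots> = (\<integral>z. indicator S z *\<^sub>R f z \<partial>(distr (lborel \<Otimes>\<^sub>M lborel) borel ?v))"
    by (simp add: lborel_real2)
  also have "\<dots> = (\<integral>p. indicator S (?v p) *\<^sub>R f (?v p) \<partial>(lborel \<Otimes>\<^sub>M lborel))"
    by (rule integral_distr[OF vector_measurable fm])
  also have "\<dots> = (\<integral>(x, y). indicator S (vector [x, y]) * f (vector [x, y]) \<partial>(lborel \<Otimes>\<^sub>M lborel))"
    by (simp add: case_prod_unfold)
  also have "\<dots> = (\<integral>y. (\<integral>x. indicator S (vector [x, y]) * f (vector [x, y]) \<partial>lborel) \<partial>lborel)"
  proof (rule lborel_pair.integral_snd[symmetric])
    have "integrable (distr (lborel \<Otimes>\<^sub>M lborel) borel ?v) (\<lambda>z. indicator S z *\<^sub>R f z)"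
      using int by (simp add: lborel_real2)
    from integrable_distr[OF vector_measurable this]
    show "integrable (lborel \<Otimes>\<^sub>M lborel) (\<lambda>(x, y). indicator S (vector [x, y]) * f (vector [x, y]))"
      by (simp add: case_prod_unfold)
  qed
  finally show ?thesis .
qed

text \<open>The trapezoid with horizontal sides at the heights \<open>p\<close> and \<open>r\<close>, centred on the vertical axis, of
  half widths \<open>u\<close> and \<open>v\<close>. The parameter \<open>s\<close> avoids a division, so the definition makes sense for
  \<open>p = r\<close> too, which occurs when the pentagon becomes a triangle.\<close>

definition trapezoid :: "real \<Rightarrow> real \<Rightarrow> real \<Rightarrow> real \<Rightarrow> (real^2) set" where
  "trapezoid p r u v = {z. \<exists>s\<in>{0..1}. z$2 = p + s * (r - p) \<and> \<bar>z$1\<bar> \<le> u + s * (v - u)}"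

lemma compact_trapezoid:
  assumes "0 \<le> u" "0 \<le> v"
  shows "compact (trapezoid p r u v)"
proof -
  let ?D = "{0..1::real} \<times> {-1..1::real}"
  let ?g = "\<lambda>q. (\<chi> i. if i = 1 then snd q * (u + fst q * (v - u)) else p + fst q * (r - p)) :: real^2"
  have cg: "continuous_on ?D ?g"
  proof (rule continuous_on_vec_lambda)
    fix i :: 2
    show "continuous_on ?D (\<lambda>q. if i = 1 then snd q * (u + fst q * (v - u)) else p + fst q * (r - p))"
      by (cases "i = 1") (simp_all add: continuous_intros)
  qed
  have "compact ?D" by (intro compact_Times compact_Icc)
  with cg have "compact (?g ` ?D)" by (rule compact_continuous_image)
  moreover have "?g ` ?D = trapezoid p r u v"
  proof (intro set_eqI iffI)
    fix z assume "z \<in> trapezoid p r u v"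
    then obtain s where s: "s \<in> {0..1}" "z$2 = p + s * (r - p)" "\<bar>z$1\<bar> \<le> u + s * (v - u)"
      by (auto simp: trapezoid_def)
    define w where "w = u + s * (v - u)"
    define x where "x = (if w = 0 then 0 else z$1 / w)"
    have x: "z$1 = x * w" "x \<in> {-1..1}"
      using s(3) unfolding w_def[symmetric] by (auto simp: x_def abs_le_iff divide_le_eq le_divide_eq)
    have "z = ?g (s, x)" using s(2) x(1) by (simp add: vec_eq_iff forall_2 w_def)
    then show "z \<in> ?g ` ?D" using s(1) x(2) by (intro image_eqI[of _ _ "(s, x)"]) auto
  next
    fix z assume "z \<in> ?g ` ?D"
    then obtain q where q: "q \<in> ?D" and z: "z = ?g q" by (rule imageE)
    have w: "0 \<le> u + fst q * (v - u)"
    proof -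
      have "0 \<le> (1 - fst q) * u + fst q * v" using q assms by (intro add_nonneg_nonneg mult_nonneg_nonneg) auto
      then show ?thesis by (simp add: algebra_simps)
    qed
    have "\<bar>z$1\<bar> = \<bar>snd q\<bar> * (u + fst q * (v - u))" using w by (simp add: z abs_mult)
    also have "\<dots> \<le> 1 * (u + fst q * (v - u))" using q w by (intro mult_right_mono) auto
    finally have "\<bar>z$1\<bar> \<le> u + fst q * (v - u)" by simp
    moreover have "z$2 = p + fst q * (r - p)" by (simp add: z)
    moreover have "fst q \<in> {0..1}" using q by auto
    ultimately show "z \<in> trapezoid p r u v" unfolding trapezoid_def by blast
  qed
  ultimately show ?thesis by simp
qed

lemma trapezoid_iff:
  assumes "p < r"
  shows "z \<in> trapezoid p r u v \<longleftrightarrow> p \<le> z$2 \<and> z$2 \<le> r \<and> \<bar>z$1\<bar> \<le> u + (v - u) / (r - p) * (z$2 - p)"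
proof
  assume "z \<in> trapezoid p r u v"
  then obtain s where s: "0 \<le> s" "s \<le> 1" "z$2 = p + s * (r - p)" "\<bar>z$1\<bar> \<le> u + s * (v - u)"
    by (auto simp: trapezoid_def)
  define d where "d = s * (r - p)"
  have "d \<le> 1 * (r - p)" unfolding d_def using s assms by (intro mult_right_mono) auto
  moreover have "0 \<le> d" using s assms by (simp add: d_def)
  moreover have "u + (v - u) / (r - p) * (z$2 - p) = u + s * (v - u)" using s(3) assms by simp
  ultimately show "p \<le> z$2 \<and> z$2 \<le> r \<and> \<bar>z$1\<bar> \<le> u + (v - u) / (r - p) * (z$2 - p)"
    using s(3,4) unfolding d_def[symmetric] by simp
next
  assume a: "p \<le> z$2 \<and> z$2 \<le> r \<and> \<bar>z$1\<bar> \<le> u + (v - u) / (r - p) * (z$2 - p)"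
  show "z \<in> trapezoid p r u v"
    unfolding trapezoid_def mem_Collect_eq
  proof (rule bexI[of _ "(z$2 - p) / (r - p)"])
    show "(z$2 - p) / (r - p) \<in> {0..1}" using a assms by (simp add: divide_le_eq)
    show "z$2 = p + (z$2 - p) / (r - p) * (r - p) \<and> \<bar>z$1\<bar> \<le> u + (z$2 - p) / (r - p) * (v - u)"
      using a assms by (simp add: mult.commute)
  qed
qed

lemma trapezoid_moment:
  assumes "p < r" "0 \<le> u" "0 \<le> v"
  defines "w \<equiv> \<lambda>y. u + (v - u) / (r - p) * (y - p)"
  shows "(LINT z:trapezoid p r u v|lebesgue. z$1 ^ i * z$2 ^ j)
    = (\<integral>y. (y ^ j * ((w y ^ Suc i - (- w y) ^ Suc i) / Suc i)) * indicator {p..r} y \<partial>lborel)"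
proof -
  have w: "w y \<ge> 0" if "p \<le> y" "y \<le> r" for y
  proof -
    have "w y = (u * (r - y) + v * (y - p)) / (r - p)"
      using assms(1) by (simp add: w_def divide_simps) (simp add: algebra_simps)
    then show ?thesis using that assms(1-3) by simp
  qed
  have "(\<integral>x. indicator (trapezoid p r u v) (vector [x, y]) * ((vector [x, y] :: real^2) $ 1 ^ i * (vector [x, y] :: real^2) $ 2 ^ j) \<partial>lborel)
    = (y ^ j * ((w y ^ Suc i - (- w y) ^ Suc i) / Suc i)) * indicator {p..r} y" for y
  proof (cases "p \<le> y \<and> y \<le> r")
    case True
    have "(\<integral>x. indicator (trapezoid p r u v) (vector [x, y]) * ((vector [x, y] :: real^2) $ 1 ^ i * (vector [x, y] :: real^2) $ 2 ^ j) \<partial>lborel)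
       = (\<integral>x. y ^ j * (x ^ i * indicator {- w y..w y} x) \<partial>lborel)"
      by (rule Bochner_Integration.integral_cong)
         (use True in \<open>auto simp: indicator_def trapezoid_iff[OF assms(1)] w_def\<close>)
    also have "\<dots> = y ^ j * ((w y ^ Suc i - (- w y) ^ Suc i) / Suc i)"
      using w[of y] True by (subst integral_mult_right_zero, subst integral_power) auto
    finally show ?thesis using True by simp
  next
    case False
    then have "vector [x, y] \<notin> trapezoid p r u v" for x
      by (auto simp: trapezoid_iff[OF assms(1)])
    then show ?thesis using False by (auto simp: indicator_def)
  qed
  then show ?thesis
    by (subst set_integral_iterated[OF compact_trapezoid[OF assms(2,3)]]) (auto intro!: continuous_intros)
qed

lemma integral_cubic_shifted:
  assumes "p \<le> (r::real)"
  shows "(\<integral>y. (c0 + c1 * (y - p) + c2 * (y - p)\<^sup>2 + c3 * (y - p) ^ 3) * indicator {p..r} y \<partial>lborel)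
    = c0 * (r - p) + c1 * (r - p)\<^sup>2 / 2 + c2 * (r - p) ^ 3 / 3 + c3 * (r - p) ^ 4 / 4"
proof -
  let ?F = "\<lambda>y. c0 * (y - p) + c1 * (y - p)\<^sup>2 / 2 + c2 * (y - p) ^ 3 / 3 + c3 * (y - p) ^ 4 / 4"
  let ?f = "\<lambda>y. c0 + c1 * (y - p) + c2 * (y - p)\<^sup>2 + c3 * (y - p) ^ 3"
  have "(\<integral>y. ?f y * indicator {p..r} y \<partial>lborel) = ?F r - ?F p"
  proof (rule integral_FTC_Icc_real[OF assms])
    fix y
    show "DERIV ?F y :> ?f y"
      by (auto intro!: derivative_eq_intros simp: power2_eq_square power3_eq_cube field_simps)
    show "isCont ?f y" by simp
  qed
  then show ?thesis by simp
qed

lemma set_integral_negligible: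
  assumes "negligible S"
  shows "(LINT z:S|lebesgue. f z) = 0"
proof -
  have "AE z in lebesgue. z \<notin> S" using assms by (intro AE_not_in) (simp add: negligible_iff_null_sets)
  then have "AE z in lebesgue. indicator S z *\<^sub>R f z = 0" by (rule AE_mp) simp
  then show ?thesis unfolding set_lebesgue_integral_def by (rule integral_eq_zero_AE)
qed

lemma negligible_horizontal: "negligible {z::real^2. z$2 = c}"
  using negligible_standard_hyperplane[of "axis 2 1 :: real^2" c] by (simp add: inner_axis Basis_real2)

text \<open>The half width of a slice is affine in its height, so after integrating along the slices the
  integrands are polynomials of degree at most three in the height.\<close>

lemma trapezoid_integrals:
  assumes "p \<le> r" "0 \<le> u" "0 \<le> v"
  shows "(LINT z:trapezoid p r u v|lebesgue. 1) = (r - p) * (u + v)"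
    and "(LINT z:trapezoid p r u v|lebesgue. z$1) = 0"
    and "(LINT z:trapezoid p r u v|lebesgue. z$2) = (r - p) * (2 * p * u + p * v + r * u + 2 * r * v) / 3"
    and "(LINT z:trapezoid p r u v|lebesgue. z$1 * z$2) = 0"
    and "(LINT z:trapezoid p r u v|lebesgue. z$1 * z$1) = (r - p) * (u ^ 3 + u\<^sup>2 * v + u * v\<^sup>2 + v ^ 3) / 6"
    and "(LINT z:trapezoid p r u v|lebesgue. z$2 * z$2)
       = (r - p) * (u * (3 * p\<^sup>2 + 2 * p * r + r\<^sup>2) + v * (p\<^sup>2 + 2 * p * r + 3 * r\<^sup>2)) / 6"
proof -
  let ?T = "trapezoid p r u v"
  have "(LINT z:?T|lebesgue. 1) = (r - p) * (u + v) \<and> (LINT z:?T|lebesgue. z$1) = 0 \<and>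
    (LINT z:?T|lebesgue. z$2) = (r - p) * (2 * p * u + p * v + r * u + 2 * r * v) / 3 \<and>
    (LINT z:?T|lebesgue. z$1 * z$2) = 0 \<and>
    (LINT z:?T|lebesgue. z$1 * z$1) = (r - p) * (u ^ 3 + u\<^sup>2 * v + u * v\<^sup>2 + v ^ 3) / 6 \<and>
    (LINT z:?T|lebesgue. z$2 * z$2)
       = (r - p) * (u * (3 * p\<^sup>2 + 2 * p * r + r\<^sup>2) + v * (p\<^sup>2 + 2 * p * r + 3 * r\<^sup>2)) / 6"
  proof (cases "p = r")
    case True
    have "negligible ?T"
      by (rule negligible_subset[OF negligible_horizontal[of p]]) (auto simp: trapezoid_def True)
    then show ?thesis using True by (simp add: set_integral_negligible)
  next
    case False
    then have pr: "p < r" using assms(1) by simp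
    define L where "L = r - p"
    define s where "s = (v - u) / (r - p)"
    have L: "L > 0" and r: "r = p + L" and v: "v = u + s * L" and rp: "r - p = L"
      using pr by (auto simp: L_def s_def)
    note mom = trapezoid_moment[OF pr assms(2,3), folded s_def]
    have ev: "(- u - x)\<^sup>2 = (u + x)\<^sup>2" for x by (simp add: power2_eq_square algebra_simps)
    have 1: "(LINT z:?T|lebesgue. 1) = (r - p) * (u + v)"
    proof -
      have "(LINT z:?T|lebesgue. 1) = (\<integral>y. (2 * u + (2 * s) * (y - p) + 0 * (y - p)\<^sup>2 + 0 * (y - p) ^ 3) * indicator {p..r} y \<partial>lborel)"
        using mom[of 0 0] by (simp add: algebra_simps)
      also have "\<dots> = (r - p) * (u + v)"
        unfolding integral_cubic_shifted[OF assms(1)] unfolding rp v by (simp add: power2_eq_square algebra_simps)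
      finally show ?thesis .
    qed
    have 2: "(LINT z:?T|lebesgue. z$1) = 0" using mom[of 1 0] by (simp add: numeral_2_eq_2[symmetric] ev)
    have 3: "(LINT z:?T|lebesgue. z$2) = (r - p) * (2 * p * u + p * v + r * u + 2 * r * v) / 3"
    proof -
      have "(LINT z:?T|lebesgue. z$2) = (\<integral>y. (2 * p * u + (2 * p * s + 2 * u) * (y - p) + 2 * s * (y - p)\<^sup>2 + 0 * (y - p) ^ 3) * indicator {p..r} y \<partial>lborel)"
        using mom[of 0 1] by (simp add: algebra_simps power2_eq_square)
      also have "\<dots> = (r - p) * (2 * p * u + p * v + r * u + 2 * r * v) / 3"
        unfolding integral_cubic_shifted[OF assms(1)] unfolding rp v r by (simp add: power2_eq_square power3_eq_cube field_simps)
      finally show ?thesis .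
    qed
    have 4: "(LINT z:?T|lebesgue. z$1 * z$2) = 0" using mom[of 1 1] by (simp add: numeral_2_eq_2[symmetric] ev)
    have 5: "(LINT z:?T|lebesgue. z$1 * z$1) = (r - p) * (u ^ 3 + u\<^sup>2 * v + u * v\<^sup>2 + v ^ 3) / 6"
    proof -
      have eq: "(u + s * (y - p)) ^ 3 * 2 / 3 = 2 / 3 * u ^ 3 + 2 * u\<^sup>2 * s * (y - p) + 2 * u * s\<^sup>2 * (y - p)\<^sup>2 + 2 / 3 * s ^ 3 * (y - p) ^ 3" for y
      proof -
        have "(u + s * e) ^ 3 * 2 / 3 = 2 / 3 * u ^ 3 + 2 * u\<^sup>2 * s * e + 2 * u * s\<^sup>2 * e\<^sup>2 + 2 / 3 * s ^ 3 * e ^ 3" for e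
          by (simp add: power2_eq_square power3_eq_cube field_simps)
        then show ?thesis .
      qed
      have odd: "(u + x) ^ 3 - (- u - x) ^ 3 = (u + x) ^ 3 * 2" for x
        by (simp add: power3_eq_cube algebra_simps)
      have "(LINT z:?T|lebesgue. z$1 * z$1) = (\<integral>y. ((u + s * (y - p)) ^ 3 * 2 / 3) * indicator {p..r} y \<partial>lborel)"
        using mom[of 2 0] by (simp add: power2_eq_square[of "_ $ 1"] numeral_3_eq_3[symmetric] odd)
      also have "\<dots> = (r - p) * (u ^ 3 + u\<^sup>2 * v + u * v\<^sup>2 + v ^ 3) / 6"
        unfolding eq integral_cubic_shifted[OF assms(1)] unfolding rp v r
        by (simp add: power2_eq_square power3_eq_cube power4_eq_xxxx field_simps)
      finally show ?thesis .
    qed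
    have 6: "(LINT z:?T|lebesgue. z$2 * z$2)
       = (r - p) * (u * (3 * p\<^sup>2 + 2 * p * r + r\<^sup>2) + v * (p\<^sup>2 + 2 * p * r + 3 * r\<^sup>2)) / 6"
    proof -
      have eq: "y\<^sup>2 * (2 * (u + s * (y - p))) = 2 * p\<^sup>2 * u + (2 * p\<^sup>2 * s + 4 * p * u) * (y - p) + (4 * p * s + 2 * u) * (y - p)\<^sup>2 + 2 * s * (y - p) ^ 3" for y
      proof -
        have "(p + e)\<^sup>2 * (2 * (u + s * e)) = 2 * p\<^sup>2 * u + (2 * p\<^sup>2 * s + 4 * p * u) * e + (4 * p * s + 2 * u) * e\<^sup>2 + 2 * s * e ^ 3" for e
          by (simp add: power2_eq_square power3_eq_cube algebra_simps)
        from this[of "y - p"] show ?thesis by simp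
      qed
      have "(LINT z:?T|lebesgue. z$2 * z$2) = (\<integral>y. (y\<^sup>2 * (2 * (u + s * (y - p)))) * indicator {p..r} y \<partial>lborel)"
        using mom[of 0 2] by (simp add: power2_eq_square[of "_ $ 2"])
      also have "\<dots> = (r - p) * (u * (3 * p\<^sup>2 + 2 * p * r + r\<^sup>2) + v * (p\<^sup>2 + 2 * p * r + 3 * r\<^sup>2)) / 6"
        unfolding eq integral_cubic_shifted[OF assms(1)] unfolding rp v r
        by (simp add: power2_eq_square power3_eq_cube power4_eq_xxxx field_simps)
      finally show ?thesis .
    qed
    show ?thesis using 1 2 3 4 5 6 by blast
  qed
  then show "(LINT z:?T|lebesgue. 1) = (r - p) * (u + v)" "(LINT z:?T|lebesgue. z$1) = 0"
    "(LINT z:?T|lebesgue. z$2) = (r - p) * (2 * p * u + p * v + r * u + 2 * r * v) / 3"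
    "(LINT z:?T|lebesgue. z$1 * z$2) = 0"
    "(LINT z:?T|lebesgue. z$1 * z$1) = (r - p) * (u ^ 3 + u\<^sup>2 * v + u * v\<^sup>2 + v ^ 3) / 6"
    "(LINT z:?T|lebesgue. z$2 * z$2)
       = (r - p) * (u * (3 * p\<^sup>2 + 2 * p * r + r\<^sup>2) + v * (p\<^sup>2 + 2 * p * r + 3 * r\<^sup>2)) / 6"
    by blast+
qed

lemma trapezoid_range: "p \<le> r \<Longrightarrow> z \<in> trapezoid p r u v \<Longrightarrow> p \<le> z$2 \<and> z$2 \<le> r"
proof -
  assume "p \<le> r" "z \<in> trapezoid p r u v"
  then obtain s where s: "0 \<le> s" "s \<le> 1" "z$2 = p + s * (r - p)" by (auto simp: trapezoid_def)
  define d where "d = s * (r - p)"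
  have "d \<le> 1 * (r - p)" unfolding d_def using s \<open>p \<le> r\<close> by (intro mult_right_mono) auto
  moreover have "0 \<le> d" using s \<open>p \<le> r\<close> by (simp add: d_def)
  ultimately show "p \<le> z$2 \<and> z$2 \<le> r" unfolding s(3) d_def[symmetric] by simp
qed

lemma set_integral_stacked_trapezoids:
  fixes f :: "real^2 \<Rightarrow> real"
  assumes "p \<le> r" "r \<le> q" "0 \<le> u" "0 \<le> v" "0 \<le> w" and f: "continuous_on UNIV f"
  shows "(LINT z:trapezoid p r u v \<union> trapezoid r q v w|lebesgue. f z)
    = (LINT z:trapezoid p r u v|lebesgue. f z) + (LINT z:trapezoid r q v w|lebesgue. f z)"
proof (rule set_integral_Un_AE)
  have "AE z in lebesgue. z \<notin> {z::real^2. z$2 = r}"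
    by (intro AE_not_in) (simp add: negligible_iff_null_sets[symmetric] negligible_horizontal)
  then show "AE z in lebesgue. \<not> (z \<in> trapezoid p r u v \<and> z \<in> trapezoid r q v w)"
  proof (rule AE_mp, intro AE_I2 impI notI)
    fix z :: "real^2" assume "z \<notin> {z. z$2 = r}" "z \<in> trapezoid p r u v \<and> z \<in> trapezoid r q v w"
    then show False using trapezoid_range[of p r z u v] trapezoid_range[of r q z v w] assms by auto
  qed
  have cf: "continuous_on A f" for A by (rule continuous_on_subset[OF f]) auto
  have c: "compact (trapezoid p r u v)" "compact (trapezoid r q v w)"
    using assms by (auto intro: compact_trapezoid)
  show "trapezoid p r u v \<in> sets lebesgue" "trapezoid r q v w \<in> sets lebesgue"
    using c by (auto intro: fmeasurableD lmeasurable_compact)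
  show "set_integrable lebesgue (trapezoid p r u v) f" "set_integrable lebesgue (trapezoid r q v w) f"
    using c by (auto intro: set_integrable_compact cf)
qed

section \<open>Pentagons whose polar body is their reflection\<close>

abbreviation pt :: "real \<Rightarrow> real \<Rightarrow> real^2" where
  "pt x y \<equiv> vector [x, y]"

lemma inner_real2: "(x::real^2) \<bullet> y = x$1 * y$1 + x$2 * y$2"
  by (simp add: inner_vec_def sum_2)

lemma norm_real2: "norm (x::real^2) = sqrt ((x$1)\<^sup>2 + (x$2)\<^sup>2)"
  by (simp add: norm_eq_sqrt_inner inner_real2 power2_eq_square)

lemma pt_eq_iff: "pt x y = pt x' y' \<longleftrightarrow> x = x' \<and> y = y'"
  by (auto simp: vec_eq_iff forall_2)

lemma continuous_on_pt:
  assumes "continuous_on S f" "continuous_on S g"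
  shows "continuous_on S (\<lambda>q. pt (f q) (g q))"
proof -
  have "continuous_on S (\<lambda>q. (\<chi> i. if i = 1 then f q else g q) :: real^2)"
  proof (rule continuous_on_vec_lambda)
    fix i :: 2
    show "continuous_on S (\<lambda>q. if i = 1 then f q else g q)" using assms by (cases "i = 1") auto
  qed
  moreover have "(\<chi> i. if i = 1 then f q else g q) = pt (f q) (g q)" for q
    by (simp add: vec_eq_iff forall_2)
  ultimately show ?thesis by simp
qed

text \<open>Half the distance of the two vertices at height \<open>b\<close>. Requiring \<open>a\<^sup>2 - b\<^sup>2 = 1\<close> makes \<open>(a, -b)\<close>,
  the reflection of the vertex \<open>(-a, b)\<close>, dual to a line through the vertex \<open>(a, b)\<close>.\<close>

definition half_top :: "real \<Rightarrow> real" where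
  "half_top b = sqrt (1 + b\<^sup>2)"

text \<open>Half the length of the lowest edge. Requiring \<open>a c + b / t = 1\<close> makes the reflection \<open>(c, 1/t)\<close> of
  a lowest vertex dual to a line through \<open>(a, b)\<close>; the same line contains \<open>(0, t)\<close>.\<close>

definition half_bottom :: "real \<Rightarrow> real \<Rightarrow> real" where
  "half_bottom t b = (1 - b / t) / half_top b"

definition vertices :: "real \<Rightarrow> real \<Rightarrow> (real^2) set" where
  "vertices t b = {pt 0 t, pt (half_top b) b, pt (- half_top b) b,
     pt (half_bottom t b) (- 1 / t), pt (- half_bottom t b) (- 1 / t)}"

definition pentagon :: "real \<Rightarrow> real \<Rightarrow> (real^2) set" where
  "pentagon t b = convex hull (vertices t b)"

text \<open>The equality cases of the two inequalities are kept because they give the triangles at the ends of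
  the family.\<close>

locale self_polar_pentagon =
  fixes t b :: real
  assumes t_pos: "0 < t" and b_lower: "- 1 / t \<le> b" and b_upper: "b \<le> t"
begin

definition "h = 1 / t"
definition "a = half_top b"
definition "c = half_bottom t b"

lemma h_pos: "0 < h" and th: "t * h = 1"
  using t_pos by (auto simp: h_def)

lemma b_ge: "- h \<le> b" using b_lower by (simp add: h_def)

lemma a_pos: "0 < a" and a_sq: "a * a = 1 + b * b"
proof -
  show "0 < a" unfolding a_def half_top_def by (simp add: add_pos_nonneg)
  have "a\<^sup>2 = 1 + b\<^sup>2" unfolding a_def half_top_def by (rule real_sqrt_pow2) simp
  then show "a * a = 1 + b * b" by (simp add: power2_eq_square)
qed

lemma ac: "a * c = 1 - b * h" and c_nonneg: "0 \<le> c"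
proof -
  show ac: "a * c = 1 - b * h"
    using a_pos by (simp add: c_def half_bottom_def a_def h_def)
  show "0 \<le> c"
    unfolding c_def half_bottom_def
    using b_upper t_pos a_pos by (simp add: a_def divide_le_eq_1)
qed

lemma vertices_eq: "vertices t b = {pt 0 t, pt a b, pt (- a) b, pt c (- h), pt (- c) (- h)}"
  by (simp add: vertices_def a_def c_def h_def)

definition region :: "(real^2) set" where
  "region = {z. - t * z$2 \<le> 1 \<and> a * \<bar>z$1\<bar> \<le> 1 + b * z$2 \<and> c * \<bar>z$1\<bar> \<le> 1 - h * z$2}"

lemma region_eq_uminus_polar: "region = uminus ` polar (vertices t b)"
proof -
  have *: "z \<in> region \<longleftrightarrow> (\<forall>v\<in>vertices t b. v \<bullet> (- z) \<le> 1)" for z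
  proof -
    have ab: "a * \<bar>z$1\<bar> = \<bar>a * z$1\<bar>" "c * \<bar>z$1\<bar> = \<bar>c * z$1\<bar>"
      using a_pos c_nonneg by (simp_all add: abs_mult)
    show ?thesis
      unfolding region_def mem_Collect_eq ab by (auto simp: vertices_eq inner_real2 abs_le_iff)
  qed
  show ?thesis
  proof (intro set_eqI iffI)
    fix z assume "z \<in> region"
    then have "- z \<in> polar (vertices t b)" by (simp add: * polar_def)
    then show "z \<in> uminus ` polar (vertices t b)" by (intro image_eqI[of _ _ "- z"]) auto
  next
    fix z assume "z \<in> uminus ` polar (vertices t b)"
    then show "z \<in> region" by (auto simp: * polar_def)
  qed
qed

lemma convex_region: "convex region"
  unfolding region_eq_uminus_polar by (intro convex_negations convex_polar)

lemma bh_le_1: "b * h \<le> 1"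
  using mult_right_mono[OF b_upper, of h] h_pos th by simp

lemma bt_ge: "b * t \<ge> -1"
  using mult_right_mono[OF b_ge, of t] t_pos th by (simp add: mult.commute)

lemma c_sq_le: "c * c \<le> 1 + h * h"
proof -
  have "(a * a) * (c * c) = (a * c) * (a * c)" by (simp add: mult_ac)
  also have "\<dots> \<le> (1 + b * b) * (1 + h * h)"
    using zero_le_square[of "b + h"] unfolding ac by (simp add: algebra_simps)
  finally have "(a * a) * (c * c) \<le> (a * a) * (1 + h * h)" unfolding a_sq .
  moreover have "0 < a * a" using a_pos by simp
  ultimately show ?thesis by (simp only: mult_le_cancel_left_pos)
qed

lemma vertices_subset_region: "vertices t b \<subseteq> region"
proof -
  have "- 1 \<le> t * t" by (rule order_trans[OF _ zero_le_square]) simp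
  then show ?thesis
    using t_pos h_pos th a_pos a_sq ac c_nonneg c_sq_le bh_le_1 bt_ge
    by (auto simp: vertices_eq region_def mult.commute)
qed

text \<open>Below height \<open>b\<close> the width of the region is limited by the edges through \<open>(\<plusminus>a, b)\<close> and the lowest
  vertices, above it by those through \<open>(\<plusminus>a, b)\<close> and the apex.\<close>

lemma region_subset_trapezoids: "region \<subseteq> trapezoid (- h) b c a \<union> trapezoid b t a 0"
proof
  fix z assume z: "z \<in> region"
  have r: "- t * z$2 \<le> 1" "a * \<bar>z$1\<bar> \<le> 1 + b * z$2" "c * \<bar>z$1\<bar> \<le> 1 - h * z$2"
    using z by (auto simp: region_def)
  have y1: "- h \<le> z$2"
  proof -
    have "h * (- t * z$2) \<le> h * 1" using r(1) h_pos by (intro mult_left_mono) auto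
    moreover have "h * (- t * z$2) = - ((t * h) * z$2)" by (simp add: mult_ac)
    moreover have "(t * h) * z$2 = z$2" by (simp only: th mult_1)
    ultimately show ?thesis by linarith
  qed
  have y2: "z$2 \<le> t"
  proof -
    have "0 \<le> c * \<bar>z$1\<bar>" using c_nonneg by simp
    then have "h * z$2 \<le> 1" using r(3) by linarith
    then have "t * (h * z$2) \<le> t * 1" using t_pos by (intro mult_left_mono) auto
    moreover have "t * (h * z$2) = (t * h) * z$2" by (simp add: mult_ac)
    moreover have "(t * h) * z$2 = z$2" by (simp only: th mult_1)
    ultimately show ?thesis by linarith
  qed
  show "z \<in> trapezoid (- h) b c a \<union> trapezoid b t a 0"
  proof (cases "z$2 \<le> b")
    case True
    \<comment> \<open>if \<open>b = - h\<close>, the lower trapezoid is the lowest edge, and \<open>a = c\<close>\<close>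
    define s where "s = (if b = - h then 1 else (z$2 + h) / (b + h))"
    have s: "s \<in> {0..1}" "z$2 = - h + s * (b - - h)"
      using True y1 b_ge by (auto simp: s_def divide_le_eq_1 divide_nonneg_nonneg)
    have "a * (c + s * (a - c)) = a * c + s * (a * a - a * c)" by (simp add: algebra_simps)
    also have "\<dots> = 1 + b * (- h + s * (b - - h))" unfolding ac a_sq by (simp add: algebra_simps)
    finally have "a * \<bar>z$1\<bar> \<le> a * (c + s * (a - c))" using r(2) s(2) by simp
    then have "\<bar>z$1\<bar> \<le> c + s * (a - c)" using a_pos by simp
    then show ?thesis using s unfolding trapezoid_def by blast
  next
    case False
    then have bt: "b < t" using y2 by simp
    define s where "s = (z$2 - b) / (t - b)"
    have s: "s \<in> {0..1}" "z$2 = b + s * (t - b)"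
      using False y2 bt by (auto simp: s_def divide_le_eq_1)
    have acp: "a * c = h * (t - b)" unfolding ac using th by (simp add: algebra_simps)
    have "0 < h * (t - b)" using h_pos bt by simp
    then have cp: "0 < c" using acp a_pos by (metis zero_less_mult_pos)
    have "c * (a + s * (0 - a)) = (a * c) * (1 - s)" by (simp add: algebra_simps)
    also have "\<dots> = t * h - h * (b + s * (t - b))" unfolding acp by (simp add: algebra_simps)
    also have "\<dots> = 1 - h * z$2" unfolding th s(2) ..
    finally have "c * \<bar>z$1\<bar> \<le> c * (a + s * (0 - a))" using r(3) by simp
    then have "\<bar>z$1\<bar> \<le> a + s * (0 - a)" using cp by simp
    then show ?thesis using s unfolding trapezoid_def by blast
  qed
qed

end

lemma horizontal_segment_subset:
  assumes "convex S" "pt x y \<in> S" "pt (- x) y \<in> S" "z$2 = y" "\<bar>z$1\<bar> \<le> x"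
  shows "z \<in> S"
proof (cases "x = 0")
  case True
  then have "z = pt x y" using assms by (simp add: vec_eq_iff forall_2)
  then show ?thesis using assms by simp
next
  case False
  then have x: "x > 0" using assms(5) by linarith
  let ?u = "(1 + z$1 / x) / 2"
  have u: "0 \<le> ?u" "?u \<le> 1" using assms(5) x by (auto simp: field_simps abs_le_iff)
  have "?u *\<^sub>R pt x y + (1 - ?u) *\<^sub>R pt (- x) y \<in> S"
    by (rule convexD[OF assms(1,2,3)]) (use u in auto)
  moreover have "?u *\<^sub>R pt x y + (1 - ?u) *\<^sub>R pt (- x) y = z"
    using x assms(4) by (simp add: vec_eq_iff forall_2 field_simps)
  ultimately show ?thesis by simp
qed

lemma trapezoid_subset_convex:
  assumes "convex S" "pt u p \<in> S" "pt (- u) p \<in> S" "pt v r \<in> S" "pt (- v) r \<in> S"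
  shows "trapezoid p r u v \<subseteq> S"
proof
  fix z assume "z \<in> trapezoid p r u v"
  then obtain s where s: "0 \<le> s" "s \<le> 1" "z$2 = p + s * (r - p)" "\<bar>z$1\<bar> \<le> u + s * (v - u)"
    by (auto simp: trapezoid_def)
  have 1: "(1 - s) *\<^sub>R pt u p + s *\<^sub>R pt v r \<in> S" and 2: "(1 - s) *\<^sub>R pt (- u) p + s *\<^sub>R pt (- v) r \<in> S"
    using assms s by (auto intro: convexD)
  have "(1 - s) *\<^sub>R pt u p + s *\<^sub>R pt v r = pt (u + s * (v - u)) (p + s * (r - p))"
    "(1 - s) *\<^sub>R pt (- u) p + s *\<^sub>R pt (- v) r = pt (- (u + s * (v - u))) (p + s * (r - p))"
    by (simp_all add: vec_eq_iff forall_2 algebra_simps)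
  with 1 2 show "z \<in> S" using horizontal_segment_subset[OF assms(1)] s by metis
qed

context self_polar_pentagon
begin

text \<open>The inclusions vertices \<open>\<subseteq>\<close> region \<open>\<subseteq>\<close> trapezoids \<open>\<subseteq>\<close> hull of the vertices close up to a circle.\<close>

lemma pentagon_eq: "pentagon t b = region"
  "pentagon t b = trapezoid (- h) b c a \<union> trapezoid b t a 0"
proof -
  have 1: "pentagon t b \<subseteq> region"
    unfolding pentagon_def by (rule hull_minimal[of _ _ convex, OF vertices_subset_region convex_region])
  have V: "v \<in> vertices t b \<Longrightarrow> v \<in> pentagon t b" for v
    unfolding pentagon_def by (rule hull_inc)
  have cv: "convex (pentagon t b)" by (simp add: pentagon_def)
  have 2: "trapezoid (- h) b c a \<subseteq> pentagon t b" "trapezoid b t a 0 \<subseteq> pentagon t b"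
    by (rule trapezoid_subset_convex[OF cv]; rule V; simp add: vertices_eq)+
  show "pentagon t b = region" "pentagon t b = trapezoid (- h) b c a \<union> trapezoid b t a 0"
    using 1 2 region_subset_trapezoids by blast+
qed

text \<open>The defining inequalities of the region are the ones that the reflected vertices impose, so the
  region is the reflected polar.\<close>

lemma polar_pentagon: "polar (pentagon t b) = uminus ` pentagon t b"
proof -
  have "polar (pentagon t b) = polar (vertices t b)"
  proof
    show "polar (pentagon t b) \<subseteq> polar (vertices t b)"
      unfolding polar_def pentagon_def by (auto intro: hull_inc)
    show "polar (vertices t b) \<subseteq> polar (pentagon t b)"
    proof
      fix y assume "y \<in> polar (vertices t b)"
      then have "vertices t b \<subseteq> {x. y \<bullet> x \<le> 1}" by (auto simp: polar_def inner_commute)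
      then have "convex hull vertices t b \<subseteq> {x. y \<bullet> x \<le> 1}"
        by (rule hull_minimal) (rule convex_halfspace_le)
      then show "y \<in> polar (pentagon t b)" by (auto simp: polar_def pentagon_def inner_commute)
    qed
  qed
  also have "\<dots> = uminus ` region" unfolding region_eq_uminus_polar by (simp add: image_image)
  finally show ?thesis by (simp add: pentagon_eq(1))
qed

lemma compact_pentagon: "compact (pentagon t b)"
  unfolding pentagon_def by (rule finite_imp_compact_convex_hull) (simp add: vertices_def)

lemma convex_pentagon: "convex (pentagon t b)"
  by (simp add: pentagon_def)

lemma ball_subset_pentagon: obtains r where "r > 0" "ball 0 r \<subseteq> pentagon t b"
proof -
  obtain B where B: "B > 0" "\<And>z. z \<in> pentagon t b \<Longrightarrow> norm z \<le> B"
    using compact_imp_bounded[OF compact_pentagon] bounded_pos by blast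
  from ball_subset_polar[of "pentagon t b" B, OF B(2,1)] have *: "ball 0 (1 / B) \<subseteq> uminus ` pentagon t b"
    by (simp add: polar_pentagon)
  have "ball 0 (1 / B) \<subseteq> pentagon t b"
  proof
    fix z :: "real^2" assume "z \<in> ball 0 (1 / B)"
    then have "- z \<in> uminus ` pentagon t b" using * by auto
    then show "z \<in> pentagon t b" by auto
  qed
  then show ?thesis using that[of "1 / B"] B(1) by simp
qed

lemma zero_in_interior: "0 \<in> interior (pentagon t b)"
  using ball_subset_pentagon by (metis centre_in_ball interior_maximal open_ball subsetD)

lemma axially_symmetric_pentagon: "axially_symmetric (pentagon t b)"
proof -
  let ?u = "pt 0 1"
  have r: "line_reflection 0 ?u z = pt (- z$1) (z$2)" for z
    by (simp add: line_reflection_def vec_eq_iff forall_2 inner_real2)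
  have "linear (line_reflection 0 ?u)"
    by (rule linearI) (simp_all add: r vec_eq_iff forall_2)
  then have "line_reflection 0 ?u ` pentagon t b = convex hull (line_reflection 0 ?u ` vertices t b)"
    unfolding pentagon_def by (rule convex_hull_linear_image)
  also have "line_reflection 0 ?u ` vertices t b = vertices t b"
    by (auto simp: vertices_eq r)
  finally have "line_reflection 0 ?u ` pentagon t b = pentagon t b" by (simp add: pentagon_def)
  moreover have "norm ?u = 1" by (simp add: norm_real2)
  ultimately show ?thesis unfolding axially_symmetric_def by blast
qed

lemma polytope_pentagon: "polytope (pentagon t b)"
  unfolding polytope_def pentagon_def by (rule exI[of _ "vertices t b"]) (simp add: vertices_def)

lemma extreme_points_subset: "{v. v extreme_point_of (pentagon t b)} \<subseteq> vertices t b"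
  unfolding pentagon_def using extreme_points_of_convex_hull by blast

lemma convex_ngon_le_5: "\<exists>k\<le>5. convex_ngon k (pentagon t b)"
proof (intro exI[of _ "card {v. v extreme_point_of (pentagon t b)}"] conjI)
  have "card {v. v extreme_point_of (pentagon t b)} \<le> card (vertices t b)"
    by (rule card_mono[OF _ extreme_points_subset]) (simp add: vertices_def)
  also have "\<dots> \<le> 5"
    unfolding vertices_def by (simp add: card_insert_if)
  finally show "card {v. v extreme_point_of (pentagon t b)} \<le> 5" .
  show "convex_ngon (card {v. v extreme_point_of (pentagon t b)}) (pentagon t b)"
    unfolding convex_ngon_def using polytope_pentagon zero_in_interior by auto
qed

end

lemma not_in_hull:
  fixes f v :: "'a::real_inner"
  assumes "\<And>w. w \<in> V - {v} \<Longrightarrow> f \<bullet> w < d" "d \<le> f \<bullet> v"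
  shows "v \<notin> convex hull (V - {v})"
proof
  assume v: "v \<in> convex hull (V - {v})"
  have "convex hull (V - {v}) \<subseteq> {x. f \<bullet> x < d}"
    by (rule hull_minimal) (use assms(1) in \<open>auto intro: convex_halfspace_lt\<close>)
  with v assms(2) show False by auto
qed

context self_polar_pentagon
begin

text \<open>A vertex is not in the hull of the others because a linear functional separates it strictly: the
  sum of the two functionals that are equal to \<open>1\<close> on the two edges at that vertex.\<close>

lemma convex_ngon_5:
  assumes lo: "- 1 / t < b" and up: "b < t"
  shows "convex_ngon 5 (pentagon t b)"
proof -
  have bl: "- h < b" using lo by (simp add: h_def)
  have bh: "b * h < 1" using mult_strict_right_mono[OF up h_pos] th by simp
  have bt: "- 1 < b * t" using mult_strict_right_mono[OF bl t_pos] th by (simp add: mult.commute)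
  have cp: "0 < c"
  proof -
    have "0 < a * c" using bh by (simp add: ac)
    then show ?thesis using a_pos by (simp add: zero_less_mult_iff)
  qed
  have cc: "c * c < 1 + h * h"
  proof -
    have "0 < (b + h) * (b + h)" using bl by simp
    then have "(1 - b * h) * (1 - b * h) < (1 + b * b) * (1 + h * h)" by (simp add: algebra_simps)
    then have "(a * c) * (a * c) < (a * a) * (1 + h * h)" by (simp only: ac a_sq)
    then have "(a * a) * (c * c) < (a * a) * (1 + h * h)" by (simp only: mult_ac)
    moreover have "0 < a * a" using a_pos by simp
    ultimately show ?thesis by (simp only: mult_less_cancel_left_pos)
  qed
  have tt: "0 < t * t" using t_pos by simp
  \<comment> \<open>weakened numerical bounds: as plain positivity statements the simplifier would rewrite them away\<close>
  have bb: "- 1 / 4 < b * b" by (rule less_le_trans[OF _ zero_le_square]) simp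
  have acp: "- 1 / 4 < a * c" using a_pos cp by (intro less_trans[OF _ mult_pos_pos]) auto
  have c2: "0 < c * c" using cp by simp
  have ind: "v \<notin> convex hull (vertices t b - {v})" if v: "v \<in> vertices t b" for v
  proof -
    consider "v = pt 0 t" | "v = pt a b" | "v = pt (- a) b" | "v = pt c (- h)" | "v = pt (- c) (- h)"
      using v by (auto simp: vertices_eq)
    then show ?thesis
    proof cases
      case 1
      show ?thesis
        by (rule not_in_hull[where f = "pt 0 1" and d = t])
           (use bl up t_pos h_pos in \<open>auto simp: 1 vertices_eq inner_real2\<close>)
    next
      case 2
      show ?thesis
        by (rule not_in_hull[where f = "pt (a + c) (h - b)" and d = 2])
           (use bh bt cc bb acp c2 th a_sq ac in \<open>auto simp: 2 vertices_eq inner_real2 algebra_simps\<close>)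
    next
      case 3
      show ?thesis
        by (rule not_in_hull[where f = "pt (- a - c) (h - b)" and d = 2])
           (use bh bt cc bb acp c2 th a_sq ac in \<open>auto simp: 3 vertices_eq inner_real2 algebra_simps\<close>)
    next
      case 4
      show ?thesis
        by (rule not_in_hull[where f = "pt a (- b - t)" and d = 2])
           (use bh bt tt bb acp th a_sq ac in \<open>auto simp: 4 vertices_eq inner_real2 algebra_simps\<close>)
    next
      case 5
      show ?thesis
        by (rule not_in_hull[where f = "pt (- a) (- b - t)" and d = 2])
           (use bh bt tt bb acp th a_sq ac in \<open>auto simp: 5 vertices_eq inner_real2 algebra_simps\<close>)
    qed
  qed
  have "compact (vertices t b)" by (rule finite_imp_compact) (simp add: vertices_def)
  from extreme_point_of_convex_hull_convex_independent[OF this ind]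
  have ext: "{v. v extreme_point_of (pentagon t b)} = vertices t b"
    by (auto simp: pentagon_def)
  have "card (vertices t b) = 5"
    unfolding vertices_eq using a_pos cp bl up t_pos h_pos by (simp add: pt_eq_iff card_insert_if)
  then show ?thesis
    unfolding convex_ngon_def ext using polytope_pentagon zero_in_interior by auto
qed

definition "area = (b + h) * (c + a) + (t - b) * a"
definition "moment_x = ((b + h) * (c ^ 3 + c\<^sup>2 * a + c * a\<^sup>2 + a ^ 3) + (t - b) * a ^ 3) / 6"
definition "moment_y = ((b + h) * (c * (3 * h\<^sup>2 - 2 * h * b + b\<^sup>2) + a * (h\<^sup>2 - 2 * h * b + 3 * b\<^sup>2))
  + (t - b) * (a * (3 * b\<^sup>2 + 2 * b * t + t\<^sup>2))) / 6"

lemma pentagon_integrals: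
  shows "(LINT z:pentagon t b|lebesgue. 1) = area"
    and "(LINT z:pentagon t b|lebesgue. z$1) = 0"
    and "(LINT z:pentagon t b|lebesgue. z$2)
      = ((b + h) * ((b - 2 * h) * c + (2 * b - h) * a) + (t - b) * ((2 * b + t) * a)) / 3"
    and "(LINT z:pentagon t b|lebesgue. z$1 * z$2) = 0"
    and "(LINT z:pentagon t b|lebesgue. z$1 * z$1) = moment_x"
    and "(LINT z:pentagon t b|lebesgue. z$2 * z$2) = moment_y"
proof -
  have ord: "- h \<le> b" "b \<le> t" "0 \<le> c" "0 \<le> a" "0 \<le> (0::real)"
    using b_ge b_upper c_nonneg a_pos by auto
  note stack = set_integral_stacked_trapezoids[OF ord, folded pentagon_eq(2)]
  note I1 = trapezoid_integrals[OF ord(1,3,4)]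
  note I2 = trapezoid_integrals[OF ord(2,4,5)]
  show "(LINT z:pentagon t b|lebesgue. 1) = area"
    by (simp add: stack I1 I2 area_def)
  show "(LINT z:pentagon t b|lebesgue. z$1) = 0"
    by (subst stack) (simp_all add: I1 I2 continuous_on_component)
  show "(LINT z:pentagon t b|lebesgue. z$2)
      = ((b + h) * ((b - 2 * h) * c + (2 * b - h) * a) + (t - b) * ((2 * b + t) * a)) / 3"
    by (subst stack) (simp_all add: I1 I2 continuous_on_component field_simps)
  show "(LINT z:pentagon t b|lebesgue. z$1 * z$2) = 0"
    by (subst stack) (simp_all add: I1 I2 continuous_on_component continuous_on_mult)
  show "(LINT z:pentagon t b|lebesgue. z$1 * z$1) = moment_x"
    by (subst stack) (simp_all add: I1 I2 continuous_on_component continuous_on_mult moment_x_def field_simps)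
  show "(LINT z:pentagon t b|lebesgue. z$2 * z$2) = moment_y"
    by (subst stack) (simp_all add: I1 I2 continuous_on_component continuous_on_mult moment_y_def field_simps)
qed

lemma measure_pentagon: "measure lebesgue (pentagon t b) = area"
  using pentagon_integrals(1) compact_pentagon by (simp add: set_lebesgue_integral_def lmeasurable_compact fmeasurableD)

lemma area_pos: "0 < area"
proof -
  have "0 \<le> (b + h) * c" "0 \<le> (b + h) * a" "0 \<le> (t - b) * a"
    using b_ge b_upper c_nonneg a_pos by simp_all
  moreover have "(b + h) * a + (t - b) * a = (t + h) * a" by (simp add: algebra_simps)
  moreover have "0 < (t + h) * a" using t_pos h_pos a_pos by simp
  ultimately show ?thesis unfolding area_def by (simp add: algebra_simps)
qed

text \<open>All moments of the polar body are moments of the pentagon itself.\<close>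

lemma reflected_integral:
  fixes f :: "real^2 \<Rightarrow> real"
  assumes "continuous_on UNIV f"
  shows "(LINT z:polar (pentagon t b)|lebesgue. f z) = (LINT z:pentagon t b|lebesgue. f (- z))"
  unfolding polar_pentagon by (rule set_integral_reflect[OF compact_pentagon assms])

lemma measure_polar_pentagon: "measure lebesgue (polar (pentagon t b)) = area"
proof -
  have "compact (polar (pentagon t b))" unfolding polar_pentagon by (rule compact_negations[OF compact_pentagon])
  then show ?thesis
    using reflected_integral[of "\<lambda>_. 1"] pentagon_integrals(1)
    by (simp add: set_lebesgue_integral_def lmeasurable_compact fmeasurableD)
qed

lemma cov_pentagon:
  "cov (pentagon t b) $ i $ j = (if i = j then (if i = 1 then moment_x / area else moment_y / area) else 0)"
  "cov (polar (pentagon t b)) $ i $ j = (if i = j then (if i = 1 then moment_x / area else moment_y / area) else 0)"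
proof -
  show "cov (pentagon t b) $ i $ j = (if i = j then (if i = 1 then moment_x / area else moment_y / area) else 0)"
    using exhaust_2[of i] exhaust_2[of j] pentagon_integrals(4-6)
    by (auto simp: cov_def measure_pentagon mult.commute[of "_ $ 2" "_ $ 1"])
  then show "cov (polar (pentagon t b)) $ i $ j = (if i = j then (if i = 1 then moment_x / area else moment_y / area) else 0)"
    using reflected_integral[of "\<lambda>z. z$i * z$j"]
    by (simp add: cov_def measure_pentagon measure_polar_pentagon continuous_on_mult continuous_on_component)
qed

lemma trace_cov: "trace (cov (pentagon t b) ** cov (polar (pentagon t b))) = (moment_x / area)\<^sup>2 + (moment_y / area)\<^sup>2"
  by (simp add: trace_def matrix_matrix_mult_def sum_2 cov_pentagon power2_eq_square)

end

section \<open>Critical points and Hessians at these pentagons\<close>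

text \<open>Three times the vertical first moment of the pentagon, multiplied by \<open>a\<close> to remove the square root
  (\<open>moment_eq_balance\<close>).\<close>

definition balance :: "real \<Rightarrow> real \<Rightarrow> real" where
  "balance t b = t * b ^ 3 + (t\<^sup>2 + 1) * b\<^sup>2 + (t + 2 / t ^ 3) * b + t\<^sup>2 - 3 / t\<^sup>2"

context self_polar_pentagon
begin

lemma moment_eq_balance:
  "a * ((b + h) * ((b - 2 * h) * c + (2 * b - h) * a) + (t - b) * ((2 * b + t) * a)) = balance t b"
proof -
  have "a * ((b + h) * ((b - 2 * h) * c + (2 * b - h) * a) + (t - b) * ((2 * b + t) * a))
    = (b + h) * ((b - 2 * h) * (a * c) + (2 * b - h) * (a * a)) + (t - b) * ((2 * b + t) * (a * a))"
    by (simp add: algebra_simps)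
  also have "\<dots> = t * b ^ 3 + (t\<^sup>2 + 1) * b\<^sup>2 + (t + 2 * h ^ 3) * b + t\<^sup>2 - 3 * h\<^sup>2"
    unfolding ac a_sq by (simp add: power2_eq_square power3_eq_cube algebra_simps)
  also have "\<dots> = balance t b"
    by (simp add: balance_def h_def power_one_over)
  finally show ?thesis .
qed

lemma compact_polar_pentagon: "compact (polar (pentagon t b))"
  unfolding polar_pentagon by (rule compact_negations[OF compact_pentagon])

lemma barycenters:
  assumes "balance t b = 0"
  shows "(LINT z:pentagon t b|lebesgue. z) = 0" "(LINT z:polar (pentagon t b)|lebesgue. z) = 0"
proof -
  have "(b + h) * ((b - 2 * h) * c + (2 * b - h) * a) + (t - b) * ((2 * b + t) * a) = 0"
    using moment_eq_balance assms a_pos by simp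
  then have c0: "(LINT z:pentagon t b|lebesgue. z$i) = 0" for i
    using pentagon_integrals(2,3) exhaust_2[of i] by auto
  then show "(LINT z:pentagon t b|lebesgue. z) = 0"
    by (simp add: vec_eq_iff vector_integral_component[OF compact_pentagon] continuous_on_id)
  have "(LINT z:polar (pentagon t b)|lebesgue. z$i) = 0" for i
    using reflected_integral[of "\<lambda>z. z$i"] c0[of i]
      set_integral_mult_right[of lebesgue "pentagon t b" "- 1" "\<lambda>z. z$i"]
    by (simp add: continuous_on_component)
  then show "(LINT z:polar (pentagon t b)|lebesgue. z) = 0"
    by (simp add: vec_eq_iff vector_integral_component[OF compact_polar_pentagon] continuous_on_id)
qed

lemma second_moment_vector:
  "(LINT z:pentagon t b|lebesgue. (12 * (x \<bullet> z)) *\<^sub>R z) = pt (12 * moment_x * x$1) (12 * moment_y * x$2)"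
  "(LINT z:polar (pentagon t b)|lebesgue. (12 * (x \<bullet> z)) *\<^sub>R z) = pt (12 * moment_x * x$1) (12 * moment_y * x$2)"
proof -
  have cont: "continuous_on UNIV (\<lambda>z::real^2. (12 * (x \<bullet> z)) *\<^sub>R z)"
    by (intro continuous_on_scaleR continuous_on_mult continuous_on_const continuous_on_inner continuous_on_id)
  have int: "set_integrable lebesgue (pentagon t b) (\<lambda>z. k * (z$i * z$j))" for k i j
    by (intro set_integrable_compact compact_pentagon continuous_on_mult continuous_on_const
        continuous_on_component continuous_on_id)
  have eq: "(LINT z:pentagon t b|lebesgue. (12 * (x \<bullet> z)) * z$i)
      = 12 * x$1 * (LINT z:pentagon t b|lebesgue. z$1 * z$i) + 12 * x$2 * (LINT z:pentagon t b|lebesgue. z$2 * z$i)" for i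
  proof -
    have "(LINT z:pentagon t b|lebesgue. (12 * (x \<bullet> z)) * z$i)
        = (LINT z:pentagon t b|lebesgue. (12 * x$1) * (z$1 * z$i) + (12 * x$2) * (z$2 * z$i))"
      by (simp add: inner_real2 algebra_simps)
    also have "\<dots> = (LINT z:pentagon t b|lebesgue. (12 * x$1) * (z$1 * z$i)) + (LINT z:pentagon t b|lebesgue. (12 * x$2) * (z$2 * z$i))"
      by (rule set_integral_add(2)[OF int int])
    finally show ?thesis by simp
  qed
  show 1: "(LINT z:pentagon t b|lebesgue. (12 * (x \<bullet> z)) *\<^sub>R z) = pt (12 * moment_x * x$1) (12 * moment_y * x$2)"
    using pentagon_integrals(4-6)
    by (simp add: vec_eq_iff forall_2 vector_integral_component[OF compact_pentagon cont] eq mult.commute[of "_ $ 2" "_ $ 1"])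
  have "(LINT z:polar (pentagon t b)|lebesgue. (12 * (x \<bullet> z)) *\<^sub>R z) $ i
      = (LINT z:pentagon t b|lebesgue. (12 * (x \<bullet> z)) *\<^sub>R z) $ i" for i
    unfolding vector_integral_component[OF compact_pentagon cont] vector_integral_component[OF compact_polar_pentagon cont]
    by (subst reflected_integral) (simp_all add: continuous_on_mult continuous_on_component continuous_on_inner)
  then show "(LINT z:polar (pentagon t b)|lebesgue. (12 * (x \<bullet> z)) *\<^sub>R z) = pt (12 * moment_x * x$1) (12 * moment_y * x$2)"
    using 1 by (simp add: vec_eq_iff)
qed

lemma FK_pentagon_gradient:
  assumes "balance t b = 0"
  obtains G where "\<forall>\<^sub>F p in nhds 0. (FK (pentagon t b) has_derivative (\<lambda>h. G p \<bullet> h)) (at p)"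
    "G 0 = 0"
    "(G has_derivative (\<lambda>h. (3 * area\<^sup>2) *\<^sub>R
       (pt (4 * (moment_x / area) * fst h $ 1 - snd h $ 1) (4 * (moment_y / area) * fst h $ 2 - snd h $ 2),
        pt (4 * (moment_x / area) * snd h $ 1 - fst h $ 1) (4 * (moment_y / area) * snd h $ 2 - fst h $ 2)))) (at 0)"
proof -
  obtain r where r: "r > 0" "ball 0 r \<subseteq> pentagon t b" by (rule ball_subset_pentagon)
  obtain G where G: "\<forall>\<^sub>F p in nhds 0. (FK (pentagon t b) has_derivative (\<lambda>h. G p \<bullet> h)) (at p)" "G 0 = 0"
    "(G has_derivative (\<lambda>h.
       (area *\<^sub>R (pt (12 * moment_x * fst h $ 1) (12 * moment_y * fst h $ 2) - (3 * area) *\<^sub>R snd h),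
        area *\<^sub>R pt (12 * moment_x * snd h $ 1) (12 * moment_y * snd h $ 2) - (3 * area * area) *\<^sub>R fst h))) (at 0)"
    by (rule FK_gradient[OF compact_pentagon convex_pentagon r(2,1) barycenters[OF assms],
          unfolded measure_pentagon measure_polar_pentagon second_moment_vector])
  have "(G has_derivative (\<lambda>h. (3 * area\<^sup>2) *\<^sub>R
       (pt (4 * (moment_x / area) * fst h $ 1 - snd h $ 1) (4 * (moment_y / area) * fst h $ 2 - snd h $ 2),
        pt (4 * (moment_x / area) * snd h $ 1 - fst h $ 1) (4 * (moment_y / area) * snd h $ 2 - fst h $ 2)))) (at 0)"
    by (rule has_derivative_eq_rhs[OF G(3)])
       (use area_pos in \<open>simp add: fun_eq_iff vec_eq_iff forall_2 power2_eq_square right_diff_distrib\<close>)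
  with G(1,2) show ?thesis by (rule that)
qed

lemma critical_point_FK:
  assumes "balance t b = 0"
  shows "critical_point (FK (pentagon t b)) (0, 0)"
proof -
  obtain G where G: "\<forall>\<^sub>F p in nhds 0. (FK (pentagon t b) has_derivative (\<lambda>h. G p \<bullet> h)) (at p)" "G 0 = 0"
    by (rule FK_pentagon_gradient[OF assms])
  from eventually_nhds_x_imp_x[OF G(1)] show ?thesis
    unfolding critical_point_def zero_prod_def[symmetric] G(2) by simp
qed

text \<open>Both covariance matrices are the diagonal matrix with entries \<open>\<kappa> / 4\<close>. In the direction \<open>(e\<^sub>1, 0)\<close> the
  second derivative is a positive multiple of \<open>\<kappa> 1\<close>, and in the direction \<open>(e\<^sub>1, e\<^sub>1)\<close> of
  \<open>\<kappa> 1 - 1\<close>; this gives the saddle point.\<close>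

lemma FK_pentagon_hessian:
  assumes "balance t b = 0"
  defines "\<kappa> \<equiv> \<lambda>i::2. 4 * (if i = 1 then moment_x / area else moment_y / area)"
  shows "twice_differentiable_at (FK (pentagon t b)) (0, 0)"
    and "hessian (FK (pentagon t b)) (0, 0) $ k $ l =
      (case k of Inl i \<Rightarrow> (case l of Inl j \<Rightarrow> if i = j then 3 * area\<^sup>2 * \<kappa> i else 0 | Inr j \<Rightarrow> if i = j then - (3 * area\<^sup>2) else 0)
        | Inr i \<Rightarrow> (case l of Inl j \<Rightarrow> if i = j then - (3 * area\<^sup>2) else 0 | Inr j \<Rightarrow> if i = j then 3 * area\<^sup>2 * \<kappa> i else 0))"
    and "0 < \<kappa> 1 \<Longrightarrow> \<kappa> 1 < 1 \<Longrightarrow> saddle_point (FK (pentagon t b)) (0, 0)"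
proof -
  let ?H = "\<lambda>h. (3 * area\<^sup>2) *\<^sub>R
       (pt (4 * (moment_x / area) * fst h $ 1 - snd h $ 1) (4 * (moment_y / area) * fst h $ 2 - snd h $ 2),
        pt (4 * (moment_x / area) * snd h $ 1 - fst h $ 1) (4 * (moment_y / area) * snd h $ 2 - fst h $ 2))"
  obtain G where G: "\<forall>\<^sub>F p in nhds 0. (FK (pentagon t b) has_derivative (\<lambda>h. G p \<bullet> h)) (at p)" "G 0 = 0"
    "(G has_derivative ?H) (at 0)"
    by (rule FK_pentagon_gradient[OF assms(1)])
  show "twice_differentiable_at (FK (pentagon t b)) (0, 0)"
    using hessian_from_gradient(1)[OF G(1,3)] by (simp add: zero_prod_def)
  show "hessian (FK (pentagon t b)) (0, 0) $ k $ l =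
      (case k of Inl i \<Rightarrow> (case l of Inl j \<Rightarrow> if i = j then 3 * area\<^sup>2 * \<kappa> i else 0 | Inr j \<Rightarrow> if i = j then - (3 * area\<^sup>2) else 0)
        | Inr i \<Rightarrow> (case l of Inl j \<Rightarrow> if i = j then - (3 * area\<^sup>2) else 0 | Inr j \<Rightarrow> if i = j then 3 * area\<^sup>2 * \<kappa> i else 0))"
  proof -
    have ij: "i = 1 \<or> i = 2" for i :: 2 by (rule exhaust_2)
    have "hessian (FK (pentagon t b)) (0, 0) $ k $ l = ?H (pair_axis k) \<bullet> pair_axis l"
      using hessian_from_gradient(2)[OF G(1,3)] by (simp add: zero_prod_def)
    then show ?thesis
    proof (cases k; cases l)
      fix i j assume kl: "k = Inl i" "l = Inl j"
      assume "hessian (FK (pentagon t b)) (0, 0) $ k $ l = ?H (pair_axis k) \<bullet> pair_axis l"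
      then show ?thesis using ij[of i] ij[of j] by (auto simp: kl pair_axis_def inner_real2 axis_def \<kappa>_def)
    next
      fix i j assume kl: "k = Inl i" "l = Inr j"
      assume "hessian (FK (pentagon t b)) (0, 0) $ k $ l = ?H (pair_axis k) \<bullet> pair_axis l"
      then show ?thesis using ij[of i] ij[of j] by (auto simp: kl pair_axis_def inner_real2 axis_def \<kappa>_def)
    next
      fix i j assume kl: "k = Inr i" "l = Inl j"
      assume "hessian (FK (pentagon t b)) (0, 0) $ k $ l = ?H (pair_axis k) \<bullet> pair_axis l"
      then show ?thesis using ij[of i] ij[of j] by (auto simp: kl pair_axis_def inner_real2 axis_def \<kappa>_def)
    next
      fix i j assume kl: "k = Inr i" "l = Inr j"
      assume "hessian (FK (pentagon t b)) (0, 0) $ k $ l = ?H (pair_axis k) \<bullet> pair_axis l"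
      then show ?thesis using ij[of i] ij[of j] by (auto simp: kl pair_axis_def inner_real2 axis_def \<kappa>_def)
    qed
  qed
  assume k: "0 < \<kappa> 1" "\<kappa> 1 < 1"
  have A: "0 < 3 * area\<^sup>2" using area_pos by simp
  let ?v = "(pt 1 0, 0 :: real^2)" and ?w = "(pt 1 0, pt 1 0)"
  have Hv: "?H ?v \<bullet> ?v = 3 * area\<^sup>2 * \<kappa> 1" by (simp add: inner_real2 \<kappa>_def)
  have Hw: "?H ?w \<bullet> ?w = 3 * area\<^sup>2 * (2 * (\<kappa> 1 - 1))" by (simp add: inner_real2 \<kappa>_def algebra_simps)
  have pos: "?H ?v \<bullet> ?v > 0" unfolding Hv by (rule mult_pos_pos[OF A k(1)])
  have neg: "?H ?w \<bullet> ?w < 0" unfolding Hw by (rule mult_pos_neg[OF A]) (use k(2) in simp)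
  show "saddle_point (FK (pentagon t b)) (0, 0)"
    using saddle_point_from_gradient[OF G(1,3,2) pos neg] by (simp add: zero_prod_def)
qed

text \<open>The Hessian is a multiple of the direct sum of the matrices with rows \<open>(k, -1)\<close> and \<open>(-1, k)\<close>, for
  \<open>k = k1\<close> and \<open>k = k2\<close>, whose determinants are \<open>k\<^sup>2 - 1\<close>.\<close>

lemma hessian_indefinite:
  assumes bal: "balance t b = 0" and x: "0 < moment_x" "4 * moment_x < area" and y: "0 < moment_y" "4 * moment_y < area"
  shows "invertible (hessian (FK (pentagon t b)) (0, 0))"
    and "\<not> positive_definite (hessian (FK (pentagon t b)) (0, 0))"
    and "\<not> negative_definite (hessian (FK (pentagon t b)) (0, 0))"
    and "saddle_point (FK (pentagon t b)) (0, 0)"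
proof -
  define A where "A = hessian (FK (pentagon t b)) (0, 0)"
  define k1 where "k1 = 4 * (moment_x / area)"
  define k2 where "k2 = 4 * (moment_y / area)"
  define m where "m = 3 * area\<^sup>2"
  have m: "m > 0" using area_pos by (simp add: m_def)
  have k: "0 < k1" "k1 < 1" "0 < k2" "k2 < 1" using x y area_pos by (simp_all add: k1_def k2_def)
  note ent = FK_pentagon_hessian(2)[OF bal, folded A_def m_def]
  have sum4: "(\<Sum>l\<in>UNIV. f l) = f (Inl 1) + f (Inl 2) + (f (Inr 1) + f (Inr 2))" for f :: "2 + 2 \<Rightarrow> real"
    unfolding UNIV_Plus_UNIV[symmetric] by (subst sum.Plus) (simp_all add: sum_2)
  have rows: "(A *v v) $ Inl 1 = m * (k1 * v $ Inl 1 - v $ Inr 1)" "(A *v v) $ Inl 2 = m * (k2 * v $ Inl 2 - v $ Inr 2)"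
    "(A *v v) $ Inr 1 = m * (k1 * v $ Inr 1 - v $ Inl 1)" "(A *v v) $ Inr 2 = m * (k2 * v $ Inr 2 - v $ Inl 2)" for v
    unfolding matrix_vector_mult_def sum4 ent by (simp_all add: k1_def k2_def right_diff_distrib)
  have "v = 0" if v: "A *v v = 0" for v
  proof -
    have e: "k1 * v $ Inl 1 = v $ Inr 1" "k2 * v $ Inl 2 = v $ Inr 2" "k1 * v $ Inr 1 = v $ Inl 1" "k2 * v $ Inr 2 = v $ Inl 2"
      using rows[of v] m unfolding v by simp_all
    have "k1 * k1 < 1 * 1" "k2 * k2 < 1 * 1" using k by (intro mult_strict_mono; simp)+
    then have "(1 - k1 * k1) \<noteq> 0" "(1 - k2 * k2) \<noteq> 0" by auto
    moreover have "(1 - k1 * k1) * v $ Inl 1 = 0" "(1 - k2 * k2) * v $ Inl 2 = 0"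
      using e by (simp_all add: algebra_simps)
    ultimately have "v $ Inl 1 = 0" "v $ Inl 2 = 0" by simp_all
    with e have z: "v $ Inl 1 = 0" "v $ Inl 2 = 0" "v $ Inr 1 = 0" "v $ Inr 2 = 0" by simp_all
    have "v $ i = 0" for i
    proof (cases i)
      case (Inl j) then show ?thesis using z exhaust_2[of j] by auto
    next
      case (Inr j) then show ?thesis using z exhaust_2[of j] by auto
    qed
    then show ?thesis by (simp add: vec_eq_iff)
  qed
  then show "invertible (hessian (FK (pentagon t b)) (0, 0))"
    unfolding A_def[symmetric] invertible_left_inverse matrix_left_invertible_ker by blast
  have quad: "v \<bullet> (A *v v) = v $ Inl 1 * (A *v v) $ Inl 1 + v $ Inl 2 * (A *v v) $ Inl 2
     + (v $ Inr 1 * (A *v v) $ Inr 1 + v $ Inr 2 * (A *v v) $ Inr 2)" for v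
    unfolding inner_vec_def sum4 by simp
  let ?v = "axis (Inl 1) 1 :: real^(2 + 2)"
  let ?w = "axis (Inl 1) 1 + axis (Inr 1) 1 :: real^(2 + 2)"
  have v: "?v \<bullet> (A *v ?v) = m * k1" unfolding quad rows by (simp add: axis_def)
  have v0: "?v \<noteq> 0" by (simp add: axis_eq_0_iff)
  show "\<not> negative_definite (hessian (FK (pentagon t b)) (0, 0))"
  proof
    assume "negative_definite (hessian (FK (pentagon t b)) (0, 0))"
    then have "?v \<bullet> (A *v ?v) < 0" using v0 unfolding A_def negative_definite_def by blast
    then show False using mult_pos_pos[OF m k(1)] v by linarith
  qed
  have w: "?w \<bullet> (A *v ?w) = m * (2 * (k1 - 1))" unfolding quad rows by (simp add: axis_def algebra_simps)
  have "?w $ Inl 1 \<noteq> 0" by (simp add: axis_def)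
  then have w0: "?w \<noteq> 0" by (metis zero_index)
  show "\<not> positive_definite (hessian (FK (pentagon t b)) (0, 0))"
  proof
    assume "positive_definite (hessian (FK (pentagon t b)) (0, 0))"
    then have "?w \<bullet> (A *v ?w) > 0" using w0 unfolding A_def positive_definite_def by blast
    moreover have "m * (2 * (k1 - 1)) < 0" by (rule mult_pos_neg[OF m]) (use k in simp)
    ultimately show False using w by linarith
  qed
  show "saddle_point (FK (pentagon t b)) (0, 0)"
    by (rule FK_pentagon_hessian(3)[OF bal]) (use k in \<open>simp_all add: k1_def\<close>)
qed

end

section \<open>The second moments as polynomials\<close>

context self_polar_pentagon
begin

text \<open>In the invariants \<open>T = t\<^sup>2\<close> and \<open>s = b t\<close> one has \<open>T a\<^sup>2 = U\<close> and \<open>T a c = V\<close>, and the heights \<open>b + h\<close>,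
  \<open>t - b\<close> of the two trapezoids are \<open>s + 1\<close> and \<open>V\<close> up to the factor \<open>t\<close>. After clearing
  denominators, the moments become polynomials in \<open>T\<close> and \<open>s\<close>.\<close>

lemma scaled_moments:
  defines "T \<equiv> t\<^sup>2" and "s \<equiv> b * t"
  defines "U \<equiv> T + s\<^sup>2" and "V \<equiv> T - s"
  shows "T * (t * a * area) = (s + 1) * (U + V) + V * U"
    and "T ^ 3 * (1 + b\<^sup>2) * (t * a * (6 * moment_x)) = (s + 1) * (U ^ 3 + U\<^sup>2 * V + U * V\<^sup>2 + V ^ 3) + V * U ^ 3"
    and "T\<^sup>2 * (t * a * (6 * moment_y)) = (s + 1) * (V * (3 - 2 * s + s\<^sup>2) + U * (1 - 2 * s + 3 * s\<^sup>2))
       + V * (U * (3 * s\<^sup>2 + 2 * s * T + T\<^sup>2))"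
    and "T * (1 + b\<^sup>2) = U"
proof -
  have Th: "T * h = t" using th by (simp add: T_def power2_eq_square mult.assoc)
  have tb: "t * (b + h) = s + 1" using th by (simp add: s_def algebra_simps)
  have ttb: "t * (t - b) = V" by (simp add: V_def T_def s_def power2_eq_square algebra_simps)
  show TU': "T * (1 + b\<^sup>2) = U" by (simp add: U_def T_def s_def power2_eq_square algebra_simps)
  then have TU: "T * (a * a) = U" unfolding a_sq by (simp add: power2_eq_square)
  have TV: "T * (a * c) = V"
  proof -
    have "T * (a * c) = T - b * (T * h)" unfolding ac by (simp add: algebra_simps)
    then show ?thesis unfolding Th by (simp add: V_def s_def)
  qed
  have Th2: "T * h\<^sup>2 = 1"
  proof -
    have "T * h\<^sup>2 = (t * h)\<^sup>2" by (simp add: T_def power_mult_distrib)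
    then show ?thesis by (simp add: th)
  qed
  have Tb2: "T * b\<^sup>2 = s\<^sup>2" by (simp add: T_def s_def power_mult_distrib)
  have Tbh: "T * (h * b) = s" using Th by (simp add: s_def mult.assoc[symmetric])
  have "T * (t * a * area) = (t * (b + h)) * (T * (a * c) + T * (a * a)) + (t * (t - b)) * (T * (a * a))"
    by (simp add: area_def algebra_simps)
  also have "\<dots> = (s + 1) * (U + V) + V * U" unfolding tb ttb TU TV by simp
  finally show "T * (t * a * area) = (s + 1) * (U + V) + V * U" .
  have "T ^ 3 * (a * a) * (t * a * (6 * moment_x))
     = (t * (b + h)) * ((T * (a * a)) ^ 3 + (T * (a * a))\<^sup>2 * (T * (a * c)) + (T * (a * a)) * (T * (a * c))\<^sup>2 + (T * (a * c)) ^ 3)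
       + (t * (t - b)) * (T * (a * a)) ^ 3"
    by (simp add: moment_x_def power2_eq_square power3_eq_cube algebra_simps)
  also have "\<dots> = (s + 1) * (U ^ 3 + U\<^sup>2 * V + U * V\<^sup>2 + V ^ 3) + V * U ^ 3" unfolding tb ttb TU TV by simp
  finally show "T ^ 3 * (1 + b\<^sup>2) * (t * a * (6 * moment_x)) = (s + 1) * (U ^ 3 + U\<^sup>2 * V + U * V\<^sup>2 + V ^ 3) + V * U ^ 3"
    unfolding a_sq by (simp add: power2_eq_square)
  have six: "6 * moment_y = (b + h) * (c * (3 * h\<^sup>2 - 2 * h * b + b\<^sup>2) + a * (h\<^sup>2 - 2 * h * b + 3 * b\<^sup>2))
      + (t - b) * (a * (3 * b\<^sup>2 + 2 * b * t + t\<^sup>2))"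
    by (simp add: moment_y_def)
  have "T\<^sup>2 * (t * a * (6 * moment_y))
     = (t * (b + h)) * ((T * (a * c)) * (3 * (T * h\<^sup>2) - 2 * (T * (h * b)) + T * b\<^sup>2)
          + (T * (a * a)) * (T * h\<^sup>2 - 2 * (T * (h * b)) + 3 * (T * b\<^sup>2)))
       + (t * (t - b)) * ((T * (a * a)) * (3 * (T * b\<^sup>2) + 2 * (T * (b * t)) + T * t\<^sup>2))"
    unfolding six by (simp add: power2_eq_square algebra_simps)
  also have "\<dots> = (s + 1) * (V * (3 - 2 * s + s\<^sup>2) + U * (1 - 2 * s + 3 * s\<^sup>2))
       + V * (U * (3 * s\<^sup>2 + 2 * s * T + T\<^sup>2))"
    unfolding tb ttb TU TV Th2 Tbh Tb2 by (simp add: s_def[symmetric] T_def[symmetric] power2_eq_square[of T] mult.assoc)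
  finally show "T\<^sup>2 * (t * a * (6 * moment_y)) = (s + 1) * (V * (3 - 2 * s + s\<^sup>2) + U * (1 - 2 * s + 3 * s\<^sup>2))
       + V * (U * (3 * s\<^sup>2 + 2 * s * T + T\<^sup>2))" .
qed

lemma moments_pos:
  assumes "0 < b"
  shows "0 < moment_x" "0 < moment_y"
proof -
  have bh: "0 < b + h" using assms h_pos by simp
  have "0 < (b + h) * (c ^ 3 + c\<^sup>2 * a + c * a\<^sup>2 + a ^ 3)"
    by (rule mult_pos_pos[OF bh]) (use c_nonneg a_pos in \<open>auto intro!: add_nonneg_pos add_nonneg_nonneg\<close>)
  moreover have "0 \<le> (t - b) * a ^ 3" using b_upper a_pos by simp
  ultimately show "0 < moment_x" by (simp add: moment_x_def)
  have 1: "3 * h\<^sup>2 - 2 * h * b + b\<^sup>2 = 2 * h\<^sup>2 + (h - b)\<^sup>2" "h\<^sup>2 - 2 * h * b + 3 * b\<^sup>2 = 2 * b\<^sup>2 + (h - b)\<^sup>2"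
    by (simp_all add: power2_eq_square algebra_simps)
  have "0 < (b + h) * (c * (2 * h\<^sup>2 + (h - b)\<^sup>2) + a * (2 * b\<^sup>2 + (h - b)\<^sup>2))"
  proof (rule mult_pos_pos[OF bh add_nonneg_pos])
    show "0 \<le> c * (2 * h\<^sup>2 + (h - b)\<^sup>2)" using c_nonneg by simp
    show "0 < a * (2 * b\<^sup>2 + (h - b)\<^sup>2)" using a_pos assms by (simp add: add_pos_nonneg)
  qed
  moreover have "0 \<le> (t - b) * (a * (3 * b\<^sup>2 + 2 * b * t + t\<^sup>2))"
    using b_upper a_pos assms t_pos by simp
  ultimately show "0 < moment_y" unfolding moment_y_def 1 by simp
qed

text \<open>The expansion of the polynomials of \<open>scaled_moments\<close> around \<open>T = 2\<close>, \<open>s = -1\<close>, the values at the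
  triangle. Every term contains \<open>w\<^sup>2\<close> or \<open>d\<^sup>2\<close>, so \<open>18 w\<^sup>2 + 27 d\<^sup>2\<close> decides the sign near that point.\<close>

lemma moment_excess:
  defines "d \<equiv> 2 - t\<^sup>2" and "w \<equiv> 1 + b * t"
  shows "(t\<^sup>2) ^ 3 * (1 + b\<^sup>2) * (t * a) * (6 * moment_x + 6 * moment_y - 3 * area)
    = w\<^sup>2 * (18 - 42 * w + 36 * w\<^sup>2 - 16 * w ^ 3 + 4 * w ^ 4 + d * (- 21 + 29 * w - 20 * w\<^sup>2 + 6 * w ^ 3 - 2 * w ^ 4)
        + d\<^sup>2 * (29 - 9 * w + 3 * w\<^sup>2 + w ^ 3) + d ^ 3 * (- 14 + 2 * w - w\<^sup>2) + 2 * d ^ 4)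
      + d\<^sup>2 * (27 - 27 * w + d * (- 27 + 18 * w) + d\<^sup>2 * (9 - 3 * w) - d ^ 3)"
proof -
  define T where "T = t\<^sup>2"
  define s where "s = b * t"
  note m = scaled_moments[folded T_def s_def]
  have "T ^ 3 * (1 + b\<^sup>2) * (t * a) * (6 * moment_x + 6 * moment_y - 3 * area)
    = T ^ 3 * (1 + b\<^sup>2) * (t * a * (6 * moment_x)) + (T * (1 + b\<^sup>2)) * (T\<^sup>2 * (t * a * (6 * moment_y)))
      - 3 * T * (T * (1 + b\<^sup>2)) * (T * (t * a * area))"
    by (simp add: power2_eq_square power3_eq_cube algebra_simps)
  also have "\<dots> = (s + 1) * ((T + s\<^sup>2) ^ 3 + (T + s\<^sup>2)\<^sup>2 * (T - s) + (T + s\<^sup>2) * (T - s)\<^sup>2 + (T - s) ^ 3) + (T - s) * (T + s\<^sup>2) ^ 3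
     + (T + s\<^sup>2) * ((s + 1) * ((T - s) * (3 - 2 * s + s\<^sup>2) + (T + s\<^sup>2) * (1 - 2 * s + 3 * s\<^sup>2))
       + (T - s) * ((T + s\<^sup>2) * (3 * s\<^sup>2 + 2 * s * T + T\<^sup>2)))
     - 3 * T * (T + s\<^sup>2) * ((s + 1) * ((T + s\<^sup>2) + (T - s)) + (T - s) * (T + s\<^sup>2))"
    unfolding m ..
  finally have e: "T ^ 3 * (1 + b\<^sup>2) * (t * a) * (6 * moment_x + 6 * moment_y - 3 * area)
    = (s + 1) * ((T + s\<^sup>2) ^ 3 + (T + s\<^sup>2)\<^sup>2 * (T - s) + (T + s\<^sup>2) * (T - s)\<^sup>2 + (T - s) ^ 3) + (T - s) * (T + s\<^sup>2) ^ 3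
     + (T + s\<^sup>2) * ((s + 1) * ((T - s) * (3 - 2 * s + s\<^sup>2) + (T + s\<^sup>2) * (1 - 2 * s + 3 * s\<^sup>2))
       + (T - s) * ((T + s\<^sup>2) * (3 * s\<^sup>2 + 2 * s * T + T\<^sup>2)))
     - 3 * T * (T + s\<^sup>2) * ((s + 1) * ((T + s\<^sup>2) + (T - s)) + (T - s) * (T + s\<^sup>2))" .
  have Td: "T = 2 - d" "s = w - 1" by (simp_all add: T_def d_def s_def w_def)
  show ?thesis unfolding T_def[symmetric] e unfolding Td by algebra
qed

text \<open>At \<open>t = 1\<close> the equation \<open>balance 1 b = 0\<close> reads \<open>b\<^sup>3 = 2 - 3b - 2b\<^sup>2\<close>. It reduces the two differences,
  up to positive factors, to the quadratics \<open>80b + 58b\<^sup>2 - 50\<close> and \<open>10b\<^sup>2 - 2\<close>.\<close>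

lemma moment_deficits_at_center:
  assumes t1: "t = 1" and bal: "balance t b = 0" and b47: "47 / 100 < b"
  shows "4 * moment_x < area" "4 * moment_y < area"
proof -
  have cubic: "b ^ 3 = 2 - 3 * b - 2 * b\<^sup>2" using bal by (simp add: balance_def t1)
  have area: "a * area = 3 + b\<^sup>2"
    using scaled_moments(1) by (simp add: t1 power2_eq_square algebra_simps)
  have mx: "(1 + b\<^sup>2) * (a * (6 * moment_x)) = (b + 1) * ((1 + b\<^sup>2) ^ 3 + (1 + b\<^sup>2)\<^sup>2 * (1 - b)
      + (1 + b\<^sup>2) * (1 - b)\<^sup>2 + (1 - b) ^ 3) + (1 - b) * (1 + b\<^sup>2) ^ 3"
    using scaled_moments(2) by (simp add: t1)
  have my: "a * (6 * moment_y) = (b + 1) * ((1 - b) * (3 - 2 * b + b\<^sup>2) + (1 + b\<^sup>2) * (1 - 2 * b + 3 * b\<^sup>2))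
       + (1 - b) * ((1 + b\<^sup>2) * (3 * b\<^sup>2 + 2 * b + 1))"
    using scaled_moments(3) by (simp add: t1)
  have b2: "(47 / 100)\<^sup>2 < b\<^sup>2" using b47 by (intro power_strict_mono) auto
  have "(1 + b\<^sup>2) * (a * (6 * (area - 4 * moment_x)))
      = 6 * (1 + b\<^sup>2) * (a * area) - 4 * ((1 + b\<^sup>2) * (a * (6 * moment_x)))"
    by (simp add: algebra_simps)
  also have "\<dots> = 80 * b + 58 * b\<^sup>2 - 50"
    unfolding area mx using cubic by algebra
  also have "\<dots> > 0" using b47 b2 by (simp add: power2_eq_square)
  finally have "0 < (1 + b\<^sup>2) * (a * (6 * (area - 4 * moment_x)))" .
  moreover have "0 < 1 + b\<^sup>2" by (simp add: add_pos_nonneg)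
  ultimately have "0 < a * (6 * (area - 4 * moment_x))" by (rule zero_less_mult_pos)
  then show "4 * moment_x < area" using a_pos by (simp add: zero_less_mult_iff)
  have "a * (6 * (area - 4 * moment_y)) = 6 * (a * area) - 4 * (a * (6 * moment_y))"
    by (simp add: algebra_simps)
  also have "\<dots> = 10 * b\<^sup>2 - 2"
    unfolding area my using cubic by algebra
  also have "\<dots> > 0" using b2 by (simp add: power2_eq_square)
  finally show "4 * moment_y < area"
    using a_pos by (simp add: zero_less_mult_iff)
qed

end

section \<open>Continuous dependence of roots and convex hulls\<close>

text \<open>If \<open>y\<close> lies on one side of the root at \<open>q\<close>, the sign of \<open>f q y\<close> tells so. The sign persists for
  parameters near \<open>q\<close>, and by monotonicity their roots lie on the same side of \<open>y\<close>.\<close>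

lemma continuous_on_root:
  fixes f :: "'a::topological_space \<Rightarrow> real \<Rightarrow> real"
  assumes root: "\<And>q. q \<in> S \<Longrightarrow> f q (r q) = 0"
    and mono: "\<And>q b b'. q \<in> S \<Longrightarrow> b < b' \<Longrightarrow> f q b < f q b'"
    and cont: "\<And>b. continuous_on S (\<lambda>q. f q b)"
  shows "continuous_on S r"
  unfolding continuous_on_def
proof (intro ballI order_tendstoI)
  fix q y assume q: "q \<in> S"
  have lim: "((\<lambda>q. f q y) \<longlongrightarrow> f q y) (at q within S)" using cont q by (auto simp: continuous_on_def)
  have inS: "\<forall>\<^sub>F q' in at q within S. q' \<in> S" by (simp add: eventually_at_filter)
  {
    assume "y < r q"
    then have "f q y < 0" using mono[OF q] root[OF q] by metis
    from order_tendstoD(2)[OF lim this] inS show "\<forall>\<^sub>F q' in at q within S. y < r q'"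
    proof eventually_elim
      case (elim q')
      show ?case
      proof (rule ccontr)
        assume "\<not> y < r q'"
        then have "f q' (r q') \<le> f q' y" using mono[OF elim(2), of "r q'" y] by (cases "r q' = y") auto
        then show False using elim root by force
      qed
    qed
  next
    assume "r q < y"
    then have "0 < f q y" using mono[OF q] root[OF q] by metis
    from order_tendstoD(1)[OF lim this] inS show "\<forall>\<^sub>F q' in at q within S. r q' < y"
    proof eventually_elim
      case (elim q')
      show ?case
      proof (rule ccontr)
        assume "\<not> r q' < y"
        then have "f q' y \<le> f q' (r q')" using mono[OF elim(2), of y "r q'"] by (cases "r q' = y") auto
        then show False using elim root by force
      qed
    qed
  }
qed

text \<open>The closed \<open>e\<close>-neighbourhood of a convex hull is convex.\<close>

lemma convex_hull_near:
  fixes v w :: "'i \<Rightarrow> 'a::real_normed_vector"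
  assumes "\<And>i. i \<in> I \<Longrightarrow> dist (v i) (w i) \<le> e" "x \<in> convex hull (v ` I)"
  shows "\<exists>y\<in>convex hull (w ` I). dist x y \<le> e"
proof -
  let ?N = "\<Union>y\<in>convex hull (w ` I). \<Union>z\<in>cball 0 e. {y + z}"
  have "convex ?N" by (rule convex_sums) auto
  moreover have "v ` I \<subseteq> ?N"
  proof
    fix x assume "x \<in> v ` I"
    then obtain i where i: "i \<in> I" "x = v i" by auto
    have "v i = w i + (v i - w i)" by simp
    moreover have "v i - w i \<in> cball 0 e" using assms(1)[OF i(1)] by (simp add: dist_norm norm_minus_commute)
    moreover have "w i \<in> convex hull (w ` I)" using i by (auto intro: hull_inc)
    ultimately show "x \<in> ?N" using i by blast
  qed
  ultimately have "convex hull (v ` I) \<subseteq> ?N" by (rule hull_minimal[rotated])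
  then obtain y z where "y \<in> convex hull (w ` I)" "z \<in> cball 0 e" "x = y + z" using assms(2) by blast
  then show ?thesis by (intro bexI[of _ y]) (simp_all add: dist_norm)
qed

lemma hausdorff_dist_convex_hull:
  fixes v w :: "'i \<Rightarrow> 'a::real_normed_vector"
  assumes I: "I \<noteq> {}" and e: "\<And>i. i \<in> I \<Longrightarrow> dist (v i) (w i) \<le> e"
  shows "0 \<le> hausdorff_dist (convex hull (v ` I)) (convex hull (w ` I))"
    and "hausdorff_dist (convex hull (v ` I)) (convex hull (w ` I)) \<le> e"
proof -
  let ?A = "convex hull (v ` I)" and ?B = "convex hull (w ` I)"
  have ne: "?A \<noteq> {}" "?B \<noteq> {}" using I by auto
  have 1: "infdist x ?B \<le> e" if x: "x \<in> ?A" for x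
  proof -
    obtain y where "y \<in> ?B" "dist x y \<le> e" using convex_hull_near[OF e x] by blast
    then show ?thesis by (rule infdist_le2)
  qed
  have 2: "infdist x ?A \<le> e" if x: "x \<in> ?B" for x
  proof -
    obtain y where "y \<in> ?A" "dist x y \<le> e" using convex_hull_near[of I w v e x] e x by (metis dist_commute)
    then show ?thesis by (rule infdist_le2)
  qed
  show "hausdorff_dist ?A ?B \<le> e"
    unfolding hausdorff_dist_def using ne 1 2 by (auto intro: cSUP_least)
  obtain x where x: "x \<in> ?A" using ne(1) by blast
  have "0 \<le> infdist x ?B" by (rule infdist_nonneg)
  also have "\<dots> \<le> (SUP a\<in>?A. infdist a ?B)"
    by (rule cSUP_upper[OF x]) (rule bdd_aboveI2[OF 1])
  finally show "0 \<le> hausdorff_dist ?A ?B" unfolding hausdorff_dist_def by simp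
qed

lemma hausdorff_continuous_convex_hull:
  fixes v :: "'i \<Rightarrow> 't::topological_space \<Rightarrow> 'a::real_normed_vector"
  assumes I: "finite I" "I \<noteq> {}" and cont: "\<And>i. i \<in> I \<Longrightarrow> continuous_on S (v i)"
  shows "hausdorff_continuous_on S (\<lambda>q. convex hull ((\<lambda>i. v i q) ` I))"
  unfolding hausdorff_continuous_on_def
proof (intro ballI)
  fix q assume q: "q \<in> S"
  let ?H = "\<lambda>r. hausdorff_dist (convex hull ((\<lambda>i. v i r) ` I)) (convex hull ((\<lambda>i. v i q) ` I))"
  have lim: "((\<lambda>r. \<Sum>i\<in>I. dist (v i r) (v i q)) \<longlongrightarrow> 0) (at q within S)"
  proof (rule tendsto_null_sum)
    fix i assume "i \<in> I"
    then have "(v i \<longlongrightarrow> v i q) (at q within S)" using cont q by (auto simp: continuous_on_def)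
    then show "((\<lambda>r. dist (v i r) (v i q)) \<longlongrightarrow> 0) (at q within S)" by (simp add: tendsto_dist_iff[symmetric])
  qed
  have le: "dist (v i r) (v i q) \<le> (\<Sum>i\<in>I. dist (v i r) (v i q))" if "i \<in> I" for i r
    by (rule member_le_sum[OF that]) (use I in auto)
  show "(?H \<longlongrightarrow> 0) (at q within S)"
    by (rule tendsto_sandwich[OF _ _ tendsto_const lim])
       (auto intro!: always_eventually hausdorff_dist_convex_hull I le)
qed

section \<open>The one-parameter family\<close>

text \<open>The difference quotient of \<open>balance t\<close>, multiplied by \<open>t\<close>, is the quadratic polynomial
  \<open>x\<^sup>2 + x y + y\<^sup>2 + (T + 1)(x + y) + T + 2 / T\<close> in \<open>x = t b\<close> and \<open>y = t b'\<close>. Completing squares leaves the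
  constant \<open>(2 - T)(T\<^sup>2 + T + 3) / (3T)\<close>, which is nonnegative for \<open>T \<le> 2\<close>.\<close>

lemma balance_strict_mono:
  assumes t: "0 < t" "t\<^sup>2 \<le> 2" and b: "b < b'"
  shows "balance t b < balance t b'"
proof -
  define T where "T = t\<^sup>2"
  define \<sigma> where "\<sigma> = t * b + t * b'"
  define E where "E = (3 / 4) * (\<sigma> + 2 * (T + 1) / 3)\<^sup>2 + (t * b - t * b')\<^sup>2 / 4 + (2 - T) * (T\<^sup>2 + T + 3) / (3 * T)"
  have T: "0 < T" "T \<le> 2" using t by (auto simp: T_def)
  have "0 < (t * b - t * b')\<^sup>2" using t b by simp
  moreover have "0 \<le> (2 - T) * (T\<^sup>2 + T + 3) / (3 * T)" using T by simp
  ultimately have E: "0 < E" unfolding E_def by (simp add: add_nonneg_pos add_pos_nonneg)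
  have "E = T * (b\<^sup>2 + b * b' + b'\<^sup>2) + (T + 1) * \<sigma> + T + 2 / T"
  proof -
    have "E = (3 / 4) * (\<sigma> + 2 * (T + 1) / 3)\<^sup>2 + (t * b - t * b')\<^sup>2 / 4 + (2 / T + T - (T + 1)\<^sup>2 / 3)"
      unfolding E_def using T by (simp add: field_simps power2_eq_square)
    also have "\<dots> = T * (b\<^sup>2 + b * b' + b'\<^sup>2) + (T + 1) * \<sigma> + T + 2 / T"
      by (simp add: \<sigma>_def T_def power2_eq_square field_simps)
    finally show ?thesis .
  qed
  moreover have "t * (balance t b' - balance t b) = (b' - b) * (T * (b\<^sup>2 + b * b' + b'\<^sup>2) + (T + 1) * \<sigma> + T + 2 / T)"
    unfolding balance_def \<sigma>_def T_def using t by (simp add: power2_eq_square power3_eq_cube field_simps)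
  ultimately have "0 < t * (balance t b' - balance t b)" using E b by simp
  then show ?thesis using t by (simp add: zero_less_mult_iff)
qed

lemma balance_lower:
  assumes t: "0 < t"
  shows "balance t (- 1 / t) = (1 + 1 / t\<^sup>2) * (t\<^sup>2 - 2) * (t\<^sup>2 + 1) / t\<^sup>2"
  unfolding balance_def using t by (simp add: power2_eq_square power3_eq_cube field_simps)

lemma balance_upper:
  assumes t: "0 < t"
  shows "balance t t = (2 * t\<^sup>2 - 1) * (t\<^sup>2 + 1)\<^sup>2 / t\<^sup>2"
  unfolding balance_def using t by (simp add: power2_eq_square power3_eq_cube field_simps)

lemma isCont_balance: "isCont (balance t) b"
  unfolding balance_def[abs_def] by simp

lemma balance_root_exists:
  assumes t: "0 < t" "1 / 2 \<le> t\<^sup>2" "t\<^sup>2 \<le> 2"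
  shows "\<exists>!b. balance t b = 0" "\<exists>b. - 1 / t \<le> b \<and> b \<le> t \<and> balance t b = 0"
proof -
  have "balance t (- 1 / t) \<le> 0"
    unfolding balance_lower[OF t(1)] using t by (intro divide_nonpos_pos mult_nonpos_nonneg mult_nonneg_nonpos) auto
  moreover have "0 \<le> balance t t"
    unfolding balance_upper[OF t(1)] using t by (intro divide_nonneg_pos mult_nonneg_nonneg) auto
  moreover have "- 1 / t \<le> t"
    by (rule order_trans[of _ 0]) (use t(1) in auto)
  ultimately show ex: "\<exists>b. - 1 / t \<le> b \<and> b \<le> t \<and> balance t b = 0"
    using IVT[of "balance t" "- 1 / t" 0 t] isCont_balance by blast
  show "\<exists>!b. balance t b = 0"
    using ex balance_strict_mono[OF t(1,3)] by (metis less_irrefl linorder_neqE)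
qed

text \<open>The positive solution \<open>t\<close> of \<open>1 / t - t = q\<close>.\<close>

definition apex :: "real \<Rightarrow> real" where
  "apex q = (sqrt (q\<^sup>2 + 4) - q) / 2"

definition shoulder :: "real \<Rightarrow> real" where
  "shoulder q = (THE b. balance (apex q) b = 0)"

definition pentagon_path :: "real \<Rightarrow> (real^2) set" where
  "pentagon_path q = pentagon (apex q) (shoulder q)"

lemma apex_pos: "0 < apex q" and apex_eq: "apex q * (apex q + q) = 1"
proof -
  have "\<bar>q\<bar> < sqrt (q\<^sup>2 + 4)" by (rule real_less_rsqrt) simp
  then show "0 < apex q" by (simp add: apex_def)
  have "(sqrt (q\<^sup>2 + 4))\<^sup>2 = q\<^sup>2 + 4" by simp
  then show "apex q * (apex q + q) = 1"
    by (simp add: apex_def power2_eq_square field_simps)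
qed

lemma apex_unique: "0 < t \<Longrightarrow> t * (t + q) = 1 \<Longrightarrow> apex q = t"
proof -
  assume t: "0 < t" "t * (t + q) = 1"
  have "(apex q - t) * (apex q * t + 1) = 0"
    using apex_eq[of q] t(2) by algebra
  moreover have "apex q * t + 1 > 0" using apex_pos[of q] t by (simp add: add_pos_pos)
  ultimately show "apex q = t" by simp
qed

text \<open>For \<open>T = t\<^sup>2\<close> the relation \<open>q = 1 / t - t\<close> gives \<open>(2T - 1)(T - 2) = (2q\<^sup>2 - 1) T\<close>, so the bounds on
  \<open>T\<close> correspond to \<open>2q\<^sup>2 \<le> 1\<close>.\<close>

lemma apex_sq_bounds:
  shows "q \<in> {- 1 / sqrt 2..1 / sqrt 2} \<Longrightarrow> 1 / 2 \<le> (apex q)\<^sup>2 \<and> (apex q)\<^sup>2 \<le> 2"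
    and "q \<in> {- 1 / sqrt 2<..<1 / sqrt 2} \<Longrightarrow> 1 / 2 < (apex q)\<^sup>2 \<and> (apex q)\<^sup>2 < 2"
proof -
  define T where "T = (apex q)\<^sup>2"
  have T: "0 < T" using apex_pos[of q] by (simp add: T_def)
  have q2: "q\<^sup>2 * T = (1 - T)\<^sup>2"
  proof -
    have "q * apex q = 1 - T" using apex_eq[of q] by (simp add: T_def power2_eq_square algebra_simps)
    then have "(q * apex q)\<^sup>2 = (1 - T)\<^sup>2" by simp
    then show ?thesis by (simp add: T_def power_mult_distrib)
  qed
  have half: "(1 / sqrt 2)\<^sup>2 = 1 / (2::real)" by (simp add: power_divide)
  have key: "(2 * T - 1) * (T - 2) = (2 * q\<^sup>2 - 1) * T"
    using q2 by (simp add: power2_eq_square algebra_simps)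
  {
    assume "q \<in> {- 1 / sqrt 2..1 / sqrt 2}"
    then have "\<bar>q\<bar> \<le> 1 / sqrt 2" by (simp add: abs_le_iff)
    then have "\<bar>q\<bar>\<^sup>2 \<le> (1 / sqrt 2)\<^sup>2" by (intro power_mono) auto
    then have "(2 * T - 1) * (T - 2) \<le> 0" unfolding key half using T by (intro mult_nonpos_nonneg) auto
    then show "1 / 2 \<le> (apex q)\<^sup>2 \<and> (apex q)\<^sup>2 \<le> 2" unfolding T_def[symmetric]
      by (auto simp: mult_le_0_iff)
  next
    assume "q \<in> {- 1 / sqrt 2<..<1 / sqrt 2}"
    then have "\<bar>q\<bar> < 1 / sqrt 2" by (simp add: abs_less_iff)
    then have "\<bar>q\<bar>\<^sup>2 < (1 / sqrt 2)\<^sup>2" by (intro power_strict_mono) auto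
    then have "(2 * T - 1) * (T - 2) < 0" unfolding key half using T by (intro mult_neg_pos) auto
    then show "1 / 2 < (apex q)\<^sup>2 \<and> (apex q)\<^sup>2 < 2" unfolding T_def[symmetric]
      by (auto simp: mult_less_0_iff)
  }
qed

lemma shoulder:
  assumes "q \<in> {- 1 / sqrt 2..1 / sqrt 2}"
  shows "balance (apex q) (shoulder q) = 0" and "self_polar_pentagon (apex q) (shoulder q)"
    and "balance (apex q) b = 0 \<Longrightarrow> shoulder q = b"
proof -
  note T = apex_pos[of q] conjunct1[OF apex_sq_bounds(1)[OF assms]] conjunct2[OF apex_sq_bounds(1)[OF assms]]
  note ex = balance_root_exists[OF T]
  show root: "balance (apex q) (shoulder q) = 0" unfolding shoulder_def by (rule theI'[OF ex(1)])
  show uniq: "balance (apex q) b = 0 \<Longrightarrow> shoulder q = b" for b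
    using ex(1) root by blast
  obtain b where b: "- 1 / apex q \<le> b" "b \<le> apex q" "balance (apex q) b = 0" using ex(2) by blast
  show "self_polar_pentagon (apex q) (shoulder q)"
    using b apex_pos[of q] uniq[OF b(3)] by (simp add: self_polar_pentagon_def)
qed

lemma shoulder_strict:
  assumes q: "q \<in> {- 1 / sqrt 2<..<1 / sqrt 2}"
  shows "- 1 / apex q < shoulder q" "shoulder q < apex q"
proof -
  have q': "q \<in> {- 1 / sqrt 2..1 / sqrt 2}" using q by simp
  note T = apex_pos[of q] apex_sq_bounds(2)[OF q]
  interpret self_polar_pentagon "apex q" "shoulder q" by (rule shoulder(2)[OF q'])
  have "balance (apex q) (- 1 / apex q) < 0"
    unfolding balance_lower[OF T(1)] using T by (intro divide_neg_pos mult_neg_pos mult_pos_neg) (auto simp: add_pos_pos)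
  then show "- 1 / apex q < shoulder q" using shoulder(1)[OF q'] b_lower by (metis less_irrefl order_le_less)
  have "0 < balance (apex q) (apex q)"
    unfolding balance_upper[OF T(1)] using T by (intro divide_pos_pos mult_pos_pos) (auto simp: zero_less_power add_pos_nonneg)
  then show "shoulder q < apex q" using shoulder(1)[OF q'] b_upper by (metis less_irrefl order_le_less)
qed

lemma continuous_on_apex: "continuous_on A apex"
  unfolding apex_def[abs_def] by (intro continuous_intros) simp

lemma continuous_on_shoulder: "continuous_on {- 1 / sqrt 2..1 / sqrt 2} shoulder"
proof (rule continuous_on_root[where f = "\<lambda>q. balance (apex q)"])
  fix q :: real assume q: "q \<in> {- 1 / sqrt 2..1 / sqrt 2}"
  show "balance (apex q) (shoulder q) = 0" by (rule shoulder(1)[OF q])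
  show "balance (apex q) b < balance (apex q) b'" if "b < b'" for b b'
    using balance_strict_mono[OF apex_pos _ that] apex_sq_bounds(1)[OF q] by simp
next
  have nz: "apex q \<noteq> 0" for q using apex_pos[of q] by simp
  show "continuous_on {- 1 / sqrt 2..1 / sqrt 2} (\<lambda>q. balance (apex q) b)" for b
    unfolding balance_def by (intro continuous_intros continuous_on_apex) (simp_all add: nz)
qed

lemma hausdorff_continuous_pentagon_path: "hausdorff_continuous_on {- 1 / sqrt 2..1 / sqrt 2} pentagon_path"
proof -
  let ?S = "{- 1 / sqrt 2..1 / sqrt 2 :: real}"
  let ?a = "\<lambda>q. half_top (shoulder q)" and ?c = "\<lambda>q. half_bottom (apex q) (shoulder q)"
  let ?V = "{\<lambda>q. pt 0 (apex q), \<lambda>q. pt (?a q) (shoulder q), \<lambda>q. pt (- ?a q) (shoulder q),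
     \<lambda>q. pt (?c q) (- 1 / apex q), \<lambda>q. pt (- ?c q) (- 1 / apex q)}"
  have nz: "apex q \<noteq> 0" for q using apex_pos[of q] by simp
  have nz2: "1 + (b::real)\<^sup>2 \<noteq> 0" for b using add_pos_nonneg[of 1 "b\<^sup>2"] by simp
  note cs = continuous_on_shoulder and ca = continuous_on_apex
  have ct: "continuous_on ?S ?a" unfolding half_top_def by (intro continuous_intros cs)
  have cb: "continuous_on ?S ?c" unfolding half_bottom_def half_top_def
    by (intro continuous_intros cs ca) (simp_all add: nz nz2)
  have ch: "continuous_on ?S (\<lambda>q. - 1 / apex q)" by (intro continuous_intros ca) (simp add: nz)
  have "hausdorff_continuous_on ?S (\<lambda>q. convex hull ((\<lambda>i. i q) ` ?V))"
    by (rule hausdorff_continuous_convex_hull)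
       (use ct cb ch cs ca in \<open>auto intro!: continuous_on_pt continuous_on_minus continuous_on_const\<close>)
  moreover have "(\<lambda>q. convex hull ((\<lambda>i. i q) ` ?V)) = pentagon_path"
    by (simp add: pentagon_path_def[abs_def] pentagon_def vertices_def)
  ultimately show ?thesis by simp
qed

section \<open>Saddle point and behaviour near the triangle\<close>

lemma left_end: "apex (- 1 / sqrt 2) = sqrt 2" "shoulder (- 1 / sqrt 2) = - 1 / sqrt 2"
proof -
  show a: "apex (- 1 / sqrt 2) = sqrt 2"
    by (rule apex_unique) (simp_all add: right_diff_distrib)
  have "balance (sqrt 2) (- 1 / sqrt 2) = 0"
    using balance_lower[of "sqrt 2"] by simp
  moreover have "- 1 / sqrt 2 \<in> {- 1 / sqrt 2..1 / sqrt (2::real)}" by simp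
  ultimately show "shoulder (- 1 / sqrt 2) = - 1 / sqrt 2"
    using shoulder(3)[of "- 1 / sqrt 2" "- 1 / sqrt 2"] a by simp
qed

lemma equilateral_left_end: "equilateral_triangle (pentagon_path (- 1 / sqrt 2))"
proof -
  let ?s = "sqrt (3 / 2)" and ?y = "- 1 / sqrt 2"
  have top: "half_top ?y = ?s"
    by (simp add: half_top_def power_divide)
  have bot: "half_bottom (sqrt 2) ?y = ?s"
  proof -
    have "1 - ?y / sqrt 2 = 3 / 2" by simp
    then show ?thesis unfolding half_bottom_def top by (simp only: real_div_sqrt)
  qed
  have "pentagon_path ?y = convex hull {pt 0 (sqrt 2), pt ?s ?y, pt (- ?s) ?y}"
    unfolding pentagon_path_def left_end pentagon_def vertices_def top bot by (simp add: insert_commute)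
  moreover have "dist (pt 0 (sqrt 2)) (pt ?s ?y) = sqrt 6" "dist (pt ?s ?y) (pt (- ?s) ?y) = sqrt 6"
    "dist (pt (- ?s) ?y) (pt 0 (sqrt 2)) = sqrt 6"
  proof -
    have e: "(sqrt 2 + 1 / sqrt 2)\<^sup>2 = 9 / 2" "(- 1 / sqrt 2 - sqrt 2)\<^sup>2 = 9 / 2"
      by (simp_all add: power2_sum power2_diff power_divide)
    show "dist (pt 0 (sqrt 2)) (pt ?s ?y) = sqrt 6" "dist (pt ?s ?y) (pt (- ?s) ?y) = sqrt 6"
      "dist (pt (- ?s) ?y) (pt 0 (sqrt 2)) = sqrt 6"
      using e by (simp_all add: dist_norm norm_real2 power_mult_distrib)
  qed
  moreover have "pt 0 (sqrt 2) \<noteq> pt ?s ?y" by (simp add: pt_eq_iff)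
  ultimately show ?thesis unfolding equilateral_triangle_def by metis
qed

lemma trace_left_end:
  "trace (cov (pentagon_path (- 1 / sqrt 2)) ** cov (polar (pentagon_path (- 1 / sqrt 2)))) = 1 / 8"
proof -
  have "- 1 / sqrt 2 \<in> {- 1 / sqrt 2..1 / sqrt (2::real)}" by simp
  from shoulder(2)[OF this] interpret self_polar_pentagon "sqrt 2" "- 1 / sqrt 2"
    unfolding left_end .
  define k where "k = sqrt 2 * a"
  have k: "k > 0" using a_pos by (simp add: k_def)
  have m: "k * area = 9 / 2" "k * moment_x = 9 / 8" "k * moment_y = 9 / 8"
    using scaled_moments(1-3) by (simp_all add: k_def power_divide algebra_simps)
  then have "k * (4 * moment_x) = k * area" "k * (4 * moment_y) = k * area" by linarith+
  then have "4 * moment_x = area" "4 * moment_y = area" using k by (simp_all only: mult_cancel_left, simp_all)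
  then have "moment_x = area / 4" "moment_y = area / 4" by simp_all
  then have "moment_x / area = 1 / 4" "moment_y / area = 1 / 4" using area_pos by simp_all
  then show ?thesis unfolding pentagon_path_def left_end trace_cov by (simp add: power2_eq_square)
qed

text \<open>The root of the cubic equation at \<open>t = 1\<close> is about \<open>0.478\<close>.\<close>

lemma shoulder_center: "apex 0 = 1" "47 / 100 < shoulder 0"
proof -
  show a: "apex 0 = 1" by (rule apex_unique) simp_all
  have I: "0 \<in> {- 1 / sqrt 2..1 / sqrt (2::real)}" by simp
  have "balance 1 (47 / 100) < 0" by (simp add: balance_def power2_eq_square power3_eq_cube)
  moreover have "balance 1 (shoulder 0) = 0" using shoulder(1)[OF I] by (simp add: a)
  ultimately have less: "balance 1 (47 / 100) < balance 1 (shoulder 0)" by simp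
  then have "shoulder 0 \<noteq> 47 / 100" by (metis less_irrefl)
  moreover have "\<not> shoulder 0 < 47 / 100"
    using less balance_strict_mono[of 1 "shoulder 0" "47 / 100"] by auto
  ultimately show "47 / 100 < shoulder 0" by linarith
qed

text \<open>By \<open>\<sigma>\<^sub>x\<^sup>2 + \<sigma>\<^sub>y\<^sup>2 \<ge> (\<sigma>\<^sub>x + \<sigma>\<^sub>y)\<^sup>2 / 2\<close> it suffices that \<open>\<sigma>\<^sub>x + \<sigma>\<^sub>y > 1/2\<close>, and the sign of the difference
  is read off from \<open>moment_excess\<close>, in which the two brackets tend to \<open>18\<close> and \<open>27\<close>.\<close>

lemma trace_near_left_end:
  "\<forall>\<^sub>F q in at_right (- 1 / sqrt 2). trace (cov (pentagon_path q) ** cov (polar (pentagon_path q))) > 1 / 8"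
proof -
  let ?I = "{- 1 / sqrt 2..1 / sqrt 2 :: real}" and ?l = "- 1 / sqrt (2::real)"
  define d where "d q = 2 - (apex q)\<^sup>2" for q
  define w where "w q = 1 + shoulder q * apex q" for q
  have lt: "?l < 1 / sqrt 2" by (rule less_trans[of _ 0]) auto
  have cd: "continuous_on ?I d" unfolding d_def by (intro continuous_intros continuous_on_apex)
  have cw: "continuous_on ?I w" unfolding w_def by (intro continuous_intros continuous_on_apex continuous_on_shoulder)
  have l0: "d ?l = 0" "w ?l = 0" unfolding d_def w_def left_end by simp_all
  let ?A = "\<lambda>d w::real. 18 - 42 * w + 36 * w\<^sup>2 - 16 * w ^ 3 + 4 * w ^ 4 + d * (- 21 + 29 * w - 20 * w\<^sup>2 + 6 * w ^ 3 - 2 * w ^ 4)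
        + d\<^sup>2 * (29 - 9 * w + 3 * w\<^sup>2 + w ^ 3) + d ^ 3 * (- 14 + 2 * w - w\<^sup>2) + 2 * d ^ 4"
  let ?B = "\<lambda>d w::real. 27 - 27 * w + d * (- 27 + 18 * w) + d\<^sup>2 * (9 - 3 * w) - d ^ 3"
  have at: "at ?l within ?I = at_right ?l" by (rule at_within_Icc_at_right[OF lt])
  have lI: "?l \<in> ?I" using lt by simp
  have lim: "(f \<longlongrightarrow> f ?l) (at_right ?l)" if "continuous_on ?I f" for f :: "real \<Rightarrow> real"
    using that lI unfolding continuous_on_def at[symmetric] by blast
  have "continuous_on ?I (\<lambda>q. ?A (d q) (w q))" by (intro continuous_intros cd cw)
  then have "((\<lambda>q. ?A (d q) (w q)) \<longlongrightarrow> ?A (d ?l) (w ?l)) (at_right ?l)"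
    by (rule lim)
  then have evA: "\<forall>\<^sub>F q in at_right ?l. 0 < ?A (d q) (w q)"
    by (rule order_tendstoD) (simp only: l0, simp)
  have "continuous_on ?I (\<lambda>q. ?B (d q) (w q))" by (intro continuous_intros cd cw)
  then have "((\<lambda>q. ?B (d q) (w q)) \<longlongrightarrow> ?B (d ?l) (w ?l)) (at_right ?l)"
    by (rule lim)
  then have evB: "\<forall>\<^sub>F q in at_right ?l. 0 < ?B (d q) (w q)"
    by (rule order_tendstoD) (simp only: l0, simp)
  have evI: "\<forall>\<^sub>F q in at_right ?l. q \<in> {?l<..<1 / sqrt 2}"
    using lt by (rule eventually_at_right_real)
  show ?thesis
    using evA evB evI
  proof eventually_elim
    case (elim q)
    then have "q \<in> ?I" by simp
    from shoulder(2)[OF this] interpret self_polar_pentagon "apex q" "shoulder q" .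
    have "0 < w q"
    proof -
      have "- 1 / apex q * apex q < shoulder q * apex q"
        by (rule mult_strict_right_mono[OF shoulder_strict(1)[OF elim(3)] apex_pos])
      then show ?thesis using apex_pos[of q] by (simp add: w_def)
    qed
    then have "0 < (w q)\<^sup>2 * ?A (d q) (w q) + (d q)\<^sup>2 * ?B (d q) (w q)"
      by (intro add_pos_nonneg mult_pos_pos[OF _ elim(1)] mult_nonneg_nonneg[OF _ less_imp_le[OF elim(2)]]) auto
    then have "0 < ((apex q)\<^sup>2) ^ 3 * (1 + (shoulder q)\<^sup>2) * (apex q * a) * (6 * moment_x + 6 * moment_y - 3 * area)"
      unfolding moment_excess d_def w_def .
    moreover have "0 < ((apex q)\<^sup>2) ^ 3 * (1 + (shoulder q)\<^sup>2) * (apex q * a)"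
      using apex_pos[of q] a_pos by (intro mult_pos_pos add_pos_nonneg zero_less_power) auto
    ultimately have "0 < 6 * moment_x + 6 * moment_y - 3 * area" by (rule zero_less_mult_pos)
    then have "1 / 2 < moment_x / area + moment_y / area"
      using area_pos by (simp add: field_simps)
    then have "(1 / 2)\<^sup>2 < (moment_x / area + moment_y / area)\<^sup>2" by (intro power_strict_mono) auto
    also have "\<dots> \<le> 2 * ((moment_x / area)\<^sup>2 + (moment_y / area)\<^sup>2)"
      using zero_le_power2[of "moment_x / area - moment_y / area"] by (simp add: power2_eq_square algebra_simps)
    finally have "(1 / 2)\<^sup>2 < 2 * ((moment_x / area)\<^sup>2 + (moment_y / area)\<^sup>2)" .
    moreover have "1 / 8 < X" if "(1 / 2)\<^sup>2 < 2 * X" for X :: real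
      using that by (simp add: power2_eq_square)
    ultimately show ?case unfolding pentagon_path_def trace_cov by blast
  qed
qed

theorem theorem1p2:
  shows "\<exists>(\<Delta> :: (real ^ 2) set) (P :: real \<Rightarrow> (real ^ 2) set).
    equilateral_triangle \<Delta> \<and>
    (\<forall>q\<in>{- 1 / sqrt 2 .. 1 / sqrt 2}.
       convex_body (P q) \<and> 0 \<in> interior (P q) \<and> axially_symmetric (P q)) \<and>
    hausdorff_continuous_on {- 1 / sqrt 2 .. 1 / sqrt 2} P \<and>
    P (- 1 / sqrt 2) = \<Delta> \<and>
    (\<forall>q\<in>{- 1 / sqrt 2 <..< 1 / sqrt 2}. convex_ngon 5 (P q)) \<and>
    (\<exists>k\<le>5. convex_ngon k (P (1 / sqrt 2))) \<and>
    (\<forall>q\<in>{- 1 / sqrt 2 .. 1 / sqrt 2}. critical_point (FK (P q)) (0, 0)) \<and>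
    (twice_differentiable_at (FK (P 0)) (0, 0) \<and>
     invertible (hessian (FK (P 0)) (0, 0)) \<and>
     \<not> positive_definite (hessian (FK (P 0)) (0, 0)) \<and>
     \<not> negative_definite (hessian (FK (P 0)) (0, 0)) \<and>
     saddle_point (FK (P 0)) (0, 0)) \<and>
    (\<forall>\<^sub>F q in at_right (- 1 / sqrt 2).
       trace (cov (P q) ** cov (polar (P q))) > trace (cov \<Delta> ** cov (polar \<Delta>))) \<and>
    trace (cov \<Delta> ** cov (polar \<Delta>)) = 1 / 8"
proof (rule exI[of _ "pentagon_path (- 1 / sqrt 2)"], rule exI[of _ pentagon_path], intro conjI)
  show "equilateral_triangle (pentagon_path (- 1 / sqrt 2))" by (rule equilateral_left_end)
  show "\<forall>q\<in>{- 1 / sqrt 2 .. 1 / sqrt 2}. convex_body (pentagon_path q) \<and> 0 \<in> interior (pentagon_path q) \<and> axially_symmetric (pentagon_path q)"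
  proof
    fix q :: real assume "q \<in> {- 1 / sqrt 2 .. 1 / sqrt 2}"
    from shoulder(2)[OF this] interpret self_polar_pentagon "apex q" "shoulder q" .
    show "convex_body (pentagon_path q) \<and> 0 \<in> interior (pentagon_path q) \<and> axially_symmetric (pentagon_path q)"
      unfolding pentagon_path_def convex_body_def
      using convex_pentagon compact_pentagon zero_in_interior axially_symmetric_pentagon by auto
  qed
  show "hausdorff_continuous_on {- 1 / sqrt 2 .. 1 / sqrt 2} pentagon_path" by (rule hausdorff_continuous_pentagon_path)
  show "pentagon_path (- 1 / sqrt 2) = pentagon_path (- 1 / sqrt 2)" ..
  show "\<forall>q\<in>{- 1 / sqrt 2 <..< 1 / sqrt 2}. convex_ngon 5 (pentagon_path q)"
  proof
    fix q :: real assume q: "q \<in> {- 1 / sqrt 2 <..< 1 / sqrt 2}"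
    then have "q \<in> {- 1 / sqrt 2 .. 1 / sqrt 2}" by simp
    from shoulder(2)[OF this] interpret self_polar_pentagon "apex q" "shoulder q" .
    show "convex_ngon 5 (pentagon_path q)" unfolding pentagon_path_def by (rule convex_ngon_5[OF shoulder_strict[OF q]])
  qed
  show "\<exists>k\<le>5. convex_ngon k (pentagon_path (1 / sqrt 2))"
  proof -
    have "1 / sqrt 2 \<in> {- 1 / sqrt 2 .. 1 / sqrt (2::real)}" by simp
    from shoulder(2)[OF this] interpret self_polar_pentagon "apex (1 / sqrt 2)" "shoulder (1 / sqrt 2)" .
    show ?thesis unfolding pentagon_path_def by (rule convex_ngon_le_5)
  qed
  show "\<forall>q\<in>{- 1 / sqrt 2 .. 1 / sqrt 2}. critical_point (FK (pentagon_path q)) (0, 0)"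
  proof
    fix q :: real assume q: "q \<in> {- 1 / sqrt 2 .. 1 / sqrt 2}"
    from shoulder(2)[OF this] interpret self_polar_pentagon "apex q" "shoulder q" .
    show "critical_point (FK (pentagon_path q)) (0, 0)" unfolding pentagon_path_def by (rule critical_point_FK[OF shoulder(1)[OF q]])
  qed
  have I: "0 \<in> {- 1 / sqrt 2 .. 1 / sqrt (2::real)}" by simp
  from shoulder(2)[OF I] interpret self_polar_pentagon "apex 0" "shoulder 0" .
  note bal = shoulder(1)[OF I]
  have b: "0 < shoulder 0" using shoulder_center(2) by simp
  note deficits = moment_deficits_at_center[OF shoulder_center(1) bal shoulder_center(2)]
  note hess = hessian_indefinite[OF bal moments_pos(1)[OF b] deficits(1) moments_pos(2)[OF b] deficits(2)]
  show "twice_differentiable_at (FK (pentagon_path 0)) (0, 0)" unfolding pentagon_path_def by (rule FK_pentagon_hessian(1)[OF bal])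
  show "invertible (hessian (FK (pentagon_path 0)) (0, 0))" "\<not> positive_definite (hessian (FK (pentagon_path 0)) (0, 0))"
    "\<not> negative_definite (hessian (FK (pentagon_path 0)) (0, 0))" "saddle_point (FK (pentagon_path 0)) (0, 0)"
    unfolding pentagon_path_def by (fact hess)+
  show "trace (cov (pentagon_path (- 1 / sqrt 2)) ** cov (polar (pentagon_path (- 1 / sqrt 2)))) = 1 / 8" by (rule trace_left_end)
  show "\<forall>\<^sub>F q in at_right (- 1 / sqrt 2). trace (cov (pentagon_path q) ** cov (polar (pentagon_path q)))
      > trace (cov (pentagon_path (- 1 / sqrt 2)) ** cov (polar (pentagon_path (- 1 / sqrt 2))))"
    unfolding trace_left_end by (rule trace_near_left_end)
qed

end
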